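(* Let $\ell,t$ be positive integers, let $C = 8\cdot 22^2$, and let $M$ be a matroid with no $U_{2,\ell+2}$-minor. If $\varepsilon(M) > \ell^{C(\ell-1)^2 t^4\log t}\, r(M)$, then $M$ has an $M(K_t)$-minor.
   Context: Matroids are finite. $r(M)$ is the rank of $M$, and $\varepsilon(M)$ is the number of points (rank-$1$ flats) of $M$, i.e. the number of elements of the simplification of $M$. $M(K_t)$ is the cycle matroid of the complete graph $K_t$; "an $N$-minor" is a minor isomorphic to $N$. $\log$ is the natural logarithm. *)

theory Defs
  imports Complex_Main
begin

record 'a matroid =
  ground :: "'a set"
  indeps :: "'a set set"

locale finite_matroid =
  fixes M :: "'a matroid"
  assumes finite_ground: "finite (ground M)"
    and indeps_subset: "X \<in> indeps M \<Longrightarrow> X \<subseteq> ground M"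
    and empty_indep: "{} \<in> indeps M"
    and indep_mono: "\<lbrakk>X \<in> indeps M; Y \<subseteq> X\<rbrakk> \<Longrightarrow> Y \<in> indeps M"
    and augmentation: "\<lbrakk>X \<in> indeps M; Y \<in> indeps M; card X < card Y\<rbrakk>
      \<Longrightarrow> \<exists>y\<in>Y - X. insert y X \<in> indeps M"

definition rank_of :: "'a matroid \<Rightarrow> 'a set \<Rightarrow> nat" where
  "rank_of M X = Max (card ` {I \<in> indeps M. I \<subseteq> X})"

definition matroid_rank :: "'a matroid \<Rightarrow> nat" where
  "matroid_rank M = rank_of M (ground M)"

definition flat :: "'a matroid \<Rightarrow> 'a set \<Rightarrow> bool" where
  "flat M F \<longleftrightarrow> F \<subseteq> ground M \<and> (\<forall>e\<in>ground M - F. rank_of M (insert e F) > rank_of M F)"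

definition num_points :: "'a matroid \<Rightarrow> nat" where
  "num_points M = card {F. flat M F \<and> rank_of M F = 1}"

definition basis_of :: "'a matroid \<Rightarrow> 'a set \<Rightarrow> 'a set \<Rightarrow> bool" where
  "basis_of M X B \<longleftrightarrow> B \<in> indeps M \<and> B \<subseteq> X \<and> (\<forall>B'\<in>indeps M. B \<subseteq> B' \<and> B' \<subseteq> X \<longrightarrow> B' = B)"

definition deletion :: "'a matroid \<Rightarrow> 'a set \<Rightarrow> 'a matroid" where
  "deletion M D = \<lparr>ground = ground M - D, indeps = {I \<in> indeps M. I \<inter> D = {}}\<rparr>"

text \<open>In a matroid, whether a set is independent in the contraction does not depend on the basis
  \<open>B\<close> of the contracted set that is chosen, so the existential quantifier could equally be
  universal.\<close>

definition contraction :: "'a matroid \<Rightarrow> 'a set \<Rightarrow> 'a matroid" where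
  "contraction M C = \<lparr>ground = ground M - C,
     indeps = {I. I \<subseteq> ground M - C \<and> (\<exists>B. basis_of M C B \<and> I \<union> B \<in> indeps M)}\<rparr>"

definition matroid_iso :: "'a matroid \<Rightarrow> 'b matroid \<Rightarrow> bool" where
  "matroid_iso M N \<longleftrightarrow> (\<exists>f. bij_betw f (ground M) (ground N) \<and>
     (\<forall>X. X \<subseteq> ground M \<longrightarrow> (X \<in> indeps M \<longleftrightarrow> f ` X \<in> indeps N)))"

definition has_minor :: "'a matroid \<Rightarrow> 'b matroid \<Rightarrow> bool" where
  "has_minor M N \<longleftrightarrow> (\<exists>C D. C \<subseteq> ground M \<and> D \<subseteq> ground M \<and> C \<inter> D = {} \<and>
     matroid_iso (deletion (contraction M C) D) N)"

definition uniform_matroid :: "nat \<Rightarrow> nat \<Rightarrow> nat matroid" where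
  "uniform_matroid k n = \<lparr>ground = {..<n}, indeps = {X. X \<subseteq> {..<n} \<and> card X \<le> k}\<rparr>"

text \<open>A simple graph is represented by its set of edges, each a two-element set of vertices.  Isolated
  vertices are irrelevant to the cycle matroid, and every cycle has length at least three.\<close>

definition cycle_edge_set :: "'v set set \<Rightarrow> bool" where
  "cycle_edge_set X \<longleftrightarrow> (\<exists>vs. distinct vs \<and> 3 \<le> length vs \<and>
     X = {{vs ! i, vs ! ((i + 1) mod length vs)} | i. i < length vs})"

definition cycle_matroid :: "'v set set \<Rightarrow> 'v set matroid" where
  "cycle_matroid E = \<lparr>ground = E, indeps = {X. X \<subseteq> E \<and> \<not> (\<exists>Y\<subseteq>X. cycle_edge_set Y)}\<rparr>"

definition complete_graph_edges :: "nat \<Rightarrow> nat set set" where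
  "complete_graph_edges t = {e. e \<subseteq> {..<t} \<and> card e = 2}"

end

theory Submission
  imports Defs
begin

text \<open>
  Write \<open>d\<close> for the assumed lower bound on the ratio of points to rank, and call two points adjacent if their
  line has a third point.  Adjacency survives contraction as long as the two points do not become parallel, so
  that contraction acts on the graph of points like edge contraction on graphs, and Mader's argument applies
  to this graph: a contraction minor with a set \<open>S\<close> of points that maximizes the average degree
  \<open>q \<ge> d - 1\<close> contains a set of at most \<open>2 q\<close> points spanning about \<open>q\<^sup>2 / l\<^sup>3\<close> adjacent
  pairs.  As \<open>q\<close> exceeds the number of points of a flat of rank about \<open>n\<^sup>2 / 2\<close>, dependent random
  choice gives \<open>n\<close> independent points any two of which can be made adjacent by contracting one further point.
  This yields a frame matroid on \<open>n\<close> joints all of whose joint pairs span long lines, where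
  \<open>n = 60 (l - 1) t\<^sup>2 + 1\<close>.  In a frame matroid of maximal density the points on the lines at some joint form
  a dense graph under collinearity; dependent random choice once more links \<open>t - 1\<close> of them pairwise, and
  the linked points together with the contracted links represent \<open>M(K\<^sub>t)\<close>.
\<close>

section \<open>Contractions of rank functions\<close>

text \<open>No minor is constructed along the way: a minor is a contracted set \<open>C\<close> with
  a set of representatives of its points, and everything is said by ranks of unions with
  \<open>C\<close>; only \<open>has_minorI\<close> returns to matroids. What separates this from
  Mader's argument for graphs is that contraction of one point \<open>z\<close> may merge many pairs
  at once, and that the third point of a line may lie outside the set of maximal density. The
  constants: one point on the line of each pair of \<open>n\<close> joints gives a frame of density
  \<open>(n - 1) / 2 = 30 (l - 1) t^2\<close>. Linking \<open>k = t - 1\<close> points of a star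
  uses up one joint per point and three per pair, so with \<open>N = k + 3 + 3 (k choose 2)\<close>
  a density of \<open>20 (l - 1) N\<close> is wanted, and \<open>2 N <= 3 t^2\<close>. To obtain the
  \<open>n\<close> joints, spans of rank up to \<open>n + (n choose 2)\<close> must be avoided,
  which is \<open>1800 (l - 1)^2 t^4\<close> plus lower terms; \<open>1936 = 4 * 22^2\<close> leaves
  room for these and for polynomial factors, and \<open>ln t >= 1/2\<close> turns the 4 into the 8
  of the theorem.\<close>

locale rank_function =
  fixes E :: "'a set" and r :: "'a set \<Rightarrow> nat"
  assumes finite_E: "finite E"
    and r_empty: "r {} = 0"
    and r_insert_le: "r (insert x X) \<le> Suc (r X)"
    and r_mono: "X \<subseteq> Y \<Longrightarrow> r X \<le> r Y"
    and r_submod: "r (X \<union> Y) + r (X \<inter> Y) \<le> r X + r Y"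
    and r_restrict: "r (X \<inter> E) = r X"
begin

definition cl :: "'a set \<Rightarrow> 'a set" where
  "cl X = {x. r (insert x X) = r X}"

text \<open>
  The first argument \<open>C\<close> of the following notions is to be thought of as contracted: \<open>pw C x y\<close> says that
  \<open>x\<close> and \<open>y\<close> represent different points of the contraction, and \<open>tri C x y z\<close> that \<open>x, y, z\<close> represent
  different points on a line.  Elements outside \<open>E\<close> behave like loops, so that no carrier conditions are needed.
\<close>

definition pw :: "'a set \<Rightarrow> 'a \<Rightarrow> 'a \<Rightarrow> bool" where
  "pw C x y \<longleftrightarrow> r (insert x (insert y C)) = r C + 2"

definition tri :: "'a set \<Rightarrow> 'a \<Rightarrow> 'a \<Rightarrow> 'a \<Rightarrow> bool" where
  "tri C x y z \<longleftrightarrow> pw C x y \<and> pw C x z \<and> pw C y z \<and> r (insert x (insert y (insert z C))) = r C + 2"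

definition adj :: "'a set \<Rightarrow> 'a \<Rightarrow> 'a \<Rightarrow> bool" where
  "adj C x y \<longleftrightarrow> (\<exists>z. tri C x y z)"

definition simple :: "'a set \<Rightarrow> 'a set \<Rightarrow> bool" where
  "simple C S \<longleftrightarrow> (\<forall>x\<in>S. x \<notin> cl C) \<and> (\<forall>x\<in>S. \<forall>y\<in>S. x \<noteq> y \<longrightarrow> pw C x y)"

definition ind :: "'a set \<Rightarrow> 'a set \<Rightarrow> bool" where
  "ind C B \<longleftrightarrow> finite B \<and> r (C \<union> B) = r C + card B"

lemma cl_iff: "x \<in> cl X \<longleftrightarrow> r (insert x X) = r X"
  by (simp add: cl_def)

lemma r_le_insert: "r X \<le> r (insert x X)"
  by (rule r_mono) blast

lemma notin_cl_iff: "x \<notin> cl X \<longleftrightarrow> r (insert x X) = Suc (r X)"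
  unfolding cl_iff using r_insert_le[of x X] r_mono[OF subset_insertI[of X x]] by linarith

lemma cl_extensive: "X \<subseteq> cl X"
  by (auto simp: cl_iff insert_absorb)

lemma in_clI: "x \<in> X \<Longrightarrow> x \<in> cl X"
  using cl_extensive by blast

lemma cl_mono: assumes "X \<subseteq> Y" shows "cl X \<subseteq> cl Y"
proof
  fix x assume x: "x \<in> cl X"
  show "x \<in> cl Y"
  proof (cases "x \<in> Y")
    case False
    have "r (insert x X \<union> Y) + r (insert x X \<inter> Y) \<le> r (insert x X) + r Y"
      by (rule r_submod)
    moreover have "insert x X \<union> Y = insert x Y" using assms by auto
    moreover have "insert x X \<inter> Y = X" using assms False by auto
    ultimately show ?thesis using x r_le_insert[of Y x] by (auto simp: cl_iff)
  qed (rule in_clI)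
qed

lemma notin_E_in_cl: "x \<notin> E \<Longrightarrow> x \<in> cl X"
  using r_restrict[of "insert x X"] r_restrict[of X] by (simp add: cl_iff)

lemma r_union_finite_cl:
  assumes "finite Y" "Y \<subseteq> cl X" shows "r (X \<union> Y) = r X"
  using assms
proof (induction Y)
  case (insert y Y)
  have "y \<in> cl (X \<union> Y)" using insert.prems cl_mono[of X "X \<union> Y"] by auto
  then show ?case using insert by (simp add: cl_iff)
qed simp

lemma r_union_cl: assumes "Y \<subseteq> cl X" shows "r (X \<union> Y) = r X"
proof -
  have "r (X \<union> (Y \<inter> E)) = r X"
    using assms by (intro r_union_finite_cl) (auto intro: finite_subset[OF _ finite_E])
  moreover have "(X \<union> (Y \<inter> E)) \<inter> E = (X \<union> Y) \<inter> E" by blast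
  ultimately show ?thesis by (metis r_restrict)
qed

lemma r_cl: "r (cl X) = r X"
  using r_union_cl[of "cl X" X] cl_extensive[of X] by (simp add: Un_absorb1)

lemma r_le_of_subset_cl: "X \<subseteq> cl Y \<Longrightarrow> r X \<le> r Y"
  using r_mono[of X "cl Y"] by (simp add: r_cl)

lemma cl_cl: "cl (cl X) = cl X"
proof
  show "cl (cl X) \<subseteq> cl X"
  proof
    fix x assume "x \<in> cl (cl X)"
    then have "r (insert x (cl X)) = r X" by (simp add: cl_iff r_cl)
    then have "r (insert x X) \<le> r X" using r_mono[of "insert x X" "insert x (cl X)"] cl_extensive[of X] by auto
    then show "x \<in> cl X" using r_le_insert[of X x] by (auto simp: cl_iff)
  qed
qed (rule cl_extensive)

lemma cl_subset_clI: "X \<subseteq> cl Y \<Longrightarrow> cl X \<subseteq> cl Y"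
  using cl_mono[of X "cl Y"] by (simp add: cl_cl)

lemma in_cl_trans: "x \<in> cl X \<Longrightarrow> X \<subseteq> cl Y \<Longrightarrow> x \<in> cl Y"
  using cl_subset_clI by blast

lemma cl_monoD: "x \<in> cl X \<Longrightarrow> X \<subseteq> Y \<Longrightarrow> x \<in> cl Y"
  using cl_mono by blast

lemma cl_exchange:
  assumes "y \<in> cl (insert x X)" "y \<notin> cl X" shows "x \<in> cl (insert y X)"
proof -
  have "r (insert y (insert x X)) = r (insert x X)" "r (insert y X) = Suc (r X)"
    using assms by (auto simp: cl_iff notin_cl_iff[symmetric])
  then have "r (insert x (insert y X)) \<le> r (insert y X)"
    using r_insert_le[of x X] by (simp add: insert_commute)
  then show ?thesis using r_le_insert[of "insert y X" x] by (auto simp: cl_iff)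
qed

lemma r_insert_notin: "x \<notin> cl X \<Longrightarrow> r (insert x X) = Suc (r X)"
  by (simp add: notin_cl_iff)

lemma pw_iff: "pw C x y \<longleftrightarrow> x \<notin> cl C \<and> y \<notin> cl (insert x C)"
  unfolding pw_def notin_cl_iff using r_insert_le[of x C] r_insert_le[of y "insert x C"]
  by (auto simp: insert_commute)

lemma pw_sym: "pw C x y \<Longrightarrow> pw C y x"
  by (simp add: pw_def insert_commute)

lemma pw_commute: "pw C x y \<longleftrightarrow> pw C y x"
  by (auto intro: pw_sym)

lemma pw_neq: "pw C x y \<Longrightarrow> x \<noteq> y"
  by (auto simp: pw_iff in_clI)

lemma pwD: assumes "pw C x y"
  shows "x \<notin> cl C" "y \<notin> cl C" "y \<notin> cl (insert x C)" "x \<notin> cl (insert y C)"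
  using assms pw_sym[OF assms] by (auto simp: pw_iff)

lemma tri_iff: "tri C x y z \<longleftrightarrow> pw C x y \<and> pw C x z \<and> pw C y z \<and> z \<in> cl (insert x (insert y C))"
  unfolding tri_def cl_iff by (auto simp: pw_def insert_commute)

lemma tri_rot: "tri C x y z \<Longrightarrow> tri C y z x"
  by (auto simp: tri_def pw_commute insert_commute)

lemma tri_swap: "tri C x y z \<Longrightarrow> tri C y x z"
  by (auto simp: tri_def pw_commute insert_commute)

lemma tri_cl: assumes "tri C x y z"
  shows "z \<in> cl (insert x (insert y C))" "x \<in> cl (insert y (insert z C))" "y \<in> cl (insert x (insert z C))"
  using assms tri_rot[OF assms] tri_rot[OF tri_rot[OF assms]] by (auto simp: tri_iff insert_commute)

lemma adj_sym: "adj C x y \<Longrightarrow> adj C y x"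
  unfolding adj_def using tri_swap by blast

lemma adj_pw: "adj C x y \<Longrightarrow> pw C x y"
  unfolding adj_def tri_def by blast

lemma adj_neq: "adj C x y \<Longrightarrow> x \<noteq> y"
  using adj_pw pw_neq by blast

lemma tri_adj: assumes "tri C x y z" shows "adj C x y" "adj C y z" "adj C x z"
  using assms tri_rot[OF assms] tri_swap[OF tri_rot[OF tri_rot[OF assms]]] unfolding adj_def by blast+

lemma tri_in_E: assumes "tri C x y z" shows "x \<in> E" "y \<in> E" "z \<in> E"
  using assms notin_E_in_cl unfolding tri_iff pw_iff by blast+

text \<open>The third point cannot become a loop or parallel to \<open>x\<close>, as
  \<open>y\<close>, being spanned by \<open>x\<close> and \<open>z\<close>, would then do the same.
  Hence a contraction destroys an adjacency only by merging the pair or making one of its members a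
  loop.\<close>

lemma tri_mono:
  assumes "tri C x y z" "C \<subseteq> C'" "pw C' x y" shows "tri C' x y z"
proof -
  have z: "z \<in> cl (insert x (insert y C'))"
    by (rule cl_monoD[OF tri_cl(1)[OF assms(1)]]) (use assms in blast)
  have nx: "z \<notin> cl (insert x C')"
  proof
    assume a: "z \<in> cl (insert x C')"
    have "y \<in> cl (insert x C')"
      by (rule in_cl_trans[OF tri_cl(3)[OF assms(1)]]) (use a assms(2) in_clI in blast)
    then show False using assms(3) by (simp add: pw_iff)
  qed
  have ny: "z \<notin> cl (insert y C')"
  proof
    assume a: "z \<in> cl (insert y C')"
    have "x \<in> cl (insert y C')"
      by (rule in_cl_trans[OF tri_cl(2)[OF assms(1)]]) (use a assms(2) in_clI in blast)
    then show False using pw_sym[OF assms(3)] by (simp add: pw_iff)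
  qed
  show ?thesis unfolding tri_iff
    using assms(3) z nx ny pwD[OF assms(3)] by (auto simp: pw_iff)
qed

lemma adj_mono: "adj C x y \<Longrightarrow> C \<subseteq> C' \<Longrightarrow> pw C' x y \<Longrightarrow> adj C' x y"
  unfolding adj_def using tri_mono by blast

lemma simple_subset: "simple C S \<Longrightarrow> S' \<subseteq> S \<Longrightarrow> simple C S'"
  unfolding simple_def by blast

lemma simple_in_E: "simple C S \<Longrightarrow> S \<subseteq> E"
  unfolding simple_def using notin_E_in_cl by blast

lemma simple_finite: "simple C S \<Longrightarrow> finite S"
  using simple_in_E finite_E finite_subset by blast

lemma simple_pw: "simple C S \<Longrightarrow> x \<in> S \<Longrightarrow> y \<in> S \<Longrightarrow> x \<noteq> y \<Longrightarrow> pw C x y"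
  unfolding simple_def by blast

lemma simple_insert:
  assumes "simple C S" "x \<notin> cl C" "\<And>y. y \<in> S \<Longrightarrow> y \<notin> cl (insert x C)"
  shows "simple C (insert x S)"
  unfolding simple_def
proof (intro conjI ballI impI)
  fix u v assume "u \<in> insert x S" "v \<in> insert x S" "u \<noteq> v"
  then show "pw C u v"
    using assms by (auto simp: simple_def pw_iff[of C x] intro: pw_sym simple_pw)
qed (use assms in \<open>auto simp: simple_def\<close>)

text \<open>A maximal simple subset is a transversal of the parallel classes that meet
  \<open>S\<close>; this replaces simplification of the contraction.\<close>

lemma maximal_simple_ext:
  assumes "simple C S0" "S0 \<subseteq> S" "finite S"
  obtains T where "S0 \<subseteq> T" "T \<subseteq> S" "simple C T"
    "\<And>y. y \<in> S \<Longrightarrow> y \<notin> cl C \<Longrightarrow> \<exists>s\<in>T. y \<in> cl (insert s C)"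
proof -
  let ?A = "{T. S0 \<subseteq> T \<and> T \<subseteq> S \<and> simple C T}"
  have fin: "finite ?A" by (rule finite_subset[of _ "Pow S"]) (use assms in auto)
  have "S0 \<in> ?A" using assms by auto
  then have "?A \<noteq> {}" by blast
  from finite_has_maximal[OF fin this]
  obtain T where T: "T \<in> ?A" and max: "\<forall>U\<in>?A. T \<subseteq> U \<longrightarrow> T = U" by auto
  show thesis
  proof (rule that)
    show "S0 \<subseteq> T" "T \<subseteq> S" "simple C T" using T by auto
    fix y assume y: "y \<in> S" "y \<notin> cl C"
    show "\<exists>s\<in>T. y \<in> cl (insert s C)"
    proof (rule ccontr)
      assume n: "\<not> ?thesis"
      have "simple C (insert y T)"
      proof (rule simple_insert)
        show "simple C T" using T by auto
        show "y \<notin> cl C" by fact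
        fix s assume s: "s \<in> T"
        then have "y \<notin> cl (insert s C)" using n by blast
        moreover have "s \<notin> cl C" using T s by (auto simp: simple_def)
        ultimately show "s \<notin> cl (insert y C)" using cl_exchange by blast
      qed
      then have "insert y T \<in> ?A" using T y by auto
      then have "T = insert y T" using max by blast
      then have "y \<in> T" by blast
      then show False using n in_clI[of y "insert y C"] by blast
    qed
  qed
qed

lemma simple_empty: "simple C {}" by (simp add: simple_def)

lemma maximal_simple:
  assumes "finite S"
  shows "\<exists>T\<subseteq>S. simple C T \<and> (\<forall>y\<in>S. y \<notin> cl C \<longrightarrow> (\<exists>s\<in>T. y \<in> cl (insert s C)))"
  by (rule maximal_simple_ext[OF simple_empty empty_subsetI assms, of C]) blast

lemma parallel_sym: "y \<in> cl (insert x C) \<Longrightarrow> y \<notin> cl C \<Longrightarrow> x \<in> cl (insert y C)"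
  by (rule cl_exchange)

lemma parallel_trans: assumes "z \<in> cl (insert y C)" "y \<in> cl (insert x C)" shows "z \<in> cl (insert x C)"
  by (rule in_cl_trans[OF assms(1)]) (use assms(2) in_clI in blast)

lemma pw_parallel:
  assumes "pw C x y" "x' \<in> cl (insert x C)" "x' \<notin> cl C" shows "pw C x' y"
proof -
  have "y \<notin> cl (insert x' C)"
  proof
    assume "y \<in> cl (insert x' C)"
    then have "y \<in> cl (insert x C)" using assms(2) parallel_trans by blast
    then show False using assms(1) by (simp add: pw_iff)
  qed
  then show ?thesis using assms by (simp add: pw_iff)
qed

lemma tri_parallel:
  assumes "tri C x y z" "x' \<in> cl (insert x C)" "x' \<notin> cl C" shows "tri C x' y z"
proof -
  have p: "pw C x' y" "pw C x' z" "pw C y z" using assms pw_parallel by (auto simp: tri_iff)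
  have "x \<in> cl (insert x' C)" using assms parallel_sym by blast
  then have "insert x (insert y C) \<subseteq> cl (insert x' (insert y C))"
    using cl_mono[of "insert x' C" "insert x' (insert y C)"] by (auto intro: in_clI)
  then have "z \<in> cl (insert x' (insert y C))"
    by (rule in_cl_trans[OF tri_cl(1)[OF assms(1)]])
  then show ?thesis using p by (simp add: tri_iff)
qed

lemma adj_parallel:
  assumes "adj C x y" "x' \<in> cl (insert x C)" "x' \<notin> cl C" shows "adj C x' y"
  using assms tri_parallel unfolding adj_def by blast

lemma ind_finite: "ind C B \<Longrightarrow> finite B" by (simp add: ind_def)

lemma r_union_le_card: "finite B \<Longrightarrow> r (C \<union> B) \<le> r C + card B"
proof (induction B rule: finite_induct)
  case (insert x F)
  then show ?case using r_insert_le[of x "C \<union> F"] by simp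
qed simp

lemma ind_subset: assumes "ind C B" "B' \<subseteq> B" shows "ind C B'"
proof -
  have f: "finite B" "finite B'" using assms by (auto simp: ind_def finite_subset)
  have "C \<union> B = (C \<union> B') \<union> (B - B')" using assms(2) by auto
  then have "r (C \<union> B) \<le> r (C \<union> B') + card (B - B')"
    using r_union_le_card[of "B - B'" "C \<union> B'"] f by auto
  moreover have "card (B - B') = card B - card B'" "card B' \<le> card B"
    using f assms(2) by (auto simp: card_Diff_subset card_mono)
  ultimately show ?thesis
    using assms(1) r_union_le_card[OF f(2), of C] f by (auto simp: ind_def)
qed

lemma ind_insert: assumes "ind C B" "x \<notin> cl (C \<union> B)" shows "ind C (insert x B)"
proof -
  have "x \<notin> B" using assms(2) in_clI by blast
  then show ?thesis using assms r_insert_notin[OF assms(2)] by (simp add: ind_def)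
qed

lemma ind_notin_cl: assumes "ind C B" "X \<subseteq> B" "x \<in> B - X" shows "x \<notin> cl (C \<union> X)"
proof -
  have "ind C (insert x X)" "ind C X" using assms by (auto intro: ind_subset)
  then show ?thesis using assms(3) by (auto simp: ind_def notin_cl_iff)
qed

lemma ind_pw: assumes "ind C B" "x \<in> B" "y \<in> B" "x \<noteq> y" shows "pw C x y"
proof -
  have "ind C {x, y}" using ind_subset[OF assms(1)] assms by auto
  then show ?thesis using assms(4) by (simp add: ind_def pw_def)
qed

lemma ind_simple: "ind C B \<Longrightarrow> simple C B"
  unfolding simple_def using ind_pw ind_notin_cl[of C B "{}"] by auto

lemma ind_contract: assumes "ind C B" "z \<notin> cl (C \<union> B)" shows "ind (insert z C) B"
proof -
  have "z \<notin> cl C" using assms(2) cl_mono[of C "C \<union> B"] by auto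
  then show ?thesis using assms by (simp add: ind_def r_insert_notin)
qed

text \<open>Submodularity for the two spans enlarged by \<open>e\<close>: spans of subsets of one
  independent set are modular pairs, so they meet in the span of the intersection. Unique supports
  in frames rest on this.\<close>

lemma cl_Int_ind:
  assumes B: "ind C B" and "X \<subseteq> B" "Y \<subseteq> B" "e \<in> cl (C \<union> X)" "e \<in> cl (C \<union> Y)"
  shows "e \<in> cl (C \<union> (X \<inter> Y))"
proof -
  have i: "ind C X" "ind C Y" "ind C (X \<inter> Y)" "ind C (X \<union> Y)"
    using assms by (auto intro!: ind_subset[OF B])
  then have f: "finite X" "finite Y" by (auto simp: ind_def)
  let ?A = "insert e (C \<union> X)" and ?A' = "insert e (C \<union> Y)"
  have "r (?A \<union> ?A') + r (?A \<inter> ?A') \<le> r ?A + r ?A'" by (rule r_submod)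
  moreover have "r ?A = r C + card X" "r ?A' = r C + card Y"
    using assms i by (auto simp: cl_iff ind_def)
  moreover have "r (C \<union> (X \<union> Y)) \<le> r (?A \<union> ?A')" by (rule r_mono) auto
  moreover have "r (insert e (C \<union> (X \<inter> Y))) \<le> r (?A \<inter> ?A')" by (rule r_mono) auto
  moreover have "r (C \<union> (X \<union> Y)) = r C + card (X \<union> Y)" using i by (auto simp: ind_def)
  moreover have "card (X \<union> Y) + card (X \<inter> Y) = card X + card Y" using card_Un_Int[OF f] by simp
  ultimately have "r (insert e (C \<union> (X \<inter> Y))) \<le> r C + card (X \<inter> Y)" by linarith
  moreover have "r (C \<union> (X \<inter> Y)) = r C + card (X \<inter> Y)" using i by (auto simp: ind_def)
  moreover have "r (C \<union> (X \<inter> Y)) \<le> r (insert e (C \<union> (X \<inter> Y)))" by (rule r_mono) auto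
  ultimately show ?thesis by (simp add: cl_iff)
qed

end

section \<open>Adjacency and long lines\<close>

definition deg_in :: "('a \<Rightarrow> 'a \<Rightarrow> bool) \<Rightarrow> 'a set \<Rightarrow> 'a \<Rightarrow> nat" where
  "deg_in A S x = card {y\<in>S. A x y}"

text \<open>Ordered pairs, so that \<open>card (adj_pairs A S) / card S\<close> is the average
  degree for symmetric \<open>A\<close>.\<close>

definition adj_pairs :: "('a \<Rightarrow> 'a \<Rightarrow> bool) \<Rightarrow> 'a set \<Rightarrow> ('a \<times> 'a) set" where
  "adj_pairs A S = {(x, y). x \<in> S \<and> y \<in> S \<and> A x y}"

definition triangles :: "('a \<Rightarrow> 'a \<Rightarrow> bool) \<Rightarrow> 'a set \<Rightarrow> ('a \<times> 'a \<times> 'a) set" where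
  "triangles A S = {(x, y, z). x \<in> S \<and> y \<in> S \<and> z \<in> S \<and> A x y \<and> A x z \<and> A y z}"

lemma finite_adj_pairs: "finite S \<Longrightarrow> finite (adj_pairs A S)"
  by (rule finite_subset[of _ "S \<times> S"]) (auto simp: adj_pairs_def)

lemma finite_triangles: "finite S \<Longrightarrow> finite (triangles A S)"
  by (rule finite_subset[of _ "S \<times> S \<times> S"]) (auto simp: triangles_def)

lemma card_adj_pairs: "finite S \<Longrightarrow> card (adj_pairs A S) = (\<Sum>x\<in>S. deg_in A S x)"
proof -
  assume f: "finite S"
  have "adj_pairs A S = (SIGMA x:S. {y\<in>S. A x y})" by (auto simp: adj_pairs_def)
  then show ?thesis using f by (simp add: deg_in_def)
qed

lemma card_adj_pairs_le: "finite S \<Longrightarrow> card (adj_pairs A S) \<le> card S * card S"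
  using card_mono[of "S \<times> S" "adj_pairs A S"] by (auto simp: adj_pairs_def card_cartesian_product)

lemma card_adj_pairs_remove:
  assumes "finite S" "\<And>x y. A x y \<Longrightarrow> A y x"
  shows "card (adj_pairs A S) \<le> card (adj_pairs A (S - {x})) + 2 * deg_in A S x"
proof -
  let ?N = "{y\<in>S. A x y}"
  have "adj_pairs A S \<subseteq> adj_pairs A (S - {x}) \<union> Pair x ` ?N \<union> (\<lambda>y. (y, x)) ` ?N"
    using assms(2) by (auto simp: adj_pairs_def)
  then have "card (adj_pairs A S) \<le> card (adj_pairs A (S - {x}) \<union> Pair x ` ?N \<union> (\<lambda>y. (y, x)) ` ?N)"
    using assms(1) by (intro card_mono) (auto intro: finite_adj_pairs)
  also have "\<dots> \<le> card (adj_pairs A (S - {x})) + card (Pair x ` ?N) + card ((\<lambda>y. (y, x)) ` ?N)"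
    using card_Un_le[of "adj_pairs A (S - {x})" "Pair x ` ?N"]
      card_Un_le[of "adj_pairs A (S - {x}) \<union> Pair x ` ?N" "(\<lambda>y. (y, x)) ` ?N"] by linarith
  also have "\<dots> \<le> card (adj_pairs A (S - {x})) + 2 * deg_in A S x"
    using card_image_le[of ?N "Pair x"] card_image_le[of ?N "\<lambda>y. (y, x)"] assms(1)
    by (simp add: deg_in_def)
  finally show ?thesis .
qed

text \<open>The family \<open>R\<close> may be infinite, because contracted sets are arbitrary sets
  of the type; but bounded numerators and denominators admit only finitely many quotients.\<close>

lemma max_ratio_attained:
  fixes f g :: "'a \<Rightarrow> nat"
  assumes "x0 \<in> R" "\<And>x. x \<in> R \<Longrightarrow> f x \<le> m" "\<And>x. x \<in> R \<Longrightarrow> g x \<le> n"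
  obtains x where "x \<in> R" "\<And>y. y \<in> R \<Longrightarrow> real (f y) / real (g y) \<le> real (f x) / real (g x)"
proof -
  let ?h = "\<lambda>x. real (f x) / real (g x)"
  have "?h ` R \<subseteq> (\<lambda>(i, j). real i / real j) ` ({..m} \<times> {..n})"
  proof
    fix h assume "h \<in> ?h ` R"
    then obtain x where "x \<in> R" "h = ?h x" by blast
    then show "h \<in> (\<lambda>(i, j). real i / real j) ` ({..m} \<times> {..n})"
      using assms(2,3) by (intro image_eqI[of _ _ "(f x, g x)"]) auto
  qed
  then have fin: "finite (?h ` R)" by (rule finite_subset) auto
  then have "Max (?h ` R) \<in> ?h ` R" using assms(1) by (intro Max_in) auto
  then obtain x where "x \<in> R" "Max (?h ` R) = ?h x" by blast
  moreover have "?h y \<le> Max (?h ` R)" if "y \<in> R" for y using that by (intro Max_ge[OF fin] imageI)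
  ultimately show thesis using that[of x] by simp
qed

lemma exists_le_average:
  fixes f :: "'a \<Rightarrow> real" and c :: real
  assumes "finite S" "S \<noteq> {}" "(\<Sum>x\<in>S. f x) \<le> c * card S"
  obtains x where "x \<in> S" "f x \<le> c"
proof (rule ccontr)
  assume "\<not> thesis"
  then have "\<forall>x\<in>S. c < f x" using that by force
  then have "(\<Sum>x\<in>S. c) < (\<Sum>x\<in>S. f x)" using assms by (intro sum_strict_mono) auto
  then show False using assms(3) by (simp add: mult.commute)
qed

lemma sum_card_swap:
  assumes "finite A" "finite B"
  shows "(\<Sum>x\<in>A. card {y\<in>B. R x y}) = (\<Sum>y\<in>B. card {x\<in>A. R x y})"
  using sum.swap_restrict[OF assms, of "\<lambda>_ _. 1::nat" R] by simp

text \<open>Removing vertices of small degree one at a time, every triangle is seen inside the neighbourhood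
  of the first of its vertices to be removed.\<close>

lemma degenerate_triangles:
  fixes q h :: real
  assumes "finite S" and sym: "\<And>x y. A x y \<Longrightarrow> A y x"
    and q: "\<And>S'. S' \<subseteq> S \<Longrightarrow> card (adj_pairs A S') \<le> q * card S'"
    and h: "\<And>V. V \<subseteq> S \<Longrightarrow> card V \<le> q \<Longrightarrow> card (adj_pairs A V) \<le> h"
  shows "card (triangles A S) \<le> 3 * h * card S"
  using assms(1) q h
proof (induction "card S" arbitrary: S)
  case 0
  then have "triangles A S = {}" using 0 by (auto simp: triangles_def)
  then show ?case using 0 by simp
next
  case (Suc k)
  then have ne: "S \<noteq> {}" by auto
  have "(\<Sum>x\<in>S. real (deg_in A S x)) \<le> q * card S"
    using Suc.prems(2)[of S] card_adj_pairs[OF Suc.prems(1), of A] by simp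
  then obtain x where x: "x \<in> S" "deg_in A S x \<le> q"
    by (rule exists_le_average[OF Suc.prems(1) ne])
  let ?N = "{y\<in>S. A x y}" and ?S = "S - {x}"
  have IH: "card (triangles A ?S) \<le> 3 * h * card ?S"
    using Suc.prems x Suc.hyps(2) by (intro Suc.hyps(1)) auto
  let ?P = "adj_pairs A ?N"
  have fP: "finite ?P" using Suc.prems(1) by (intro finite_adj_pairs) auto
  \<comment> \<open>A triple through \<open>x\<close> has \<open>x\<close> in one of three places,
    and its other two entries form an ordered adjacent pair in the neighbourhood of
    \<open>x\<close>, which has at most \<open>q\<close> elements. This is the factor 3.\<close>
  have "triangles A S \<subseteq> triangles A ?S \<union> (\<lambda>(y, z). (x, y, z)) ` ?P
      \<union> (\<lambda>(y, z). (y, x, z)) ` ?P \<union> (\<lambda>(y, z). (y, z, x)) ` ?P" (is "_ \<subseteq> ?A \<union> ?B \<union> ?C \<union> ?D")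
  proof
    fix u assume "u \<in> triangles A S"
    then obtain a b c where u: "u = (a, b, c)" "a \<in> S" "b \<in> S" "c \<in> S" "A a b" "A a c" "A b c"
      by (auto simp: triangles_def)
    consider "a = x" | "b = x" | "c = x" | "a \<noteq> x" "b \<noteq> x" "c \<noteq> x" by blast
    then show "u \<in> ?A \<union> ?B \<union> ?C \<union> ?D"
    proof cases
      case 1
      then have "(b, c) \<in> ?P" using u by (auto simp: adj_pairs_def)
      then show ?thesis using u 1 by (intro UnI1[OF UnI1[OF UnI2]] image_eqI[of _ _ "(b, c)"]) auto
    next
      case 2
      then have "(a, c) \<in> ?P" using u sym by (auto simp: adj_pairs_def)
      then show ?thesis using u 2 by (intro UnI1[OF UnI2] image_eqI[of _ _ "(a, c)"]) auto
    next
      case 3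
      then have "(a, b) \<in> ?P" using u sym by (auto simp: adj_pairs_def)
      then show ?thesis using u 3 by (intro UnI2 image_eqI[of _ _ "(a, b)"]) auto
    next
      case 4
      then show ?thesis using u by (auto simp: triangles_def)
    qed
  qed
  moreover have "finite (?A \<union> ?B \<union> ?C \<union> ?D)" using fP Suc.prems(1) by (auto intro: finite_triangles)
  ultimately have "card (triangles A S) \<le> card (?A \<union> ?B \<union> ?C \<union> ?D)" by (rule card_mono[rotated])
  also have "\<dots> \<le> card ?A + card ?B + card ?C + card ?D"
    using card_Un_le[of ?A ?B] card_Un_le[of "?A \<union> ?B" ?C] card_Un_le[of "?A \<union> ?B \<union> ?C" ?D] by linarith
  also have "\<dots> \<le> card ?A + 3 * card ?P"
    using card_image_le[OF fP, of "\<lambda>(y, z). (x, y, z)"] card_image_le[OF fP, of "\<lambda>(y, z). (y, x, z)"]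
      card_image_le[OF fP, of "\<lambda>(y, z). (y, z, x)"] by linarith
  finally have "real (card (triangles A S)) \<le> card ?A + 3 * card ?P" by linarith
  moreover have "card ?P \<le> h" using x(2) by (intro Suc.prems(3)) (auto simp: deg_in_def)
  moreover have "card S = Suc (card ?S)" using card.remove[OF Suc.prems(1) x(1)] by simp
  ultimately show ?case using IH by (simp add: algebra_simps)
qed

text \<open>\<open>line_bound\<close> is the exclusion of \<open>U_{2,l+2}\<close> as a minor: no
  contraction has a line with \<open>l + 2\<close> points.\<close>

locale line_bounded = rank_function +
  fixes l :: nat
  assumes line_bound: "simple C S \<Longrightarrow> r (C \<union> S) \<le> r C + 2 \<Longrightarrow> card S \<le> l + 1"
    and l_pos: "0 < l"
begin

lemma tri_neq: assumes "tri C x y z" shows "x \<noteq> y" "x \<noteq> z" "y \<noteq> z"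
  using assms pw_neq unfolding tri_iff by blast+

text \<open>Two of the at most \<open>l + 1\<close> points of the line are taken by \<open>x\<close>
  and \<open>y\<close>, which are adjoined here because they need not belong to
  \<open>Z\<close>.\<close>

lemma card_third_le:
  assumes "simple C Z" shows "card {z\<in>Z. tri C x y z} \<le> l - 1"
proof (cases "{z\<in>Z. tri C x y z} = {}")
  case False
  let ?T = "{z\<in>Z. tri C x y z}"
  have xy: "pw C x y" using False by (auto simp: tri_iff)
  have fin: "finite ?T" using simple_finite[OF assms] by auto
  have nx: "x \<notin> ?T" "y \<notin> ?T" using tri_neq by blast+
  have sT: "simple C ?T" by (rule simple_subset[OF assms]) blast
  have "simple C (insert y ?T)"
  proof (rule simple_insert[OF sT])
    show "y \<notin> cl C" by (rule pwD(2)[OF xy])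
    fix z assume "z \<in> ?T"
    then have "pw C y z" unfolding tri_iff by blast
    then show "z \<notin> cl (insert y C)" by (rule pwD(3))
  qed
  then have "simple C (insert x (insert y ?T))"
  proof (rule simple_insert)
    show "x \<notin> cl C" by (rule pwD(1)[OF xy])
    fix z assume "z \<in> insert y ?T"
    then have "pw C x z" using xy unfolding tri_iff by blast
    then show "z \<notin> cl (insert x C)" by (rule pwD(3))
  qed
  moreover have "r (C \<union> insert x (insert y ?T)) \<le> r C + 2"
  proof -
    have "C \<union> insert x (insert y ?T) \<subseteq> cl (insert x (insert y C))"
      by (auto simp: tri_iff intro: in_clI)
    then have "r (C \<union> insert x (insert y ?T)) \<le> r (insert x (insert y C))" by (rule r_le_of_subset_cl)
    then show ?thesis using xy by (simp add: pw_def)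
  qed
  ultimately have "card (insert x (insert y ?T)) \<le> l + 1" by (rule line_bound)
  then show ?thesis using nx fin pw_neq[OF xy] by auto
qed (auto simp only: card.empty)

text \<open>Kung's bound. After contraction of a point \<open>e\<close> each remaining class comes
  from a line through \<open>e\<close>, which has at most \<open>l\<close> further points; so the
  bound for rank \<open>k + 1\<close> is one plus \<open>l\<close> times the bound for rank
  \<open>k\<close>.\<close>

lemma card_simple_le_sum:
  "simple C S \<Longrightarrow> r (C \<union> S) \<le> r C + k \<Longrightarrow> card S \<le> (\<Sum>i<k. l ^ i)"
proof (induction k arbitrary: C S)
  case 0
  have "S = {}"
  proof (rule ccontr)
    assume "S \<noteq> {}"
    then obtain x where x: "x \<in> S" by blast
    then have "r (insert x C) = Suc (r C)" using 0 by (simp add: simple_def notin_cl_iff)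
    moreover have "r (insert x C) \<le> r (C \<union> S)" using x by (intro r_mono) auto
    ultimately show False using 0 by simp
  qed
  then show ?case by simp
next
  case (Suc k)
  show ?case
  proof (cases "S = {}")
    case False
    then obtain e where e: "e \<in> S" by blast
    let ?C = "insert e C"
    have fS: "finite S" using Suc.prems simple_finite by blast
    have nl: "y \<notin> cl ?C" if "y \<in> S - {e}" for y
      using simple_pw[OF Suc.prems(1) e, of y] that by (auto simp: pw_iff)
    obtain T where T: "T \<subseteq> S - {e}" "simple ?C T"
      and max: "\<forall>y\<in>S - {e}. y \<notin> cl ?C \<longrightarrow> (\<exists>s\<in>T. y \<in> cl (insert s ?C))"
      using maximal_simple[of "S - {e}" ?C] finite_Diff[OF fS] by blast
    let ?cls = "\<lambda>s. {y \<in> S - {e}. y \<in> cl (insert s ?C)}"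
    have c: "card (?cls s) \<le> l" if "s \<in> T" for s
    proof -
      have "simple C (insert e (?cls s))" using e by (intro simple_subset[OF Suc.prems(1)]) auto
      moreover have "r (C \<union> insert e (?cls s)) \<le> r C + 2"
      proof -
        have "C \<union> insert e (?cls s) \<subseteq> cl (insert s ?C)" by (auto intro: in_clI)
        then have "r (C \<union> insert e (?cls s)) \<le> r (insert s ?C)" by (rule r_le_of_subset_cl)
        also have "\<dots> \<le> r C + 2" using r_insert_le[of s ?C] r_insert_le[of e C] by simp
        finally show ?thesis .
      qed
      ultimately have "card (insert e (?cls s)) \<le> l + 1" by (rule line_bound)
      then show ?thesis using fS by simp
    qed
    have "S - {e} \<subseteq> (\<Union>s\<in>T. ?cls s)" using max nl by blast
    then have "card (S - {e}) \<le> card (\<Union>s\<in>T. ?cls s)" using fS T by (intro card_mono) (auto intro: finite_subset)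
    also have "\<dots> \<le> (\<Sum>s\<in>T. card (?cls s))" using fS T by (intro card_UN_le) (auto intro: finite_subset)
    also have "\<dots> \<le> card T * l" using sum_bounded_above[of T "\<lambda>s. card (?cls s)" l] c by simp
    also have "\<dots> \<le> (\<Sum>i<k. l ^ i) * l"
    proof -
      have "r (?C \<union> T) \<le> r (C \<union> S)" using e T by (intro r_mono) auto
      moreover have "r ?C = Suc (r C)" using Suc.prems(1) e by (simp add: simple_def notin_cl_iff)
      ultimately have "card T \<le> (\<Sum>i<k. l ^ i)" using Suc.prems(2) T(2) by (intro Suc.IH) auto
      then show ?thesis by (rule mult_right_mono) simp
    qed
    finally have "card S \<le> 1 + (\<Sum>i<k. l ^ i) * l" using e fS by (simp add: card_Diff_singleton)
    also have "\<dots> = (\<Sum>i<Suc k. l ^ i)"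
      by (subst sum.lessThan_Suc_shift) (simp add: sum_distrib_left mult.commute)
    finally show ?thesis .
  qed simp
qed

lemma card_simple_le_power:
  assumes "simple C S" "r (C \<union> S) \<le> r C + k" "2 \<le> l" shows "card S \<le> l ^ k"
proof -
  have "(\<Sum>i<k. l ^ i) < l ^ k"
  proof (induction k)
    case (Suc k)
    have "2 * l ^ k \<le> l * l ^ k" using assms(3) by (rule mult_right_mono) simp
    moreover have "(\<Sum>i<k. l ^ i) < l ^ k" by (rule Suc)
    ultimately show ?case by (simp only: sum.lessThan_Suc power_Suc)
  qed simp
  then show ?thesis using card_simple_le_sum[OF assms(1,2)] by simp
qed

text \<open>Contracting \<open>C\<close> of maximal rank keeping the number of points above \<open>d\<close> times the rank, the
  contraction of any further point loses more than \<open>d\<close> points, hence every point is on many long lines.\<close>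

lemma dense_min_degree:
  fixes d :: real
  assumes "simple {} S0" "card S0 > d * r E" "0 \<le> d"
  obtains C S where "simple C S" "S \<noteq> {}" "\<And>e. e \<in> S \<Longrightarrow> deg_in (adj C) S e > d - 1"
proof -
  let ?P = "\<lambda>C. \<exists>S. simple C S \<and> real (card S) > d * (real (r E) - real (r C))"
  have bd: "r C \<le> r E" for C using r_restrict[of C] r_mono[of "C \<inter> E" E] by simp
  have "\<exists>m. (\<exists>C. ?P C \<and> r C = m) \<and> (\<forall>m'. (\<exists>C. ?P C \<and> r C = m') \<longrightarrow> m' \<le> m)"
  proof (rule Nat.ex_has_greatest_nat)
    show "\<exists>C. ?P C \<and> r C = 0" using assms by (intro exI[of _ "{}"]) (auto simp: r_empty)
    show "\<forall>m'. (\<exists>C. ?P C \<and> r C = m') \<longrightarrow> m' \<le> r E" using bd by auto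
  qed
  then obtain C where C: "?P C" and max: "\<And>C'. ?P C' \<Longrightarrow> r C' \<le> r C" by blast
  then obtain S where S: "simple C S" "real (card S) > d * (real (r E) - real (r C))" by blast
  show thesis
  proof (rule that[OF S(1)])
    have "0 \<le> d * (real (r E) - real (r C))" using bd[of C] assms(3) by simp
    then show "S \<noteq> {}" using S(2) by auto
    fix e assume e: "e \<in> S"
    let ?C = "insert e C"
    have fS: "finite S" using S simple_finite by blast
    have rC: "r ?C = Suc (r C)" using S(1) e by (simp add: simple_def notin_cl_iff)
    obtain T where T: "T \<subseteq> S - {e}" "simple ?C T"
      and mx: "\<forall>y\<in>S - {e}. y \<notin> cl ?C \<longrightarrow> (\<exists>s\<in>T. y \<in> cl (insert s ?C))"
      using maximal_simple[of "S - {e}" ?C] finite_Diff[OF fS] by blast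
    \<comment> \<open>Otherwise \<open>insert e C\<close> would be a contraction of larger rank that
      is still dense enough.\<close>
    have cT: "real (card T) \<le> d * (real (r E) - real (r C) - 1)"
    proof (rule ccontr)
      assume "\<not> ?thesis"
      then have "?P ?C" using T rC by (intro exI[of _ T]) (auto simp: algebra_simps)
      then show False using max rC by fastforce
    qed
    \<comment> \<open>A lost point \<open>y\<close> is parallel, after contraction of
      \<open>e\<close>, to some \<open>s\<close> in \<open>T\<close> different from
      \<open>y\<close>; then \<open>e\<close>, \<open>s\<close>, \<open>y\<close> are
      collinear.\<close>
    have "S - {e} - T \<subseteq> {y\<in>S. adj C e y}"
    proof
      fix y assume y: "y \<in> S - {e} - T"
      have ey: "pw C e y" using S(1) e y by (auto intro: simple_pw)
      then have "y \<notin> cl ?C" by (simp add: pw_iff)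
      then obtain s where s: "s \<in> T" "y \<in> cl (insert s ?C)" using mx y by blast
      have "pw C e s" "pw C s y" using S(1) e y T s by (auto intro!: simple_pw)
      then have "tri C e s y" using ey s(2) by (auto simp: tri_iff insert_commute)
      then show "y \<in> {y\<in>S. adj C e y}" using y tri_adj by blast
    qed
    then have "card (S - {e} - T) \<le> deg_in (adj C) S e"
      unfolding deg_in_def using fS by (intro card_mono) auto
    moreover have "card (S - {e} - T) = card S - 1 - card T"
      using T e fS finite_subset by (subst card_Diff_subset) (auto simp: card_Diff_singleton)
    ultimately have "real (card S) - 1 - card T \<le> deg_in (adj C) S e" by linarith
    then show "deg_in (adj C) S e > d - 1" using cT S(2) by (simp add: algebra_simps)
  qed
qed

end

section \<open>Contractions of maximal density\<close>

context line_bounded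
begin

abbreviation degC :: "'a set \<Rightarrow> 'a set \<Rightarrow> 'a \<Rightarrow> nat" where
  "degC C \<equiv> deg_in (adj C)"

abbreviation adjsC :: "'a set \<Rightarrow> 'a set \<Rightarrow> nat" where
  "adjsC C S \<equiv> card (adj_pairs (adj C) S)"

text \<open>The points of \<open>S\<close> that contraction of \<open>z\<close> merges with another
  point of \<open>S\<close>.\<close>

definition kernel :: "'a set \<Rightarrow> 'a set \<Rightarrow> 'a \<Rightarrow> 'a set" where
  "kernel C S z = {x\<in>S. \<exists>y\<in>S. tri C x y z}"

text \<open>Two adjacencies \<open>x y\<close> and \<open>x' y\<close> that become one when
  contraction of \<open>z\<close> merges \<open>x\<close> with \<open>x'\<close>.\<close>

definition forks :: "'a set \<Rightarrow> 'a set \<Rightarrow> 'a \<Rightarrow> ('a \<times> 'a \<times> 'a) set" where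
  "forks C S z = {(x, x', y). x \<in> S \<and> x' \<in> S \<and> y \<in> S \<and> tri C x x' z \<and> adj C x y \<and> adj C x' y}"

lemma finite_forks: "finite S \<Longrightarrow> finite (forks C S z)"
  by (rule finite_subset[of _ "S \<times> S \<times> S"]) (auto simp: forks_def)

lemma kernel_subset: "kernel C S z \<subseteq> S"
  by (auto simp: kernel_def)

text \<open>Contracting \<open>z\<close> merges exactly the pairs that are collinear with \<open>z\<close>.  Adjacent pairs survive, and
  are identified with each other only inside the kernel or through a fork.\<close>

lemma contract_point:
  assumes S: "simple C (insert z S)" "z \<notin> S"
  obtains T where "T \<subseteq> S" "simple (insert z C) T"
    "2 * card T + card (kernel C S z) \<le> 2 * card S"
    "adjsC C S \<le> adjsC (insert z C) T + adjsC C (kernel C S z) + 2 * card (forks C S z)"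
proof -
  let ?C = "insert z C" and ?K = "kernel C S z"
  have fin: "finite S" using simple_finite[OF S(1)] by auto
  have sS: "simple C S" by (rule simple_subset[OF S(1)]) blast
  have zx: "pw C z x" if "x \<in> S" for x using S that by (intro simple_pw[OF S(1)]) auto
  have nl: "x \<notin> cl ?C" if "x \<in> S" for x using zx[OF that] by (simp add: pw_iff)
  obtain T where T: "T \<subseteq> S" "simple ?C T"
    and max: "\<forall>y\<in>S. y \<notin> cl ?C \<longrightarrow> (\<exists>s\<in>T. y \<in> cl (insert s ?C))"
    using maximal_simple[OF fin, of ?C] by blast
  have par: "tri C x y z" if "x \<in> S" "y \<in> S" "x \<noteq> y" "y \<in> cl (insert x ?C)" for x y
  proof -
    have "pw C x y" by (rule simple_pw[OF sS that(1,2,3)])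
    moreover have "pw C x z" "pw C z y" using zx that pw_sym by blast+
    ultimately have "tri C x z y" using that(4) by (simp add: tri_iff)
    then show ?thesis using tri_rot tri_swap by blast
  qed
  have unpar: "y \<in> cl (insert x ?C)" if "tri C x y z" for x y
    by (rule tri_cl(3)[OF that])
  have "\<forall>y\<in>S. \<exists>s. s \<in> T \<and> y \<in> cl (insert s ?C)" using max nl by blast
  then obtain \<pi> where \<pi>: "\<And>y. y \<in> S \<Longrightarrow> \<pi> y \<in> T" "\<And>y. y \<in> S \<Longrightarrow> y \<in> cl (insert (\<pi> y) ?C)"
    by metis
  have \<pi>': "\<pi> y \<in> cl (insert y ?C)" if "y \<in> S" for y
    using parallel_sym[OF \<pi>(2)[OF that] nl[OF that]] .
  have \<pi>_eq: "tri C x y z" if "x \<in> S" "y \<in> S" "x \<noteq> y" "\<pi> x = \<pi> y" for x y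
  proof -
    have "y \<in> cl (insert x ?C)"
      using parallel_trans[OF \<pi>(2)[OF that(2)]] \<pi>'[OF that(1)] that(4) by simp
    then show ?thesis using par that by blast
  qed
  show thesis
  proof (rule that[OF T])
    \<comment> \<open>At least half of the kernel is dropped: a representative in the kernel has a
      partner that is not a representative, and different representatives have different
      partners.\<close>
    have "\<forall>s\<in>T \<inter> ?K. \<exists>y. y \<in> S \<and> tri C s y z" by (auto simp: kernel_def)
    then obtain g where g: "\<And>s. s \<in> T \<inter> ?K \<Longrightarrow> g s \<in> S \<and> tri C s (g s) z" by metis
    have notT: "\<not> tri C s y z" if "s \<in> T" "y \<in> T" for s y
    proof
      assume t: "tri C s y z"
      then have "pw ?C s y" using T(2) that tri_neq[OF t] by (intro simple_pw) auto
      then show False using unpar[OF t] by (simp add: pw_iff)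
    qed
    have gK: "g s \<in> ?K - T" if "s \<in> T \<inter> ?K" for s
    proof -
      have "s \<in> S" using that T by blast
      moreover have "tri C (g s) s z" using g[OF that] tri_swap by blast
      ultimately have "g s \<in> ?K" using g[OF that] unfolding kernel_def by blast
      then show ?thesis using g[OF that] notT that by blast
    qed
    have inj: "inj_on g (T \<inter> ?K)"
    proof (rule inj_onI)
      fix s s' assume s: "s \<in> T \<inter> ?K" "s' \<in> T \<inter> ?K" "g s = g s'"
      show "s = s'"
      proof (rule ccontr)
        assume ne: "s \<noteq> s'"
        have a: "g s \<in> cl (insert s ?C)" using g[OF s(1)] unpar by blast
        have "tri C (g s) s' z" using g[OF s(2)] s(3) tri_swap by simp
        then have "s' \<in> cl (insert (g s) ?C)" by (rule unpar)
        then have "s' \<in> cl (insert s ?C)" using a by (rule parallel_trans)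
        then have "tri C s s' z" using s ne T by (intro par) auto
        then show False using notT s by blast
      qed
    qed
    have "card (T \<inter> ?K) \<le> card (?K - T)"
      using gK by (intro card_inj_on_le[OF inj]) (auto intro: finite_subset[OF kernel_subset fin])
    moreover have "card ?K = card (?K \<inter> T) + card (?K - T)"
      by (rule card_Int_Diff[OF finite_subset[OF kernel_subset fin]])
    moreover have "card T + card (?K - T) \<le> card S"
    proof -
      have "card T + card (?K - T) = card (T \<union> (?K - T))"
        using fin T by (intro card_Un_disjoint[symmetric]) (auto intro: finite_subset[OF kernel_subset fin] finite_subset)
      also have "\<dots> \<le> card S" using T kernel_subset fin by (intro card_mono) auto
      finally show ?thesis .
    qed
    ultimately show "2 * card T + card ?K \<le> 2 * card S" by (simp add: Int_commute)
  next
    let ?F = "forks C S z"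
    \<comment> \<open>On these pairs the map to representatives is injective: two pairs with the
      same image that differ in both entries put \<open>x\<close> and \<open>y\<close> into the
      kernel, and if they differ in one entry they yield a fork.\<close>
    let ?G = "{(x, y)\<in>adj_pairs (adj C) S. \<not> (x \<in> ?K \<and> y \<in> ?K)
       \<and> (\<forall>x'\<in>S. tri C x x' z \<longrightarrow> \<not> adj C x' y) \<and> (\<forall>y'\<in>S. tri C y y' z \<longrightarrow> \<not> adj C y' x)}"
    let ?f = "\<lambda>(x, y). (\<pi> x, \<pi> y)"
    have cover: "adj_pairs (adj C) S \<subseteq> ?G \<union> adj_pairs (adj C) ?K \<union> (\<lambda>(x, x', y). (x, y)) ` ?F
        \<union> (\<lambda>(y, y', x). (x, y)) ` ?F"
    proof
      fix p assume p: "p \<in> adj_pairs (adj C) S"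
      obtain x y where xy: "p = (x, y)" by (cases p)
      have a: "x \<in> S" "y \<in> S" "adj C x y" using p xy by (auto simp: adj_pairs_def)
      consider "x \<in> ?K \<and> y \<in> ?K" | x' where "x' \<in> S" "tri C x x' z" "adj C x' y"
        | y' where "y' \<in> S" "tri C y y' z" "adj C y' x" | "p \<in> ?G"
        using p xy by blast
      then show "p \<in> ?G \<union> adj_pairs (adj C) ?K \<union> (\<lambda>(x, x', y). (x, y)) ` ?F \<union> (\<lambda>(y, y', x). (x, y)) ` ?F"
      proof cases
        case 1
        then have "p \<in> adj_pairs (adj C) ?K" using xy a by (auto simp: adj_pairs_def)
        then show ?thesis by blast
      next
        case (2 x')
        then have "(x, x', y) \<in> ?F" using a by (auto simp: forks_def)
        then have "p \<in> (\<lambda>(x, x', y). (x, y)) ` ?F" using xy by (intro image_eqI[of _ _ "(x, x', y)"]) auto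
        then show ?thesis by blast
      next
        case (3 y')
        then have "(y, y', x) \<in> ?F" using a adj_sym by (auto simp: forks_def)
        then have "p \<in> (\<lambda>(y, y', x). (x, y)) ` ?F" using xy by (intro image_eqI[of _ _ "(y, y', x)"]) auto
        then show ?thesis by blast
      next
        case 4
        then show ?thesis by blast
      qed
    qed
    have finG: "finite ?G" using finite_adj_pairs[OF fin] by (rule rev_finite_subset) blast
    have inj: "inj_on ?f ?G"
    proof (rule inj_onI)
      fix p q assume p: "p \<in> ?G" and q: "q \<in> ?G" and eq: "?f p = ?f q"
      obtain x y where xy: "p = (x, y)" by (cases p)
      obtain u v where uv: "q = (u, v)" by (cases q)
      have pS: "x \<in> S" "y \<in> S" "adj C x y" and qS: "u \<in> S" "v \<in> S" "adj C u v"
        using p q xy uv by (auto simp: adj_pairs_def)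
      have e: "\<pi> x = \<pi> u" "\<pi> y = \<pi> v" using eq xy uv by auto
      have 1: "x = u \<or> tri C x u z" using \<pi>_eq pS qS e by blast
      have 2: "y = v \<or> tri C y v z" using \<pi>_eq pS qS e by blast
      have 3: "\<not> (tri C x u z \<and> tri C y v z)"
      proof
        assume "tri C x u z \<and> tri C y v z"
        then have "x \<in> ?K" "y \<in> ?K" using pS qS unfolding kernel_def by blast+
        then show False using p xy by blast
      qed
      have 4: "\<not> (tri C x u z \<and> y = v)" using p xy qS by blast
      have 5: "\<not> (x = u \<and> tri C y v z)" using p xy qS adj_sym by blast
      show "p = q" using 1 2 3 4 5 xy uv by blast
    qed
    have img: "?f ` ?G \<subseteq> adj_pairs (adj ?C) T"
    proof
      fix w assume "w \<in> ?f ` ?G"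
      then obtain x y where p: "(x, y) \<in> ?G" and w: "w = (\<pi> x, \<pi> y)" by auto
      have a: "x \<in> S" "y \<in> S" "adj C x y" using p by (auto simp: adj_pairs_def)
      have "y \<notin> cl (insert x ?C)"
      proof
        assume "y \<in> cl (insert x ?C)"
        then have "tri C x y z" using par a adj_neq by blast
        then have "x \<in> ?K" "y \<in> ?K" using a tri_swap unfolding kernel_def by blast+
        then show False using p by blast
      qed
      then have "pw ?C x y" using nl[OF a(1)] by (simp add: pw_iff)
      then have "adj ?C x y" by (rule adj_mono[OF a(3) subset_insertI])
      then have "adj ?C (\<pi> x) y"
        by (rule adj_parallel) (use \<pi>' \<pi> a T in \<open>auto simp: simple_def\<close>)
      then have "adj ?C (\<pi> y) (\<pi> x)"
        by (rule adj_parallel[OF adj_sym]) (use \<pi>' \<pi> a T in \<open>auto simp: simple_def\<close>)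
      then show "w \<in> adj_pairs (adj ?C) T" using w \<pi> a adj_sym by (auto simp: adj_pairs_def)
    qed
    have finT: "finite (adj_pairs (adj ?C) T)" using T fin by (intro finite_adj_pairs) (rule finite_subset)
    have G: "card ?G \<le> adjsC ?C T" by (rule card_inj_on_le[OF inj img finT])
    let ?A = "adj_pairs (adj C) ?K" and ?X = "(\<lambda>(x, x', y). (x, y)) ` ?F" and ?Y = "(\<lambda>(y, y', x). (x, y)) ` ?F"
    have finF: "finite ?F" by (rule finite_forks[OF fin])
    have finA: "finite ?A" using kernel_subset fin by (intro finite_adj_pairs) (rule finite_subset)
    have XY: "card ?X \<le> card ?F" "card ?Y \<le> card ?F" by (rule card_image_le[OF finF])+
    have "adjsC C S \<le> card (?G \<union> ?A \<union> ?X \<union> ?Y)"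
      by (rule card_mono[OF _ cover]) (use finG finA finF in blast)
    also have "\<dots> \<le> card ?G + card ?A + card ?X + card ?Y"
      using card_Un_le[of ?G ?A] card_Un_le[of "?G \<union> ?A" ?X] card_Un_le[of "?G \<union> ?A \<union> ?X" ?Y] by linarith
    finally show "adjsC C S \<le> adjsC ?C T + adjsC C ?K + 2 * card ?F" using G XY by linarith
  qed
qed

text \<open>Contraction of \<open>z\<close> removes at least half of the kernel from the points. As
  the density cannot exceed \<open>q\<close> afterwards, at least \<open>q / 2\<close> adjacent
  pairs per kernel element must disappear, and \<open>contract_point\<close> says where. A point
  \<open>z\<close> of \<open>S\<close> is first removed from \<open>S\<close>, at the price of twice
  its degree.\<close>

lemma kernel_bound:
  fixes q :: real
  assumes S: "simple C (insert z S)" and fin: "finite S" and q0: "0 \<le> q" and eq: "adjsC C S = q * card S"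
    and max: "\<And>C' S'. simple C' S' \<Longrightarrow> adjsC C' S' \<le> q * card S'"
  shows "q * card (kernel C S z) \<le> 2 * adjsC C (kernel C S z) + 4 * card (forks C S z)
    + 4 * (if z \<in> S then degC C S z else 0)"
proof (cases "z \<in> S")
  case False
  obtain T where T: "simple (insert z C) T" "2 * card T + card (kernel C S z) \<le> 2 * card S"
    "adjsC C S \<le> adjsC (insert z C) T + adjsC C (kernel C S z) + 2 * card (forks C S z)"
    by (rule contract_point[OF S False])
  have 1: "q * (2 * card T + card (kernel C S z)) \<le> q * (2 * card S)"
    using T(2) q0 by (intro mult_left_mono) linarith+
  have 2: "real (adjsC (insert z C) T) \<le> q * card T" by (rule max[OF T(1)])
  have 3: "q * card S \<le> adjsC (insert z C) T + adjsC C (kernel C S z) + 2 * card (forks C S z)"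
    using T(3) eq by linarith
  show ?thesis using 1 2 3 False by (simp add: algebra_simps)
next
  case True
  define S0 where "S0 = S - {z}"
  have S': "simple C (insert z S0)" using S True by (simp add: insert_absorb S0_def)
  have K: "kernel C S0 z = kernel C S z"
    using tri_neq unfolding kernel_def S0_def by blast
  have F: "card (forks C S0 z) \<le> card (forks C S z)"
    by (rule card_mono[OF finite_forks[OF fin]]) (auto simp: forks_def S0_def)
  obtain T where T: "simple (insert z C) T" "2 * card T + card (kernel C S0 z) \<le> 2 * card S0"
    "adjsC C S0 \<le> adjsC (insert z C) T + adjsC C (kernel C S0 z) + 2 * card (forks C S0 z)"
    by (rule contract_point[OF S']) (auto simp: S0_def)
  have c: "card S = Suc (card S0)" unfolding S0_def by (rule card.remove[OF fin True])
  have 1: "q * (2 * card T + card (kernel C S z)) \<le> q * (2 * card S0)"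
    using T(2) q0 K by (intro mult_left_mono) auto
  have 2: "real (adjsC (insert z C) T) \<le> q * card T" by (rule max[OF T(1)])
  have "adjsC C S \<le> adjsC C S0 + 2 * degC C S z"
    unfolding S0_def by (rule card_adj_pairs_remove[OF fin adj_sym])
  then have 3: "q * card S \<le> adjsC (insert z C) T + adjsC C (kernel C S z) + 2 * card (forks C S z) + 2 * degC C S z"
    using T(3) eq F unfolding K by linarith
  have 4: "q * card S0 \<le> q * card S" using c q0 by (intro mult_left_mono) auto
  show ?thesis using 1 2 3 4 True by (simp add: algebra_simps)
qed

text \<open>
  Adding a point outside \<open>S\<close> with a large kernel would increase the density, and few adjacent pairs consist of
  points of high degree, so many adjacent pairs have a third point of low degree.  Contracting such a point
  cannot increase the density, which forces many adjacent pairs in its kernel or many forks, that is, triangles.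
\<close>

lemma locally_dense:
  fixes q :: real
  assumes S: "simple C S" "S \<noteq> {}" and eq: "adjsC C S = q * card S"
    and max: "\<And>C' S'. simple C' S' \<Longrightarrow> adjsC C' S' \<le> q * card S'" and q: "64 * real l ^ 2 \<le> q"
  obtains V where "simple C V" "card V \<le> 2 * q" "q ^ 2 / (100 * real l ^ 3) \<le> adjsC C V"
proof -
  have fin: "finite S" by (rule simple_finite[OF S(1)])
  have cS: "0 < card S" using fin S(2) by (simp add: card_gt_0_iff)
  have l1: "1 \<le> real l" using l_pos by simp
  then have l2: "1 \<le> real l ^ 2" "1 \<le> real l ^ 3" by (auto intro: one_le_power)
  have q0: "0 < q" using q l2 by linarith
  \<comment> \<open>\<open>Z\<close> represents all points of the contraction, so every adjacent
    pair of \<open>S\<close> has a third point in \<open>Z\<close>, though perhaps not in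
    \<open>S\<close>.\<close>
  obtain Z where Z: "S \<subseteq> Z" "Z \<subseteq> E" "simple C Z"
    and Zmax: "\<And>y. y \<in> E \<Longrightarrow> y \<notin> cl C \<Longrightarrow> \<exists>s\<in>Z. y \<in> cl (insert s C)"
    by (rule maximal_simple_ext[OF S(1) simple_in_E[OF S(1)] finite_E]) blast
  have finZ: "finite Z" by (rule simple_finite[OF Z(3)])
  have third: "\<exists>z\<in>Z. tri C x y z" if a: "adj C x y" for x y
  proof -
    obtain z where z: "tri C x y z" using a by (auto simp: adj_def)
    have "z \<in> E" "z \<notin> cl C" using tri_in_E[OF z] z by (auto simp: tri_iff dest: pwD)
    then obtain s where s: "s \<in> Z" "z \<in> cl (insert s C)" using Zmax by blast
    have "s \<in> cl (insert z C)" by (rule parallel_sym[OF s(2)]) fact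
    moreover have "s \<notin> cl C" using Z(3) s by (auto simp: simple_def)
    ultimately have "tri C s x y" by (rule tri_parallel[OF tri_rot[OF tri_rot[OF z]]])
    then show ?thesis using s tri_rot by blast
  qed
  let ?K = "\<lambda>z. kernel C S z" and ?H = "{z\<in>S. 2 * q < degC C S z}"
  \<comment> \<open>Excluding the points of high degree keeps all kernels below
    \<open>2 * q\<close>, so that any kernel is small enough to serve as \<open>V\<close>.\<close>
  define Zl where "Zl = Z - ?H"
  have ZlZ: "Zl \<subseteq> Z" by (auto simp: Zl_def)
  have finZl: "finite Zl" using finZ ZlZ finite_subset by blast
  have sum_deg: "(\<Sum>x\<in>S. real (degC C S x)) = q * card S"
    using eq card_adj_pairs[OF fin, of "adj C"] by simp
  have H: "2 * real (card ?H) \<le> card S"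
  proof -
    have "(\<Sum>x\<in>?H. 2 * q) \<le> (\<Sum>x\<in>?H. real (degC C S x))" by (intro sum_mono) auto
    also have "\<dots> \<le> (\<Sum>x\<in>S. real (degC C S x))" using fin by (intro sum_mono2) auto
    finally have "q * (2 * card ?H) \<le> q * card S" using sum_deg by (simp add: algebra_simps)
    then show ?thesis using q0 by simp
  qed
  let ?Good = "{(x, y). x \<in> S \<and> y \<in> S \<and> (\<exists>z\<in>Zl. tri C x y z)}"
  have finGood: "finite ?Good" by (rule finite_subset[of _ "S \<times> S"]) (use fin in auto)
  have triS: "card {y\<in>S. tri C u v y} \<le> l - 1" for u v by (rule card_third_le[OF S(1)])
  \<comment> \<open>A pair that is not good has its third point \<open>z\<close> in
    \<open>?H\<close>. If one of its ends is not in \<open>?H\<close>, the other end and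
    \<open>z\<close> form a good pair with that end as third point, and a good pair arises so from
    at most \<open>l - 1\<close> pairs in either order. The pairs inside \<open>?H\<close> are at
    most half of all, since \<open>?H\<close> has density at most \<open>q\<close> and at most half
    of the points.\<close>
  have Good: "q * card S \<le> 4 * l * real (card ?Good)"
  proof -
    let ?B1 = "(\<lambda>((x, z), y). (x, y)) ` (SIGMA p:?Good. {y\<in>S. tri C (fst p) (snd p) y})"
    let ?B2 = "(\<lambda>((z, y), x). (x, y)) ` (SIGMA p:?Good. {x\<in>S. tri C (fst p) (snd p) x})"
    have cover: "adj_pairs (adj C) S \<subseteq> ?Good \<union> adj_pairs (adj C) ?H \<union> ?B1 \<union> ?B2"
    proof
      fix p assume p: "p \<in> adj_pairs (adj C) S"
      obtain x y where xy: "p = (x, y)" by (cases p)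
      have a: "x \<in> S" "y \<in> S" "adj C x y" using p xy by (auto simp: adj_pairs_def)
      obtain z where z: "z \<in> Z" "tri C x y z" using third[OF a(3)] by blast
      consider "z \<in> Zl" | "x \<in> ?H" "y \<in> ?H" | "z \<in> ?H" "y \<notin> ?H" | "z \<in> ?H" "x \<notin> ?H"
        using z Zl_def by blast
      then show "p \<in> ?Good \<union> adj_pairs (adj C) ?H \<union> ?B1 \<union> ?B2"
      proof cases
        case 1
        then have "p \<in> ?Good" using xy a z by blast
        then show ?thesis by blast
      next
        case 2
        then have "p \<in> adj_pairs (adj C) ?H" using xy a by (auto simp: adj_pairs_def)
        then show ?thesis by blast
      next
        case 3
        have t: "tri C x z y" using z(2) tri_rot tri_swap by blast
        have "y \<in> Zl" using 3 a Z Zl_def by blast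
        then have "(x, z) \<in> ?Good" using t 3 a by blast
        then have "((x, z), y) \<in> (SIGMA p:?Good. {y\<in>S. tri C (fst p) (snd p) y})" using t a by auto
        then have "p \<in> ?B1" using xy by (intro image_eqI[of _ _ "((x, z), y)"]) auto
        then show ?thesis by blast
      next
        case 4
        have t: "tri C z y x" using z(2) tri_rot tri_swap by blast
        have "x \<in> Zl" using 4 a Z Zl_def by blast
        then have "(z, y) \<in> ?Good" using t 4 a by blast
        then have "((z, y), x) \<in> (SIGMA p:?Good. {x\<in>S. tri C (fst p) (snd p) x})" using t a by auto
        then have "p \<in> ?B2" using xy by (intro image_eqI[of _ _ "((z, y), x)"]) auto
        then show ?thesis by blast
      qed
    qed
    have finSig: "finite (SIGMA p:?Good. {y\<in>S. tri C (fst p) (snd p) y})"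
      using finGood fin by (intro finite_SigmaI) auto
    have "card (SIGMA p:?Good. {y\<in>S. tri C (fst p) (snd p) y}) = (\<Sum>p\<in>?Good. card {y\<in>S. tri C (fst p) (snd p) y})"
      using finGood fin by (intro card_SigmaI) auto
    also have "\<dots> \<le> card ?Good * (l - 1)"
      using sum_bounded_above[of ?Good "\<lambda>p. card {y\<in>S. tri C (fst p) (snd p) y}" "l - 1"] triS by simp
    finally have Sig: "card (SIGMA p:?Good. {y\<in>S. tri C (fst p) (snd p) y}) \<le> card ?Good * (l - 1)" .
    have B: "card ?B1 \<le> card ?Good * (l - 1)" "card ?B2 \<le> card ?Good * (l - 1)"
      by (rule order.trans[OF card_image_le[OF finSig] Sig])+
    have "simple C ?H" by (rule simple_subset[OF S(1)]) blast
    then have HH: "adjsC C ?H \<le> q * card ?H" by (rule max)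
    have "q * (2 * card ?H) \<le> q * card S" using H q0 by (intro mult_left_mono) auto
    then have HH': "2 * real (adjsC C ?H) \<le> q * card S" using HH by simp
    have finHH: "finite (adj_pairs (adj C) ?H)" using fin by (intro finite_adj_pairs) auto
    have "adjsC C S \<le> card (?Good \<union> adj_pairs (adj C) ?H \<union> ?B1 \<union> ?B2)"
      by (rule card_mono[OF _ cover]) (use finGood finHH finSig in blast)
    also have "\<dots> \<le> card ?Good + adjsC C ?H + card ?B1 + card ?B2"
      using card_Un_le[of ?Good "adj_pairs (adj C) ?H"] card_Un_le[of "?Good \<union> adj_pairs (adj C) ?H" ?B1]
        card_Un_le[of "?Good \<union> adj_pairs (adj C) ?H \<union> ?B1" ?B2] by linarith
    finally have "adjsC C S \<le> card ?Good + 2 * (card ?Good * (l - 1)) + adjsC C ?H" using B by linarith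
    moreover have "card ?Good + 2 * (card ?Good * (l - 1)) \<le> 2 * (l * card ?Good)"
      using l_pos by (cases l) (auto simp: algebra_simps)
    ultimately have "adjsC C S \<le> 2 * (l * card ?Good) + adjsC C ?H" by linarith
    then have "real (adjsC C S) \<le> real (2 * (l * card ?Good) + adjsC C ?H)" by (rule of_nat_mono)
    then show ?thesis using eq HH' by (simp add: algebra_simps)
  qed
  \<comment> \<open>A good pair \<open>(x, y)\<close> with third point \<open>z\<close> has
    \<open>x\<close> in the kernel of \<open>z\<close>, and \<open>x\<close> and \<open>z\<close>
    leave at most \<open>l - 1\<close> choices for \<open>y\<close>.\<close>
  have sumK: "q * card S \<le> 4 * real l ^ 2 * (\<Sum>z\<in>Zl. real (card (?K z)))"
  proof -
    have "?Good \<subseteq> (\<Union>z\<in>Zl. SIGMA x:?K z. {y\<in>S. tri C x z y})"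
    proof
      fix p assume "p \<in> ?Good"
      then obtain x y z where p: "p = (x, y)" "x \<in> S" "y \<in> S" "z \<in> Zl" "tri C x y z" by blast
      have "tri C x z y" by (rule tri_swap[OF tri_rot[OF tri_rot[OF p(5)]]])
      moreover have "x \<in> ?K z" using p unfolding kernel_def by blast
      ultimately have "p \<in> (SIGMA x:?K z. {y\<in>S. tri C x z y})" using p by simp
      then show "p \<in> (\<Union>z\<in>Zl. SIGMA x:?K z. {y\<in>S. tri C x z y})" using p(4) by blast
    qed
    moreover have fu: "finite (SIGMA x:?K z. {y\<in>S. tri C x z y})" for z
      using finite_subset[OF kernel_subset fin] fin by (intro finite_SigmaI) auto
    ultimately have "card ?Good \<le> card (\<Union>z\<in>Zl. SIGMA x:?K z. {y\<in>S. tri C x z y})"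
      using finZl by (intro card_mono) auto
    also have "\<dots> \<le> (\<Sum>z\<in>Zl. card (SIGMA x:?K z. {y\<in>S. tri C x z y}))" by (rule card_UN_le[OF finZl])
    also have "\<dots> \<le> (\<Sum>z\<in>Zl. card (?K z) * l)"
    proof (rule sum_mono)
      fix z
      have "card (SIGMA x:?K z. {y\<in>S. tri C x z y}) = (\<Sum>x\<in>?K z. card {y\<in>S. tri C x z y})"
        using finite_subset[OF kernel_subset fin] fin by (intro card_SigmaI) auto
      also have "\<dots> \<le> card (?K z) * (l - 1)"
        using sum_bounded_above[of "?K z" "\<lambda>x. card {y\<in>S. tri C x z y}" "l - 1"] triS by simp
      also have "\<dots> \<le> card (?K z) * l" by simp
      finally show "card (SIGMA x:?K z. {y\<in>S. tri C x z y}) \<le> card (?K z) * l" .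
    qed
    also have "\<dots> = l * (\<Sum>z\<in>Zl. card (?K z))" by (simp add: sum_distrib_left mult.commute)
    finally have "real (card ?Good) \<le> real (l * (\<Sum>z\<in>Zl. card (?K z)))" by (rule of_nat_mono)
    then have "4 * l * real (card ?Good) \<le> 4 * l * real (l * (\<Sum>z\<in>Zl. card (?K z)))"
      by (intro mult_left_mono) auto
    then show ?thesis using Good by (simp add: power2_eq_square mult.assoc)
  qed
  \<comment> \<open>A kernel consists of neighbours of \<open>z\<close>. If \<open>z\<close> is
    outside \<open>S\<close>, adjoining it to \<open>S\<close> adds one point and two ordered pairs
    per kernel element, so maximality of \<open>q\<close> bounds the kernel by
    \<open>q / 2\<close>.\<close>
  have Ksmall: "real (card (?K z)) \<le> 2 * q" if z: "z \<in> Zl" for z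
  proof (cases "z \<in> S")
    case True
    then have "degC C S z \<le> 2 * q" using z Zl_def by auto
    moreover have "?K z \<subseteq> {y\<in>S. adj C z y}"
    proof
      fix x assume "x \<in> ?K z"
      then obtain y where "x \<in> S" "tri C x y z" by (auto simp: kernel_def)
      then show "x \<in> {y\<in>S. adj C z y}" using tri_adj(3) adj_sym by blast
    qed
    then have "card (?K z) \<le> degC C S z" unfolding deg_in_def by (rule card_mono[rotated]) (use fin in auto)
    ultimately show ?thesis by linarith
  next
    case False
    let ?S = "insert z S"
    have sS: "simple C ?S" using Z z ZlZ by (intro simple_subset[OF Z(3)]) auto
    let ?A = "adj_pairs (adj C) S" and ?X = "Pair z ` ?K z" and ?Y = "(\<lambda>y. (y, z)) ` ?K z"
    have fK: "finite (?K z)" by (rule finite_subset[OF kernel_subset fin])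
    have fA: "finite ?A" by (rule finite_adj_pairs[OF fin])
    have "adj C z x" if "x \<in> ?K z" for x using that tri_adj(3)[THEN adj_sym] unfolding kernel_def by blast
    then have "?A \<union> ?X \<union> ?Y \<subseteq> adj_pairs (adj C) ?S"
      using kernel_subset[of C S z] adj_sym by (auto simp: adj_pairs_def)
    then have "card (?A \<union> ?X \<union> ?Y) \<le> adjsC C ?S" using fin by (intro card_mono finite_adj_pairs) auto
    moreover have "card (?A \<union> ?X \<union> ?Y) = card ?A + card ?X + card ?Y"
    proof -
      have "(?A \<union> ?X) \<inter> ?Y = {}" "?A \<inter> ?X = {}"
        using False kernel_subset[of C S z] by (auto simp: adj_pairs_def)
      then show ?thesis using fA fK by (simp add: card_Un_disjoint)
    qed
    moreover have "card ?X = card (?K z)" "card ?Y = card (?K z)" by (auto intro!: card_image inj_onI)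
    ultimately have "adjsC C S + 2 * card (?K z) \<le> adjsC C ?S" by linarith
    moreover have "adjsC C ?S \<le> q * card ?S" by (rule max[OF sS])
    ultimately have "q * card S + 2 * card (?K z) \<le> q * card ?S" using eq by linarith
    then have "2 * real (card (?K z)) \<le> q" using False fin by (simp add: algebra_simps)
    then show ?thesis using q0 by linarith
  qed
  have simpK: "simple C (?K z)" for z by (rule simple_subset[OF S(1) kernel_subset])
  show thesis
  proof (cases "\<exists>z\<in>Zl. ?K z \<noteq> {} \<and> q * card (?K z) < 8 * adjsC C (?K z)")
    case True
    then obtain z where z: "z \<in> Zl" "?K z \<noteq> {}" "q * card (?K z) < 8 * adjsC C (?K z)" by blast
    have fK: "finite (?K z)" by (rule finite_subset[OF kernel_subset fin])
    have c: "0 < real (card (?K z))" using z(2) fK by (simp add: card_gt_0_iff)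
    \<comment> \<open>A set has at most the square of its size in pairs, so such a kernel has at
      least \<open>q / 8\<close> points and therefore \<open>q^2 / 64\<close> adjacent
      pairs.\<close>
    have "adjsC C (?K z) \<le> card (?K z) * card (?K z)" by (rule card_adj_pairs_le[OF fK])
    then have "real (adjsC C (?K z)) \<le> real (card (?K z) * card (?K z))" by (rule of_nat_mono)
    then have "q * card (?K z) \<le> (8 * real (card (?K z))) * card (?K z)" using z(3) by simp
    then have "q \<le> 8 * real (card (?K z))" using c by simp
    then have "q * q \<le> q * (8 * real (card (?K z)))" using q0 by (intro mult_left_mono) auto
    then have "q * q \<le> 64 * adjsC C (?K z)" using z(3) by linarith
    moreover have "64 \<le> 100 * real l ^ 3" using l2 by linarith
    then have "q ^ 2 / (100 * real l ^ 3) \<le> q ^ 2 / 64" by (intro divide_left_mono) (use l_pos in auto)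
    ultimately have "q ^ 2 / (100 * real l ^ 3) \<le> adjsC C (?K z)" by (simp add: power2_eq_square)
    then show thesis using that[OF simpK Ksmall[OF z(1)]] by blast
  next
    case False
    let ?T = "triangles (adj C) S"
    have finT: "finite ?T" by (rule finite_triangles[OF fin])
    \<comment> \<open>The pairs inside the kernel now account for at most a quarter of the left side
      of \<open>kernel_bound\<close>; the rest must come from forks and the degree of
      \<open>z\<close>.\<close>
    have z: "3 * q * card (?K z) \<le> 16 * card (forks C S z) + 16 * (if z \<in> S then degC C S z else 0)"
      if "z \<in> Zl" for z
    proof -
      have "8 * real (adjsC C (?K z)) \<le> q * card (?K z)"
        using False that by (cases "?K z = {}") (auto simp: not_less adj_pairs_def)
      moreover have "simple C (insert z S)" using Z that ZlZ by (intro simple_subset[OF Z(3)]) auto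
      from kernel_bound[OF this fin less_imp_le[OF q0] eq max]
      have "q * card (?K z) \<le> 2 * adjsC C (?K z) + 4 * card (forks C S z)
        + 4 * (if z \<in> S then degC C S z else 0)" .
      ultimately show ?thesis by linarith
    qed
    have "(\<Sum>z\<in>Zl. 3 * q * card (?K z))
        \<le> (\<Sum>z\<in>Zl. real (16 * card (forks C S z) + 16 * (if z \<in> S then degC C S z else 0)))"
      by (intro sum_mono z)
    also have "\<dots> = (\<Sum>z\<in>Zl. 16 * real (card (forks C S z)) + 16 * (if z \<in> S then real (degC C S z) else 0))"
      by (intro sum.cong) auto
    also have "\<dots> = 16 * real (\<Sum>z\<in>Zl. card (forks C S z)) + 16 * (\<Sum>z\<in>Zl. if z \<in> S then real (degC C S z) else 0)"
      unfolding sum.distrib by (simp only: sum_distrib_left of_nat_sum)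
    finally have 1: "3 * q * (\<Sum>z\<in>Zl. real (card (?K z)))
      \<le> 16 * real (\<Sum>z\<in>Zl. card (forks C S z)) + 16 * (\<Sum>z\<in>Zl. if z \<in> S then real (degC C S z) else 0)"
      by (simp add: sum_distrib_left)
    have "(\<Sum>z\<in>Zl. if z \<in> S then real (degC C S z) else 0) = (\<Sum>z\<in>Zl \<inter> S. real (degC C S z))"
      using finZl by (simp add: sum.inter_restrict)
    also have "\<dots> \<le> (\<Sum>z\<in>S. real (degC C S z))" using fin by (intro sum_mono2) auto
    finally have 2: "(\<Sum>z\<in>Zl. if z \<in> S then real (degC C S z) else 0) \<le> q * card S" using sum_deg by simp
    \<comment> \<open>The points \<open>x\<close> and \<open>x'\<close> of a fork are themselves
      adjacent, by their third point \<open>z\<close>. So forks are triangles, each counted for at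
      most \<open>l - 1\<close> points \<open>z\<close>.\<close>
    have fk: "forks C S z = {t\<in>?T. tri C (fst t) (fst (snd t)) z}" for z
      using tri_adj(1) by (auto simp: forks_def triangles_def)
    have "(\<Sum>z\<in>Zl. card (forks C S z)) = (\<Sum>t\<in>?T. card {z\<in>Zl. tri C (fst t) (fst (snd t)) z})"
      unfolding fk by (rule sum_card_swap[OF finZl finT])
    also have "\<dots> \<le> card ?T * (l - 1)"
      using sum_bounded_above[of ?T "\<lambda>t. card {z\<in>Zl. tri C (fst t) (fst (snd t)) z}" "l - 1"]
        card_third_le[OF simple_subset[OF Z(3) ZlZ]] by simp
    also have "\<dots> \<le> card ?T * l" by simp
    finally have "real (\<Sum>z\<in>Zl. card (forks C S z)) \<le> real (card ?T * l)" by (rule of_nat_mono)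
    then have 3: "3 * q * (\<Sum>z\<in>Zl. real (card (?K z))) \<le> 16 * (l * real (card ?T)) + 16 * (q * card S)"
      using 1 2 by (simp add: mult.commute)
    have "3 * q * (q * card S) \<le> 3 * q * (4 * real l ^ 2 * (\<Sum>z\<in>Zl. real (card (?K z))))"
      using sumK q0 by (intro mult_left_mono) auto
    also have "\<dots> = 4 * real l ^ 2 * (3 * q * (\<Sum>z\<in>Zl. real (card (?K z))))" by simp
    also have "\<dots> \<le> 4 * real l ^ 2 * (16 * (l * real (card ?T)) + 16 * (q * card S))"
      by (rule mult_left_mono[OF 3]) simp
    also have "\<dots> = 64 * real l ^ 3 * card ?T + (64 * real l ^ 2) * (q * card S)"
      by (simp add: algebra_simps power2_eq_square power3_eq_cube)
    \<comment> \<open>The lower bound \<open>64 * l^2\<close> on \<open>q\<close> absorbs the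
      contribution of the degrees.\<close>
    also have "\<dots> \<le> 64 * real l ^ 3 * card ?T + q * (q * card S)"
      using mult_right_mono[OF q, of "q * card S"] q0 by simp
    finally have "2 * (q * q * card S) \<le> 64 * real l ^ 3 * card ?T" by (simp add: algebra_simps)
    then have T: "q ^ 2 * card S \<le> 32 * real l ^ 3 * card ?T" by (simp add: power2_eq_square)
    show thesis
    proof (rule ccontr)
      assume no: "\<not> thesis"
      \<comment> \<open>If no neighbourhood had \<open>?h\<close> pairs, there would be at most
        \<open>3 * ?h\<close> triangles per point, against the \<open>q^2 / (32 * l^3)\<close> just
        found; the constant 100 exceeds \<open>3 * 32\<close>.\<close>
      let ?h = "q ^ 2 / (100 * real l ^ 3)"
      have "card ?T \<le> 3 * ?h * card S"
      proof (rule degenerate_triangles[OF fin adj_sym, where q = q])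
        fix S' assume "S' \<subseteq> S"
        then show "adjsC C S' \<le> q * card S'" using max simple_subset[OF S(1)] by blast
      next
        fix V assume V: "V \<subseteq> S" "card V \<le> q"
        then have "simple C V" "card V \<le> 2 * q" using simple_subset[OF S(1)] q0 by auto
        then show "adjsC C V \<le> ?h" using that no by force
      qed
      then have "32 * real l ^ 3 * card ?T \<le> 32 * real l ^ 3 * (3 * ?h * card S)"
        by (intro mult_left_mono) auto
      also have "\<dots> = (96 / 100) * (q ^ 2 * card S)" using l_pos by (simp add: field_simps)
      finally have "q ^ 2 * card S \<le> (96 / 100) * (q ^ 2 * card S)" using T by linarith
      moreover have "0 < q ^ 2 * card S" using q0 cS by simp
      ultimately show False by linarith
    qed
  qed
qed

end

section \<open>Cliques of adjacent points\<close>

definition codeg :: "('a \<Rightarrow> 'a \<Rightarrow> bool) \<Rightarrow> 'a set \<Rightarrow> 'a \<Rightarrow> 'a \<Rightarrow> nat" where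
  "codeg A V x y = card {w\<in>V. A w x \<and> A w y}"

text \<open>Cauchy-Schwarz, read off from the variance being nonnegative.\<close>

lemma sum_squares_ge:
  fixes f :: "'a \<Rightarrow> real"
  assumes "finite V" "V \<noteq> {}"
  shows "(\<Sum>x\<in>V. f x) ^ 2 / card V \<le> (\<Sum>x\<in>V. f x ^ 2)"
proof -
  define D where "D = (\<Sum>x\<in>V. f x)"
  define v where "v = real (card V)"
  have v: "0 < v" using assms by (simp add: v_def card_gt_0_iff)
  define k where "k = 2 * (D / v)"
  have "0 \<le> (\<Sum>x\<in>V. (f x - D / v) ^ 2)" by (intro sum_nonneg) simp
  also have "\<dots> = (\<Sum>x\<in>V. f x ^ 2 + (D / v) ^ 2 - k * f x)"
    by (intro sum.cong) (auto simp: k_def power2_eq_square algebra_simps)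
  also have "\<dots> = (\<Sum>x\<in>V. f x ^ 2) + v * (D / v) ^ 2 - k * D"
    unfolding D_def by (simp add: sum.distrib sum_subtractf sum_distrib_left v_def)
  also have "v * (D / v) ^ 2 = D ^ 2 / v" using v by (simp add: power2_eq_square field_simps)
  also have "k * D = 2 * (D ^ 2 / v)" by (simp add: k_def power2_eq_square)
  finally show ?thesis by (simp add: D_def v_def)
qed

text \<open>Dependent random choice, with a single choice: in the neighbourhood of a suitable vertex few pairs
  have few common neighbours.\<close>

lemma few_bad_pairs:
  fixes c s :: real
  assumes fin: "finite V" and ne: "V \<noteq> {}" and "0 \<le> c" "0 \<le> s"
  obtains w where "w \<in> V"
    "c * card {(x, y). x \<in> {x\<in>V. A w x} \<and> y \<in> {x\<in>V. A w x} \<and> codeg A V x y \<le> s}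
      + real (card (adj_pairs A V)) ^ 2 / real (card V) ^ 2 \<le> real (deg_in A V w) ^ 2 + c * s * card V"
proof -
  define v where "v = real (card V)"
  define D where "D = real (card (adj_pairs A V))"
  have v: "0 < v" using fin ne by (simp add: v_def card_gt_0_iff)
  let ?P = "{p\<in>V \<times> V. codeg A V (fst p) (snd p) \<le> s}"
  let ?bad = "\<lambda>w. {p\<in>?P. A w (fst p) \<and> A w (snd p)}"
  have finP: "finite ?P" using fin by auto
  have bad: "{(x, y). x \<in> {x\<in>V. A w x} \<and> y \<in> {x\<in>V. A w x} \<and> codeg A V x y \<le> s} = ?bad w" for w
    by auto
  \<comment> \<open>Double counting: a pair with at most \<open>s\<close> common neighbours lies in
    at most \<open>s\<close> neighbourhoods.\<close>
  have "(\<Sum>w\<in>V. card (?bad w)) = (\<Sum>p\<in>?P. card {w\<in>V. A w (fst p) \<and> A w (snd p)})"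
    by (rule sum_card_swap[OF fin finP])
  then have "real (\<Sum>w\<in>V. card (?bad w)) = (\<Sum>p\<in>?P. real (codeg A V (fst p) (snd p)))"
    by (simp add: codeg_def)
  also have "\<dots> \<le> (\<Sum>p\<in>?P. s)" by (intro sum_mono) auto
  also have "\<dots> \<le> s * (card V * card V)"
  proof -
    have "card ?P \<le> card (V \<times> V)" using fin by (intro card_mono) auto
    then have "real (card ?P) \<le> card V * card V" unfolding card_cartesian_product by (rule of_nat_mono)
    then have "real (card ?P) * s \<le> real (card V * card V) * s" using assms(4) by (rule mult_right_mono)
    then show ?thesis by (simp add: mult.commute)
  qed
  finally have B: "(\<Sum>w\<in>V. real (card (?bad w))) \<le> s * v * v" by (simp add: v_def)
  have "(\<Sum>w\<in>V. real (deg_in A V w)) = D"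
    using card_adj_pairs[OF fin, of A] by (simp add: D_def)
  then have Sq: "D ^ 2 / v \<le> (\<Sum>w\<in>V. real (deg_in A V w) ^ 2)"
    using sum_squares_ge[OF fin ne, of "\<lambda>w. real (deg_in A V w)"] by (simp add: v_def)
  \<comment> \<open>Averaging the difference makes a single \<open>w\<close> serve both purposes: a
    large neighbourhood and few bad pairs in it.\<close>
  have "(\<Sum>w\<in>V. c * card (?bad w) - real (deg_in A V w) ^ 2)
    = c * (\<Sum>w\<in>V. real (card (?bad w))) - (\<Sum>w\<in>V. real (deg_in A V w) ^ 2)"
    by (simp add: sum_subtractf sum_distrib_left)
  also have "\<dots> \<le> c * (s * v * v) - D ^ 2 / v"
    using mult_left_mono[OF B assms(3)] Sq by linarith
  also have "\<dots> = (c * s * v - D ^ 2 / v ^ 2) * card V"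
    using v by (simp add: v_def[symmetric] field_simps power2_eq_square)
  finally obtain w where w: "w \<in> V" "c * card (?bad w) - real (deg_in A V w) ^ 2 \<le> c * s * v - D ^ 2 / v ^ 2"
    by (rule exists_le_average[OF fin ne])
  show thesis
    by (rule that[OF w(1)]) (use w(2) bad in \<open>simp add: v_def D_def\<close>)
qed

text \<open>Markov's inequality: at most half of the vertices can have more than
  \<open>\<beta>\<close> bad partners.\<close>

lemma many_good_vertices:
  fixes \<beta> :: real
  assumes A: "finite A" and "0 < \<beta>" and bad: "2 * real (card {(x, y). x \<in> A \<and> y \<in> A \<and> R x y}) \<le> \<beta> * card A"
  shows "card A \<le> 2 * real (card {x\<in>A. card {y\<in>A. R x y} \<le> \<beta>})"
proof -
  let ?B = "{x\<in>A. \<beta> < card {y\<in>A. R x y}}" and ?G = "{x\<in>A. card {y\<in>A. R x y} \<le> \<beta>}"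
  have "\<beta> * card ?B = (\<Sum>x\<in>?B. \<beta>)" by simp
  also have "\<dots> \<le> (\<Sum>x\<in>?B. real (card {y\<in>A. R x y}))" by (intro sum_mono) auto
  also have "\<dots> \<le> (\<Sum>x\<in>A. real (card {y\<in>A. R x y}))" using A by (intro sum_mono2) auto
  also have "\<dots> = card (SIGMA x:A. {y\<in>A. R x y})" using A by simp
  also have "(SIGMA x:A. {y\<in>A. R x y}) = {(x, y). x \<in> A \<and> y \<in> A \<and> R x y}" by auto
  finally have "\<beta> * (2 * card ?B) \<le> \<beta> * card A" using bad by simp
  then have "2 * real (card ?B) \<le> card A" using assms(2) by simp
  moreover have "card A \<le> card ?G + card ?B"
    using card_Un_le[of ?G ?B] A by (intro order.trans[OF card_mono[of "?G \<union> ?B" A]]) auto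
  ultimately show ?thesis by linarith
qed

context line_bounded
begin

text \<open>Greedy choice: fewer than \<open>n\<close> chosen points exclude at most
  \<open>n * \<beta>\<close> points as bad partners and at most \<open>l^n\<close> points by their
  span.\<close>

lemma pick_independent:
  assumes V: "simple C V" and A: "A0 \<subseteq> V" and l2: "2 \<le> l"
    and deg: "\<And>x. x \<in> A0 \<Longrightarrow> real (card {y\<in>A0. R x y}) \<le> \<beta>"
    and big: "n * \<beta> + real l ^ n < card A0" and \<beta>: "0 \<le> \<beta>"
    and sym: "\<And>x y. R x y \<Longrightarrow> R y x"
  shows "k \<le> n \<Longrightarrow> \<exists>X\<subseteq>A0. card X = k \<and> ind C X \<and> (\<forall>x\<in>X. \<forall>y\<in>X. x \<noteq> y \<longrightarrow> \<not> R x y)"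
proof (induction k)
  case 0
  then show ?case by (intro exI[of _ "{}"]) (auto simp: ind_def)
next
  case (Suc k)
  then obtain X where X: "X \<subseteq> A0" "card X = k" "ind C X" "\<forall>x\<in>X. \<forall>y\<in>X. x \<noteq> y \<longrightarrow> \<not> R x y" by auto
  have fX: "finite X" by (rule ind_finite[OF X(3)])
  have fA: "finite A0" using A simple_finite[OF V] finite_subset by blast
  let ?B = "\<Union>x\<in>X. {y\<in>A0. R x y}" and ?D = "{y\<in>A0. y \<in> cl (C \<union> X)}"
  have "card ?B \<le> (\<Sum>x\<in>X. card {y\<in>A0. R x y})" by (rule card_UN_le[OF fX])
  then have "real (card ?B) \<le> (\<Sum>x\<in>X. real (card {y\<in>A0. R x y}))"
    unfolding of_nat_sum[symmetric] by (rule of_nat_mono)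
  also have "\<dots> \<le> (\<Sum>x\<in>X. \<beta>)" using X(1) deg by (intro sum_mono) auto
  also have "\<dots> \<le> n * \<beta>" using X(2) Suc.prems \<beta> by (simp add: mult_right_mono)
  finally have B: "real (card ?B) \<le> n * \<beta>" .
  have "simple C ?D" using A by (intro simple_subset[OF V]) auto
  moreover have "r (C \<union> ?D) \<le> r C + n"
  proof -
    have "C \<union> ?D \<subseteq> cl (C \<union> X)" by (auto intro: in_clI)
    then have "r (C \<union> ?D) \<le> r (C \<union> X)" by (rule r_le_of_subset_cl)
    then show ?thesis using X Suc.prems by (simp add: ind_def)
  qed
  ultimately have "card ?D \<le> l ^ n" using l2 by (rule card_simple_le_power)
  then have D: "real (card ?D) \<le> real l ^ n" using of_nat_mono[of "card ?D" "l ^ n"] by simp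
  have "card (?B \<union> ?D) \<le> card ?B + card ?D" by (rule card_Un_le)
  then have "real (card (?B \<union> ?D)) < card A0" using B D big by linarith
  then have "\<not> A0 \<subseteq> ?B \<union> ?D" using card_mono[of "?B \<union> ?D" A0] fA fX by auto
  then obtain x where x: "x \<in> A0" "x \<notin> ?B" "x \<notin> ?D" by blast
  have x': "x \<notin> cl (C \<union> X)" using x by blast
  then have "x \<notin> X" using in_clI by blast
  show ?case
  proof (intro exI conjI)
    show "insert x X \<subseteq> A0" using X x by blast
    show "card (insert x X) = Suc k" using \<open>x \<notin> X\<close> fX X by simp
    show "ind C (insert x X)" by (rule ind_insert[OF X(3) x'])
    show "\<forall>u\<in>insert x X. \<forall>y\<in>insert x X. u \<noteq> y \<longrightarrow> \<not> R u y"
      using X(4) x sym by blast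
  qed
qed

text \<open>A common neighbour \<open>y\<close> outside the current span makes \<open>x\<close> and \<open>x'\<close> adjacent: contracting the third
  point of the line through \<open>x\<close> and \<open>y\<close> identifies these two points.\<close>

lemma link:
  assumes "ind C' X" "C \<subseteq> C'" "x \<in> X" "x' \<in> X" "x \<noteq> x'"
    and y: "tri C x y z" "adj C y x'" "y \<notin> cl (C' \<union> X)"
  shows "ind (insert z C') X" "adj (insert z C') x x'"
proof -
  have z: "z \<notin> cl (C' \<union> X)"
  proof
    assume z: "z \<in> cl (C' \<union> X)"
    have "y \<in> cl (C' \<union> X)"
      by (rule in_cl_trans[OF tri_cl(3)[OF y(1)]]) (use z assms in \<open>auto intro: in_clI\<close>)
    then show False using y(3) by blast
  qed
  show i: "ind (insert z C') X" by (rule ind_contract[OF assms(1) z])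
  have p: "pw (insert z C') x x'" by (rule ind_pw[OF i assms(3-5)])
  have yx: "y \<in> cl (insert x (insert z C'))"
    by (rule cl_monoD[OF tri_cl(3)[OF y(1)]]) (use assms(2) in blast)
  have xy: "x \<in> cl (insert y (insert z C'))"
    by (rule cl_monoD[OF tri_cl(2)[OF y(1)]]) (use assms(2) in blast)
  have ny: "y \<notin> cl (insert z C')"
  proof
    assume "y \<in> cl (insert z C')"
    then have "insert y (insert z C') \<subseteq> cl (insert z C')" by (auto intro: in_clI)
    then have "x \<in> cl (insert z C')" by (rule in_cl_trans[OF xy])
    then show False using pwD(1)[OF p] by blast
  qed
  have "pw (insert z C') y x'" by (rule pw_parallel[OF p yx ny])
  then have "adj (insert z C') y x'" using assms(2) by (intro adj_mono[OF y(2)]) auto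
  then show "adj (insert z C') x x'" by (rule adj_parallel[OF _ xy pwD(1)[OF p]])
qed

text \<open>Each pair costs one contraction, so at every stage the span of \<open>C'\<close> and
  \<open>X\<close> has rank at most \<open>n + m\<close> over \<open>C\<close> and contains at most
  \<open>l^(n + m)\<close> points of \<open>V\<close>. The codegree thus leaves a common neighbour
  outside the span. As \<open>X\<close> stays independent, adjacencies obtained earlier
  persist.\<close>

lemma link_pairs:
  assumes V: "simple C V" and l2: "2 \<le> l" and X: "X \<subseteq> V" "ind C X" "card X = n"
    and good: "\<And>x y. x \<in> X \<Longrightarrow> y \<in> X \<Longrightarrow> x \<noteq> y \<Longrightarrow> l ^ (n + m) < codeg (adj C) V x y"
  shows "finite F \<Longrightarrow> F \<subseteq> {e. e \<subseteq> X \<and> card e = 2} \<Longrightarrow> card F \<le> m \<Longrightarrow>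
    \<exists>C'. C \<subseteq> C' \<and> ind C' X \<and> r C' \<le> r C + card F \<and> (\<forall>x y. x \<noteq> y \<longrightarrow> {x, y} \<in> F \<longrightarrow> adj C' x y)"
proof (induction F rule: finite_induct)
  case empty
  show ?case using X by (intro exI[of _ C]) auto
next
  case (insert e F)
  then obtain C' where C': "C \<subseteq> C'" "ind C' X" "r C' \<le> r C + card F"
    "\<forall>x y. x \<noteq> y \<longrightarrow> {x, y} \<in> F \<longrightarrow> adj C' x y" by auto
  obtain x x' where e: "e = {x, x'}" "x \<noteq> x'" "x \<in> X" "x' \<in> X"
    using insert.prems by (auto simp: card_2_iff)
  let ?W = "{w\<in>V. adj C w x \<and> adj C w x'}"
  have "\<not> ?W \<subseteq> cl (C' \<union> X)"
  proof
    assume W: "?W \<subseteq> cl (C' \<union> X)"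
    have "C \<union> ?W \<subseteq> cl (C' \<union> X)" using W C'(1) by (auto intro: in_clI)
    then have "r (C \<union> ?W) \<le> r (C' \<union> X)" by (rule r_le_of_subset_cl)
    also have "\<dots> \<le> r C + (n + m)" using C' X insert.prems insert.hyps by (simp add: ind_def)
    finally have "card ?W \<le> l ^ (n + m)"
      using l2 by (intro card_simple_le_power[of C]) (auto intro: simple_subset[OF V])
    then show False using good[OF e(3,4,2)] by (simp add: codeg_def)
  qed
  then obtain y where y: "y \<in> V" "adj C y x" "adj C y x'" "y \<notin> cl (C' \<union> X)" by blast
  obtain z where z: "tri C x y z" using adj_sym[OF y(2)] by (auto simp: adj_def)
  note l = link[OF C'(2) C'(1) e(3,4,2) z y(3,4)]
  show ?case
  proof (intro exI conjI allI impI)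
    show "C \<subseteq> insert z C'" using C' by blast
    show "ind (insert z C') X" by (rule l)
    show "r (insert z C') \<le> r C + card (insert e F)"
      using r_insert_le[of z C'] C'(3) insert.hyps by simp
    fix u v assume uv: "u \<noteq> v" "{u, v} \<in> insert e F"
    show "adj (insert z C') u v"
    proof (cases "{u, v} = e")
      case True
      then have "(u = x \<and> v = x') \<or> (u = x' \<and> v = x)" using e by (auto simp: doubleton_eq_iff)
      then show ?thesis using l(2) adj_sym by blast
    next
      case False
      then have "{u, v} \<in> F" using uv by blast
      then have a: "adj C' u v" and "u \<in> X" "v \<in> X" using C'(4) uv insert.prems by auto
      then have "pw (insert z C') u v" using uv by (intro ind_pw[OF l(1)])
      then show ?thesis by (rule adj_mono[OF a subset_insertI])
    qed
  qed
qed

text \<open>The threshold \<open>s\<close> bounds the points in a flat whose rank allows for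
  \<open>n\<close> chosen points and one contraction for each of their pairs.\<close>

lemma clique_of_locally_dense:
  fixes q :: real and n :: nat
  defines "s \<equiv> l ^ (n + (n choose 2))"
  assumes V: "simple C V" "card V \<le> 2 * q" "q ^ 2 / (100 * real l ^ 3) \<le> adjsC C V"
    and l2: "2 \<le> l" and n: "1 \<le> n" and q: "1280000 * n * real s * real l ^ 6 \<le> q"
  obtains C' X where "ind C' X" "card X = n" "\<And>x y. x \<in> X \<Longrightarrow> y \<in> X \<Longrightarrow> x \<noteq> y \<Longrightarrow> adj C' x y"
proof -
  have fin: "finite V" by (rule simple_finite[OF V(1)])
  have s1: "1 \<le> s" "l ^ n \<le> s" unfolding s_def using l2 by (auto intro!: one_le_power power_increasing)
  have L: "1 \<le> real l ^ 6" using l2 by (intro one_le_power) simp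
  have ns: "1 \<le> real n * real s" using n s1 mult_mono[of 1 "real n" 1 "real s"] by simp
  have "1280000 * (real n * real s) * 1 \<le> 1280000 * (real n * real s) * real l ^ 6"
    using L ns by (intro mult_left_mono) auto
  then have q': "1280000 * (real n * real s) \<le> q" using q by (simp add: mult.assoc)
  then have q0: "0 < q" using ns by linarith
  have D0: "0 < q ^ 2 / (100 * real l ^ 3)" using q0 l2 by simp
  have "V \<noteq> {}" using V(3) D0 by (auto simp: adj_pairs_def)
  then have v0: "0 < real (card V)" using fin by (simp add: card_gt_0_iff)
  let ?R = "\<lambda>x y. real (codeg (adj C) V x y) \<le> real s"
  obtain w where w: "w \<in> V" "8 * real n * card {(x, y). x \<in> {x\<in>V. adj C w x} \<and> y \<in> {x\<in>V. adj C w x} \<and> ?R x y}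
      + real (adjsC C V) ^ 2 / real (card V) ^ 2 \<le> real (degC C V w) ^ 2 + 8 * real n * real s * card V"
    by (rule few_bad_pairs[OF fin \<open>V \<noteq> {}\<close>, of "8 * real n" "real s"]) auto
  define A where "A = {x\<in>V. adj C w x}"
  define a where "a = real (card A)"
  define b where "b = real (card {(x, y). x \<in> A \<and> y \<in> A \<and> ?R x y})"
  have finA: "finite A" using fin by (simp add: A_def)
  have w': "8 * real n * b + real (adjsC C V) ^ 2 / real (card V) ^ 2 \<le> a ^ 2 + 8 * real n * real s * card V"
    using w(2) by (simp add: a_def b_def A_def deg_in_def)
  \<comment> \<open>The average degree in \<open>V\<close> is at least
    \<open>q / (200 * l^3)\<close>. The factor \<open>1280000 = 32 * 40000\<close> makes its square
    at least \<open>32 * n * s * q\<close>, of which the error term of the random choice takes at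
    most half.\<close>
  have "(q / (200 * real l ^ 3)) ^ 2 \<le> (real (adjsC C V) / real (card V)) ^ 2"
  proof (rule power_mono)
    have "q / (200 * real l ^ 3) = (q ^ 2 / (100 * real l ^ 3)) / (2 * q)"
      using q0 by (simp add: power2_eq_square)
    also have "\<dots> \<le> real (adjsC C V) / real (card V)"
      using V(2,3) v0 D0 by (intro frac_le) auto
    finally show "q / (200 * real l ^ 3) \<le> real (adjsC C V) / real (card V)" .
  qed (use q0 in simp)
  moreover have "(q / (200 * real l ^ 3)) ^ 2 = q * (q / (40000 * real l ^ 6))"
    by (simp add: power_divide power_mult_distrib power2_eq_square power3_eq_cube eval_nat_numeral)
  moreover have "32 * (real n * real s) \<le> q / (40000 * real l ^ 6)"
    using q l2 by (simp add: pos_le_divide_eq algebra_simps)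
  then have "q * (32 * (real n * real s)) \<le> q * (q / (40000 * real l ^ 6))"
    using q0 by (intro mult_left_mono) auto
  ultimately have "32 * (real n * real s) * q \<le> real (adjsC C V) ^ 2 / real (card V) ^ 2"
    using l2 by (simp add: power_divide mult.commute)
  moreover have "8 * real n * real s * card V \<le> 8 * real n * real s * (2 * q)"
    using V(2) by (intro mult_left_mono) auto
  ultimately have w2: "8 * real n * b + 16 * (real n * real s) * q \<le> a ^ 2" using w' by (simp add: algebra_simps)
  have "16 * (real n * real s) * (16 * (real n * real s)) \<le> 16 * (real n * real s) * q"
    using q' ns by (intro mult_left_mono) auto
  moreover have "0 \<le> 8 * real n * b" by (simp add: b_def)
  moreover have "(16 * (real n * real s)) ^ 2 = 16 * (real n * real s) * (16 * (real n * real s))"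
    by (rule power2_eq_square)
  ultimately have "(16 * (real n * real s)) ^ 2 \<le> a ^ 2" using w2 by linarith
  then have a: "16 * (real n * real s) \<le> a" by (rule power2_le_imp_le) (simp add: a_def)
  have "0 \<le> 16 * (real n * real s) * q" using ns q0 by (intro mult_nonneg_nonneg) auto
  then have b: "8 * real n * b \<le> a * a" using w2 unfolding power2_eq_square by linarith
  have a0: "0 < a" using a ns by linarith
  \<comment> \<open>The bad partners of \<open>n\<close> points then cover at most
    \<open>a / 4\<close> vertices, and a span covers at most \<open>l^n <= s <= a / 16\<close>;
    together this is less than the \<open>a / 2\<close> vertices available in
    \<open>A0\<close>.\<close>
  define \<beta> where "\<beta> = a / (4 * real n)"
  have \<beta>0: "0 < \<beta>" using a0 n by (simp add: \<beta>_def)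
  define A0 where "A0 = {x\<in>A. real (card {y\<in>A. ?R x y}) \<le> \<beta>}"
  have "2 * b \<le> \<beta> * a" using b n by (simp add: \<beta>_def field_simps)
  then have cA0: "a \<le> 2 * real (card A0)"
    unfolding a_def b_def A0_def by (rule many_good_vertices[OF finA \<beta>0])
  have finA0: "A0 \<subseteq> A" "finite A0" using finA by (auto simp: A0_def)
  have "\<exists>X\<subseteq>A0. card X = n \<and> ind C X \<and> (\<forall>x\<in>X. \<forall>y\<in>X. x \<noteq> y \<longrightarrow> \<not> ?R x y)"
  proof (rule pick_independent[OF V(1) _ l2])
    show "A0 \<subseteq> V" using finA0 by (auto simp: A_def)
    show "real (card {y\<in>A0. ?R x y}) \<le> \<beta>" if "x \<in> A0" for x
    proof -
      have "card {y\<in>A0. ?R x y} \<le> card {y\<in>A. ?R x y}" using finA finA0 by (intro card_mono) auto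
      then show ?thesis using that by (simp add: A0_def)
    qed
    have "n * \<beta> = a / 4" using n by (simp add: \<beta>_def)
    moreover have "real l ^ n \<le> real s" using s1(2) by (metis of_nat_le_iff of_nat_power)
    moreover have "real s \<le> real n * real s" using n by (simp add: mult_le_cancel_right1)
    ultimately show "n * \<beta> + real l ^ n < card A0" using a cA0 ns by linarith
    show "?R y x" if "?R x y" for x y using that by (simp add: codeg_def conj_commute)
  qed (use \<beta>0 in auto)
  then obtain X where X: "X \<subseteq> A0" "card X = n" "ind C X" "\<forall>x\<in>X. \<forall>y\<in>X. x \<noteq> y \<longrightarrow> \<not> ?R x y" by blast
  let ?F = "{e. e \<subseteq> X \<and> card e = 2}"
  have fX: "finite X" by (rule ind_finite[OF X(3)])
  have cF: "card ?F = n choose 2" using n_subsets[OF fX, of 2] X(2) by simp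
  have "\<exists>C'. C \<subseteq> C' \<and> ind C' X \<and> r C' \<le> r C + card ?F \<and> (\<forall>x y. x \<noteq> y \<longrightarrow> {x, y} \<in> ?F \<longrightarrow> adj C' x y)"
  proof (rule link_pairs[OF V(1) l2 _ X(3,2)])
    show "X \<subseteq> V" using X finA0 by (auto simp: A_def)
    show "l ^ (n + (n choose 2)) < codeg (adj C) V x y" if "x \<in> X" "y \<in> X" "x \<noteq> y" for x y
      using X(4) that unfolding s_def of_nat_le_iff not_le by blast
    show "finite ?F" using fX by auto
  qed (use cF in auto)
  then obtain C' where C': "ind C' X" "\<forall>x y. x \<noteq> y \<longrightarrow> {x, y} \<in> ?F \<longrightarrow> adj C' x y" by blast
  show thesis
    by (rule that[OF C'(1) X(2)]) (use C'(2) in auto)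
qed

end

section \<open>Many short paths with fresh colours\<close>

lemma exists_new_color:
  assumes "finite V" "\<And>x. card {q\<in>V. e q = x} \<le> m" "S \<subseteq> V" "finite U" "m * card U < card S"
  obtains q where "q \<in> S" "e q \<notin> U"
proof (rule ccontr)
  assume n: "\<not> thesis"
  have "e q \<in> U" if "q \<in> S" for q using n that \<open>\<And>q. q \<in> S \<Longrightarrow> e q \<notin> U \<Longrightarrow> thesis\<close> by metis
  then have "S \<subseteq> (\<Union>x\<in>U. {q\<in>V. e q = x})" using assms(3) by auto
  then have "card S \<le> card (\<Union>x\<in>U. {q\<in>V. e q = x})" using assms by (intro card_mono) auto
  also have "\<dots> \<le> (\<Sum>x\<in>U. card {q\<in>V. e q = x})" by (rule card_UN_le[OF assms(4)])
  also have "\<dots> \<le> card U * m" using sum_bounded_above[of U "\<lambda>x. card {q\<in>V. e q = x}" m] assms(2) by simp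
  finally show False using assms(5) by (simp add: mult.commute)
qed

text \<open>In the application \<open>V\<close> is the star at a joint \<open>b\<close> and the
  colour of a point is its other joint; a colour outside \<open>U\<close> then means a point outside
  the span of \<open>b\<close> and \<open>U\<close>. The inner vertices also have pairwise different
  colours.\<close>

abbreviation fresh_path :: "('a \<Rightarrow> 'a \<Rightarrow> bool) \<Rightarrow> 'a set \<Rightarrow> ('a \<Rightarrow> 'b) \<Rightarrow> 'b set \<Rightarrow> 'a \<Rightarrow> 'a \<Rightarrow> bool" where
  "fresh_path H V e U a a' \<equiv> \<exists>p1\<in>V. \<exists>p2\<in>V. \<exists>p3\<in>V. H a p1 \<and> H p1 p2 \<and> H p2 p3 \<and> H p3 a'
    \<and> e p1 \<notin> U \<and> e p2 \<notin> insert (e p1) U \<and> e p3 \<notin> insert (e p2) (insert (e p1) U)"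

text \<open>The middle vertex \<open>p2\<close> is taken from the neighbourhood of a suitable vertex, most pairs of which have many
  common neighbours.\<close>

lemma robust_paths:
  fixes R :: real and e :: "'a \<Rightarrow> 'b"
  assumes fin: "finite V" and ne: "V \<noteq> {}" and sym: "\<And>x y. H x y \<Longrightarrow> H y x"
    and col: "\<And>x. card {q\<in>V. e q = x} \<le> m" and m: "1 \<le> m"
    and deg: "\<And>p. p \<in> V \<Longrightarrow> R - m \<le> deg_in H V p" and cV: "card V \<le> 2 * R"
    and R: "20 * real m * real N \<le> R" and N: "k + 3 \<le> N" "u + 3 \<le> N"
  obtains A where "A \<subseteq> V" "card A = k" "inj_on e A"
    "\<And>a a' U. a \<in> A \<Longrightarrow> a' \<in> A \<Longrightarrow> finite U \<Longrightarrow> card U \<le> u \<Longrightarrow> fresh_path H V e U a a'"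
proof -
  let ?s = "real m * real N"
  let ?R = "\<lambda>x y. real (codeg H V x y) \<le> ?s"
  have sN: "real m * 3 \<le> ?s" using N by (intro mult_left_mono) auto
  have R0: "0 < R" using R sN m by linarith
  obtain w where w: "w \<in> V" "8 * card {(x, y). x \<in> {x\<in>V. H w x} \<and> y \<in> {x\<in>V. H w x} \<and> ?R x y}
      + real (card (adj_pairs H V)) ^ 2 / real (card V) ^ 2 \<le> real (deg_in H V w) ^ 2 + 8 * ?s * card V"
    by (rule few_bad_pairs[OF fin ne, of 8 ?s]) auto
  define A where "A = {x\<in>V. H w x}"
  define a where "a = real (card A)"
  define b where "b = real (card {(x, y). x \<in> A \<and> y \<in> A \<and> ?R x y})"
  have AV: "A \<subseteq> V" "finite A" using fin by (auto simp: A_def)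
  have w': "8 * b + (real (card (adj_pairs H V)) / real (card V)) ^ 2 \<le> a ^ 2 + 8 * ?s * card V"
    using w(2) by (simp add: a_def b_def A_def deg_in_def power_divide)
  have v0: "0 < real (card V)" using fin ne by (simp add: card_gt_0_iff)
  have "card V * (R - m) \<le> (\<Sum>x\<in>V. real (deg_in H V x))"
    using sum_mono[of V "\<lambda>_. R - m" "\<lambda>x. real (deg_in H V x)"] deg by simp
  then have "card V * (R - m) \<le> card (adj_pairs H V)" using card_adj_pairs[OF fin, of H] by simp
  then have "R - m \<le> real (card (adj_pairs H V)) / real (card V)"
    using v0 by (simp add: pos_le_divide_eq mult.commute)
  moreover have Rl: "0 \<le> R - m" using R sN by linarith
  ultimately have "(R - m) ^ 2 \<le> (real (card (adj_pairs H V)) / real (card V)) ^ 2" by (intro power_mono)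
  \<comment> \<open>The error term is absorbed because \<open>16 * ?s <= R - 2 * m\<close>, so at
    most an eighth of the pairs in \<open>A\<close> are bad.\<close>
  moreover have "8 * ?s * card V \<le> (R - m) ^ 2"
  proof -
    have "8 * ?s * card V \<le> 8 * ?s * (2 * R)" using cV by (intro mult_left_mono) auto
    also have "\<dots> = R * (16 * ?s)" by simp
    also have "\<dots> \<le> R * (R - 2 * m)" using R sN R0 by (intro mult_left_mono) linarith+
    also have "\<dots> \<le> (R - m) ^ 2" by (simp add: power2_eq_square algebra_simps)
    finally show ?thesis .
  qed
  ultimately have b: "8 * b \<le> a ^ 2" using w' by linarith
  have a: "19 * ?s \<le> a"
  proof -
    have "R - m \<le> a" using deg[OF w(1)] by (simp add: a_def A_def deg_in_def)
    then show ?thesis using R sN by linarith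
  qed
  have a0: "0 < a" using a sN m by linarith
  define \<beta> where "\<beta> = a / 4"
  define A0 where "A0 = {x\<in>A. real (card {y\<in>A. ?R x y}) \<le> \<beta>}"
  have "0 < \<beta>" using a0 by (simp add: \<beta>_def)
  moreover have "2 * b \<le> \<beta> * a" using b by (simp add: \<beta>_def power2_eq_square)
  ultimately have cA0: "a \<le> 2 * real (card A0)"
    unfolding a_def b_def A0_def by (rule many_good_vertices[OF AV(2)])
  have finA0: "A0 \<subseteq> A" "finite A0" using AV by (auto simp: A0_def)
  \<comment> \<open>Fewer than \<open>k\<close> colours would occur on at most \<open>m * N\<close>
    vertices, but \<open>A0\<close> is larger.\<close>
  have "k \<le> card (e ` A0)"
  proof (rule ccontr)
    assume "\<not> ?thesis"
    then have "m * card (e ` A0) \<le> m * N" using N by (intro mult_left_mono) auto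
    then have "real (m * card (e ` A0)) \<le> ?s" using of_nat_mono[of _ "m * N"] by fastforce
    then have "m * card (e ` A0) < card A0" using cA0 a sN m by linarith
    then obtain q where "q \<in> A0" "e q \<notin> e ` A0"
      using exists_new_color[OF fin col, of A0 "e ` A0"] finA0 AV by blast
    then show False by blast
  qed
  then obtain T where "T \<subseteq> e ` A0" "card T = k" by (meson obtain_subset_with_card_n)
  then obtain X where X: "X \<subseteq> A0" "inj_on e X" "card X = k"
    by (metis card_image subset_image_inj)
  show thesis
  proof (rule that[of X])
    show "X \<subseteq> V" using X finA0 AV by blast
  next
    fix x x' and U :: "'b set" assume xs: "x \<in> X" "x' \<in> X" and U: "finite U" "card U \<le> u"
    have UN: "m * (card U + 2) \<le> m * N" using U N by (intro mult_left_mono) auto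
    have pick: "\<exists>q\<in>S. e q \<notin> W" if SW: "S \<subseteq> V" "finite W" "card W \<le> card U + 2" "?s < card S" for S and W :: "'b set"
    proof -
      have "m * card W \<le> m * (card U + 2)" using that by (intro mult_left_mono) auto
      then have "m * card W \<le> m * N" using UN by linarith
      then have "real (m * card W) \<le> real (m * N)" by (rule of_nat_mono)
      also have "\<dots> < real (card S)" using that(4) by simp
      finally have "m * card W < card S" by (simp only: of_nat_less_iff)
      then obtain q where "q \<in> S" "e q \<notin> W" by (rule exists_new_color[OF fin col SW(1,2)])
      then show ?thesis by blast
    qed
    \<comment> \<open>Each end has at most \<open>a / 4\<close> bad partners in \<open>A\<close>, so
      half of \<open>A\<close> is left for \<open>p2\<close>; afterwards \<open>p1\<close> and
      \<open>p3\<close> are common neighbours of \<open>p2\<close> with one end each. At most two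
      colours besides \<open>U\<close> are forbidden at any choice.\<close>
    let ?G = "{y\<in>A. \<not> ?R x y \<and> \<not> ?R x' y}"
    have "A \<subseteq> ?G \<union> {y\<in>A. ?R x y} \<union> {y\<in>A. ?R x' y}" by auto
    then have "card A \<le> card (?G \<union> {y\<in>A. ?R x y} \<union> {y\<in>A. ?R x' y})" using AV by (intro card_mono) auto
    also have "\<dots> \<le> card ?G + card {y\<in>A. ?R x y} + card {y\<in>A. ?R x' y}"
      using card_Un_le[of ?G "{y\<in>A. ?R x y}"] card_Un_le[of "?G \<union> {y\<in>A. ?R x y}" "{y\<in>A. ?R x' y}"] by linarith
    finally have "a \<le> card ?G + real (card {y\<in>A. ?R x y}) + real (card {y\<in>A. ?R x' y})"
      unfolding a_def by linarith
    moreover have "real (card {y\<in>A. ?R x y}) \<le> \<beta>" "real (card {y\<in>A. ?R x' y}) \<le> \<beta>"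
      using xs X(1) by (auto simp: A0_def)
    ultimately have "a \<le> 2 * real (card ?G)" by (simp add: \<beta>_def)
    then have "?s < card ?G" using a sN m by linarith
    then obtain p2 where p2: "p2 \<in> ?G" "e p2 \<notin> U" using pick[of ?G U] AV U by auto
    have "?s < card {w\<in>V. H w x \<and> H w p2}" using p2 by (simp add: codeg_def)
    moreover have "card (insert (e p2) U) \<le> card U + 2" using U by (simp add: card_insert_if)
    ultimately obtain p1 where p1: "p1 \<in> V" "H p1 x" "H p1 p2" "e p1 \<notin> insert (e p2) U"
      using pick[of "{w\<in>V. H w x \<and> H w p2}" "insert (e p2) U"] U by auto
    have "?s < card {w\<in>V. H w x' \<and> H w p2}" using p2 by (simp add: codeg_def)
    moreover have "card (insert (e p1) (insert (e p2) U)) \<le> card U + 2"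
      using U by (simp add: card_insert_if)
    ultimately obtain p3 where p3: "p3 \<in> V" "H p3 x'" "H p3 p2" "e p3 \<notin> insert (e p1) (insert (e p2) U)"
      using pick[of "{w\<in>V. H w x' \<and> H w p2}" "insert (e p1) (insert (e p2) U)"] U by auto
    have "p2 \<in> V" using p2 AV by blast
    then show "fresh_path H V e U x x'"
      using p1 p2(2) p3 sym by (intro bexI[of _ p1] bexI[of _ p2] bexI[of _ p3]) auto
  qed (use X in auto)
qed

section \<open>Frames\<close>

context line_bounded
begin

text \<open>\<open>B\<close> is the set of joints. By \<open>tri\<close> no point of
  \<open>P\<close> is parallel to a joint, so the joints themselves are not counted in the density
  \<open>card P / card B\<close>.\<close>

definition frame :: "'a set \<Rightarrow> 'a set \<Rightarrow> 'a set \<Rightarrow> bool" where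
  "frame C B P \<longleftrightarrow> ind C B \<and> simple C P \<and> (\<forall>p\<in>P. \<exists>b\<in>B. \<exists>b'\<in>B. tri C b b' p)"

text \<open>By \<open>cl_Int_ind\<close> the point \<open>p\<close> lies in the span of
  \<open>{b, b'} \<inter> Y\<close>, and no proper subset of \<open>{b, b'}\<close> spans it: the
  pair is the least support of \<open>p\<close>.\<close>

lemma support_subset:
  assumes "ind C B" "b \<in> B" "b' \<in> B" "tri C b b' p" "Y \<subseteq> B" "p \<in> cl (C \<union> Y)"
  shows "b \<in> Y" "b' \<in> Y"
proof -
  have "insert b (insert b' C) = C \<union> {b, b'}" by auto
  then have "p \<in> cl (C \<union> {b, b'})" using tri_cl(1)[OF assms(4)] by simp
  then have p: "p \<in> cl (C \<union> ({b, b'} \<inter> Y))"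
    using assms by (intro cl_Int_ind[OF assms(1)]) auto
  have n: "p \<notin> cl (insert b C)" "p \<notin> cl (insert b' C)" using assms(4) by (auto simp: tri_iff dest: pwD)
  show "b \<in> Y"
  proof (rule ccontr)
    assume "b \<notin> Y"
    then have "C \<union> ({b, b'} \<inter> Y) \<subseteq> insert b' C" by auto
    then show False using cl_monoD[OF p] n by blast
  qed
  show "b' \<in> Y"
  proof (rule ccontr)
    assume "b' \<notin> Y"
    then have "C \<union> ({b, b'} \<inter> Y) \<subseteq> insert b C" by auto
    then show False using cl_monoD[OF p] n by blast
  qed
qed

lemma tri_in_cl:
  assumes "tri C b b' p" "b \<in> Y" "b' \<in> Y" shows "p \<in> cl (C \<union> Y)"
  by (rule cl_monoD[OF tri_cl(1)[OF assms(1)]]) (use assms in auto)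

lemma collinear_supports:
  assumes B: "ind C B" "b \<in> B" "b' \<in> B" "c \<in> B" "c' \<in> B" "d \<in> B" "d' \<in> B"
    and t: "tri C b b' p" "tri C c c' q" "tri C d d' q'" and col: "tri C p q q'"
  shows "{b, b'} \<subseteq> {c, c', d, d'}"
proof -
  have "insert q (insert q' C) \<subseteq> cl (C \<union> {c, c', d, d'})"
    using tri_in_cl[OF t(2), of "{c, c', d, d'}"] tri_in_cl[OF t(3), of "{c, c', d, d'}"]
    by (auto intro: in_clI)
  then have "p \<in> cl (C \<union> {c, c', d, d'})" by (rule in_cl_trans[OF tri_cl(2)[OF col]])
  from support_subset[OF B(1,2,3) t(1) _ this] B show ?thesis by auto
qed

text \<open>With points of a frame seen as edges between joints, each of three collinear points has
  its support inside the union of the other two supports; if the first support differs from the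
  others, the three edges form a triangle.\<close>

lemma triangle_supports:
  assumes B: "ind C B" "b \<in> B" "b' \<in> B" "c \<in> B" "c' \<in> B" "d \<in> B" "d' \<in> B"
    and t: "tri C b b' p" "tri C c c' q" "tri C d d' q'" and col: "tri C p q q'"
    and ne: "{c, c'} \<noteq> {b, b'}" "{d, d'} \<noteq> {b, b'}"
  obtains x where "x \<in> B" "x \<noteq> b" "x \<noteq> b'"
    "{c, c'} = {b, x} \<and> {d, d'} = {b', x} \<or> {c, c'} = {b', x} \<and> {d, d'} = {b, x}"
proof -
  have 1: "{b, b'} \<subseteq> {c, c', d, d'}" by (rule collinear_supports[OF B t col])
  have 2: "{c, c'} \<subseteq> {d, d', b, b'}"
    by (rule collinear_supports[OF B(1,4,5,6,7,2,3) t(2,3,1) tri_rot[OF col]])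
  have 3: "{d, d'} \<subseteq> {b, b', c, c'}"
    by (rule collinear_supports[OF B(1,6,7,2,3,4,5) t(3,1,2) tri_rot[OF tri_rot[OF col]]])
  have n: "b \<noteq> b'" "c \<noteq> c'" "d \<noteq> d'" using t tri_neq(1) by auto
  have "\<exists>x\<in>B. x \<noteq> b \<and> x \<noteq> b' \<and> ({c, c'} = {b, x} \<and> {d, d'} = {b', x} \<or> {c, c'} = {b', x} \<and> {d, d'} = {b, x})"
  proof (cases "c \<in> {b, b'}")
    case True
    then have "c' \<notin> {b, b'}" using ne(1) n by auto
    then show ?thesis using True 1 2 3 n ne(2) B by (intro bexI[of _ c']) (auto simp: doubleton_eq_iff)
  next
    case False
    then have "c' \<in> {b, b'}" using 1 2 3 n ne by (auto simp: doubleton_eq_iff)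
    then show ?thesis using False 1 2 3 n ne(2) B by (intro bexI[of _ c]) (auto simp: doubleton_eq_iff)
  qed
  then show thesis using that by blast
qed

lemma support_unique:
  assumes "ind C B" "b \<in> B" "b' \<in> B" "c \<in> B" "c' \<in> B" "tri C b b' p" "tri C c c' p"
  shows "{b, b'} = {c, c'}"
proof -
  have "p \<in> cl (C \<union> {c, c'})" "p \<in> cl (C \<union> {b, b'})"
    using tri_in_cl[OF assms(7), of "{c, c'}"] tri_in_cl[OF assms(6), of "{b, b'}"] by auto
  from support_subset[OF assms(1,2,3,6) _ this(1)] support_subset[OF assms(1,4,5,7) _ this(2)]
  show ?thesis using assms by auto
qed

text \<open>Contraction of \<open>p\<close> identifies the joint \<open>b'\<close> with
  \<open>b\<close>. The points on the line of \<open>b\<close> and \<open>b'\<close> fall on this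
  joint or become loops and are dropped. Two other points merge only as sides of a triangle on
  \<open>b\<close>, \<open>b'\<close> and some \<open>x\<close>; \<open>T\<close> drops the side at
  \<open>b\<close>, the side at \<open>b'\<close> moves to the line of \<open>b\<close> and
  \<open>x\<close>.\<close>

lemma frame_contract:
  assumes F: "frame C B P" and b: "b \<in> B" "b' \<in> B" "p \<in> P" "tri C b b' p"
  defines "T \<equiv> {q\<in>P. (\<exists>x\<in>B. x \<noteq> b' \<and> tri C b x q) \<and> (\<exists>q'\<in>P. tri C p q q')}"
  shows "frame (insert p C) (B - {b'}) (P - {q\<in>P. tri C b b' q} - T)"
  unfolding frame_def
proof (intro conjI ballI)
  let ?C = "insert p C" and ?P = "P - {q\<in>P. tri C b b' q} - T"
  have B: "ind C B" and P: "simple C P" and on: "\<And>q. q \<in> P \<Longrightarrow> \<exists>c\<in>B. \<exists>c'\<in>B. tri C c c' q"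
    using F by (auto simp: frame_def)
  have bb: "b \<noteq> b'" by (rule tri_neq(1)[OF b(4)])
  have "p \<notin> cl (C \<union> (B - {b'}))" using support_subset(2)[OF B b(1,2,4), of "B - {b'}"] by auto
  then show i: "ind ?C (B - {b'})" by (intro ind_contract ind_subset[OF B]) auto
  have pu: "pw C p u" if "u \<in> ?P" for u using that b by (intro simple_pw[OF P]) auto
  show "simple ?C ?P"
    unfolding simple_def
  proof (intro conjI ballI impI)
    fix u assume "u \<in> ?P"
    then show "u \<notin> cl ?C" using pu by (auto dest: pwD)
  next
    fix u u' assume u: "u \<in> ?P" "u' \<in> ?P" "u \<noteq> u'"
    show "pw ?C u u'"
    proof (rule ccontr)
      assume n: "\<not> pw ?C u u'"
      have "pw C u u'" using u by (intro simple_pw[OF P]) auto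
      moreover have "u' \<in> cl (insert u ?C)" using n pu[OF u(1)] by (auto simp: pw_iff dest: pwD)
      ultimately have col: "tri C p u u'"
        using pu u by (auto simp: tri_iff insert_commute)
      obtain c c' where c: "c \<in> B" "c' \<in> B" "tri C c c' u" using on u by blast
      obtain d d' where d: "d \<in> B" "d' \<in> B" "tri C d d' u'" using on u by blast
      have "\<not> tri C b b' u" "\<not> tri C b b' u'" using u by blast+
      then have ne: "{c, c'} \<noteq> {b, b'}" "{d, d'} \<noteq> {b, b'}"
        using c(3) d(3) tri_swap by (auto simp: doubleton_eq_iff)
      obtain x where x: "x \<in> B" "x \<noteq> b" "x \<noteq> b'"
        "{c, c'} = {b, x} \<and> {d, d'} = {b', x} \<or> {c, c'} = {b', x} \<and> {d, d'} = {b, x}"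
        by (rule triangle_supports[OF B b(1,2) c(1,2) d(1,2) b(4) c(3) d(3) col ne])
      from x(4) show False
      proof
        assume "{c, c'} = {b, x} \<and> {d, d'} = {b', x}"
        then have "tri C b x u" using c(3) tri_swap by (auto simp: doubleton_eq_iff)
        then have "u \<in> T" using x col u unfolding T_def by blast
        then show False using u by blast
      next
        assume "{c, c'} = {b', x} \<and> {d, d'} = {b, x}"
        then have "tri C b x u'" using d(3) tri_swap by (auto simp: doubleton_eq_iff)
        moreover have "tri C p u' u" by (rule tri_swap[OF tri_rot[OF tri_rot[OF col]]])
        ultimately have "u' \<in> T" using x u unfolding T_def by blast
        then show False using u by blast
      qed
    qed
  qed
  have bpar: "b \<in> cl (insert b' ?C)" "b' \<in> cl (insert b ?C)"
    using tri_cl(2,3)[OF b(4)] by (auto simp: insert_commute)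
  have bnl: "b \<notin> cl ?C" "b' \<notin> cl ?C" using b(4) by (auto simp: tri_iff dest: pwD pw_sym)
  fix q assume q: "q \<in> ?P"
  have key: "\<exists>c\<in>B - {b'}. \<exists>c'\<in>B - {b'}. tri ?C c c' q"
    if c: "c \<in> B" "c' \<in> B" "tri C c c' q" "c' \<noteq> b'" for c c'
  proof (cases "c = b'")
    case False
    have "pw ?C c c'" using c False tri_neq(1)[OF c(3)] by (intro ind_pw[OF i]) auto
    then have "tri ?C c c' q" by (rule tri_mono[OF c(3) subset_insertI])
    then show ?thesis using c False by blast
  next
    case True
    have "c' \<noteq> b"
    proof
      assume "c' = b"
      then have "tri C b b' q" using c(3) True tri_swap by blast
      then show False using q by blast
    qed
    then have "pw ?C b c'" using c b bb by (intro ind_pw[OF i]) auto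
    then have p: "pw ?C b' c'" by (rule pw_parallel[OF _ bpar(2) bnl(2)])
    have "tri C b' c' q" using c(3) True by simp
    then have "tri ?C b' c' q" by (rule tri_mono[OF _ subset_insertI p])
    then have "tri ?C b c' q" by (rule tri_parallel[OF _ bpar(1) bnl(1)])
    then show ?thesis using c b bb by blast
  qed
  obtain c c' where c: "c \<in> B" "c' \<in> B" "tri C c c' q" using on q by blast
  show "\<exists>c\<in>B - {b'}. \<exists>c'\<in>B - {b'}. tri ?C c c' q"
  proof (cases "c' = b'")
    case True
    then have "c \<noteq> b'" using tri_neq(1)[OF c(3)] by auto
    then show ?thesis using key[OF c(2,1) tri_swap[OF c(3)]] by blast
  qed (use key[OF c] in blast)
qed

text \<open>One third point is chosen for each pair of joints; different pairs give nonparallel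
  points because supports are unique.\<close>

lemma clique_frame:
  assumes X: "ind C X" and adj: "\<And>x y. x \<in> X \<Longrightarrow> y \<in> X \<Longrightarrow> x \<noteq> y \<Longrightarrow> adj C x y"
  obtains P where "frame C X P" "card P = card X choose 2"
proof -
  have fX: "finite X" by (rule ind_finite[OF X])
  let ?F = "{e. e \<subseteq> X \<and> card e = 2}"
  have "\<forall>e\<in>?F. \<exists>p. \<exists>x\<in>X. \<exists>y\<in>X. e = {x, y} \<and> tri C x y p"
  proof
    fix e assume "e \<in> ?F"
    then obtain x y where "e = {x, y}" "x \<noteq> y" "x \<in> X" "y \<in> X" by (auto simp: card_2_iff)
    then show "\<exists>p. \<exists>x\<in>X. \<exists>y\<in>X. e = {x, y} \<and> tri C x y p" using adj unfolding adj_def by blast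
  qed
  then obtain f where f: "\<And>e. e \<in> ?F \<Longrightarrow> \<exists>x\<in>X. \<exists>y\<in>X. e = {x, y} \<and> tri C x y (f e)" by metis
  have sub: "e \<subseteq> e'" if e: "e \<in> ?F" "e' \<in> ?F" "f e \<in> cl (insert (f e') C)" for e e'
  proof -
    obtain x y where x: "x \<in> X" "y \<in> X" "e = {x, y}" "tri C x y (f e)" using f[OF e(1)] by blast
    obtain u v where u: "u \<in> X" "v \<in> X" "e' = {u, v}" "tri C u v (f e')" using f[OF e(2)] by blast
    have "f e' \<in> cl (C \<union> e')" by (rule tri_in_cl[OF u(4)]) (use u in auto)
    then have "insert (f e') C \<subseteq> cl (C \<union> e')" by (auto intro: in_clI)
    then have "f e \<in> cl (C \<union> e')" by (rule in_cl_trans[OF e(3)])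
    from support_subset[OF X x(1,2,4) _ this] u x show ?thesis by auto
  qed
  have eq: "e = e'" if "e \<in> ?F" "e' \<in> ?F" "f e \<in> cl (insert (f e') C)" for e e'
    using sub[OF that] that(1,2) fX by (intro card_subset_eq) (auto intro: finite_subset)
  have nl: "f e \<notin> cl C" if "e \<in> ?F" for e using f[OF that] by (auto simp: tri_iff dest: pwD)
  show thesis
  proof (rule that)
    show "frame C X (f ` ?F)"
      unfolding frame_def
    proof (intro conjI ballI X)
      show "simple C (f ` ?F)"
        unfolding simple_def
      proof (intro conjI ballI impI)
        fix p assume "p \<in> f ` ?F"
        then show "p \<notin> cl C" using nl by blast
      next
        fix p q assume "p \<in> f ` ?F" "q \<in> f ` ?F" and ne: "p \<noteq> q"
        then obtain e e' where e: "e \<in> ?F" "p = f e" "e' \<in> ?F" "q = f e'" by blast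
        have "q \<notin> cl (insert p C)" using eq[OF e(3,1)] e ne by auto
        then show "pw C p q" using nl e by (simp add: pw_iff)
      qed
    next
      fix p assume "p \<in> f ` ?F"
      then show "\<exists>b\<in>X. \<exists>b'\<in>X. tri C b b' p" using f by blast
    qed
    have "inj_on f ?F" by (intro inj_onI eq) (auto intro: in_clI)
    then have "card (f ` ?F) = card ?F" by (rule card_image)
    then show "card (f ` ?F) = card X choose 2" using n_subsets[OF fX, of 2] by simp
  qed
qed

definition star :: "'a set \<Rightarrow> 'a set \<Rightarrow> 'a set \<Rightarrow> 'a \<Rightarrow> 'a set" where
  "star C B P b = {p\<in>P. \<exists>b'\<in>B. tri C b b' p}"

text \<open>The points \<open>z\<close> are going to be contracted; they lie in a flat that avoids the star at \<open>b\<close>.\<close>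

definition star_adj :: "'a set \<Rightarrow> 'a set \<Rightarrow> 'a \<Rightarrow> 'a \<Rightarrow> 'a \<Rightarrow> bool" where
  "star_adj C B b p q \<longleftrightarrow> (\<exists>z \<in> cl (C \<union> (B - {b})). tri C p q z)"

lemma star_adj_sym: "star_adj C B b p q \<Longrightarrow> star_adj C B b q p"
  unfolding star_adj_def using tri_swap by blast

lemma frame_delete:
  assumes "frame C B P" shows "frame C (B - {b}) (P - star C B P b)"
  unfolding frame_def
proof (intro conjI ballI)
  have F: "ind C B" "simple C P" "\<And>p. p \<in> P \<Longrightarrow> \<exists>b\<in>B. \<exists>b'\<in>B. tri C b b' p"
    using assms by (auto simp: frame_def)
  show "ind C (B - {b})" by (rule ind_subset[OF F(1)]) blast
  show "simple C (P - star C B P b)" by (rule simple_subset[OF F(2)]) blast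
  fix p assume p: "p \<in> P - star C B P b"
  then obtain c c' where c: "c \<in> B" "c' \<in> B" "tri C c c' p" using F(3) by blast
  have "c \<noteq> b" using p c unfolding star_def by blast
  moreover have "c' \<noteq> b" using p c tri_swap[OF c(3)] unfolding star_def by blast
  ultimately show "\<exists>c\<in>B - {b}. \<exists>c'\<in>B - {b}. tri C c c' p" using c by blast
qed

text \<open>In a densest frame, contraction of a point of the star at \<open>b\<close> loses many points, and these lie in
  balanced triangles; a star of average size is then dense in itself.\<close>

lemma extremal_frame:
  assumes F0: "frame C0 B0 P0" "B0 \<noteq> {}" "P0 \<noteq> {}"
  obtains C B P b and R :: real where "frame C B P" "b \<in> B" "real (card P0) / card B0 \<le> R"
    "star C B P b \<noteq> {}" "card (star C B P b) \<le> 2 * R"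
    "\<And>p. p \<in> star C B P b \<Longrightarrow> R - real (l - 1) \<le> deg_in (star_adj C B b) (star C B P b) p"
proof -
  let ?F = "{(C, B, P). frame C B P \<and> B \<noteq> {}}"
  have cE: "card P \<le> card E" "card B \<le> card E" if "frame C B P" for C B P
    using that simple_in_E ind_simple finite_E unfolding frame_def by (auto intro!: card_mono)
  have bounds: "card (snd (snd x)) \<le> card E" "card (fst (snd x)) \<le> card E" if "x \<in> ?F" for x
    using cE that by auto
  have "(C0, B0, P0) \<in> ?F" using F0 by auto
  then obtain x where x: "x \<in> ?F"
    "\<And>y. y \<in> ?F \<Longrightarrow> real (card (snd (snd y))) / card (fst (snd y)) \<le> real (card (snd (snd x))) / card (fst (snd x))"
    by (rule max_ratio_attained[OF _ bounds]) (assumption | rule that)+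
  obtain C B P where CBP: "x = (C, B, P)" by (cases x)
  have F: "frame C B P" "B \<noteq> {}" using x(1) CBP by auto
  have Fmax: "real (card P') / card B' \<le> real (card P) / card B" if "frame C' B' P'" "B' \<noteq> {}" for C' B' P'
    using x(2)[of "(C', B', P')"] that CBP by simp
  define R where "R = real (card P) / card B"
  have max: "real (card P') \<le> R * card B'" if "frame C' B' P'" "B' \<noteq> {}" for C' B' P'
  proof -
    have "0 < card B'" using that ind_finite by (auto simp: frame_def card_gt_0_iff)
    then show ?thesis using Fmax[OF that] by (simp add: R_def pos_divide_le_eq)
  qed
  have R0: "real (card P0) / card B0 \<le> R" unfolding R_def by (rule Fmax[OF F0(1,2)])
  have B: "ind C B" and P: "simple C P" and on: "\<And>p. p \<in> P \<Longrightarrow> \<exists>b\<in>B. \<exists>b'\<in>B. tri C b b' p"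
    using F(1) by (auto simp: frame_def)
  have finB: "finite B" and finP: "finite P" using ind_finite[OF B] simple_finite[OF P] by auto
  have cB: "0 < card B" using F(2) finB by (simp add: card_gt_0_iff)
  have RP: "real (card P) = R * card B" using cB by (simp add: R_def)
  have "0 < card P0" "0 < card B0"
    using F0 simple_finite ind_finite by (auto simp: frame_def card_gt_0_iff)
  then have "0 < real (card P0) / card B0" by simp
  then have Rpos: "0 < R" using R0 by linarith
  have card_del: "real (card (B - {b})) = real (card B) - 1" if "b \<in> B" for b
    using card.remove[OF finB that] by simp
  let ?S = "star C B P"
  \<comment> \<open>A point lies only in the stars of its two joints, so the average star has at
    most \<open>2 * R\<close> points.\<close>
  have "(\<Sum>b\<in>B. card (?S b)) = (\<Sum>p\<in>P. card {b\<in>B. \<exists>b'\<in>B. tri C b b' p})"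
    unfolding star_def by (rule sum_card_swap[OF finB finP])
  also have "\<dots> \<le> (\<Sum>p\<in>P. 2)"
  proof (rule sum_mono)
    fix p assume "p \<in> P"
    then obtain c c' where c: "c \<in> B" "c' \<in> B" "tri C c c' p" using on by blast
    have "{b\<in>B. \<exists>b'\<in>B. tri C b b' p} \<subseteq> {c, c'}"
    proof
      fix b assume "b \<in> {b\<in>B. \<exists>b'\<in>B. tri C b b' p}"
      then obtain b' where b: "b \<in> B" "b' \<in> B" "tri C b b' p" by blast
      show "b \<in> {c, c'}" using support_unique[OF B b(1,2) c(1,2) b(3) c(3)] by blast
    qed
    then have "card {b\<in>B. \<exists>b'\<in>B. tri C b b' p} \<le> card {c, c'}" by (intro card_mono) auto
    also have "\<dots> \<le> 2" by (simp add: card_insert_if)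
    finally show "card {b\<in>B. \<exists>b'\<in>B. tri C b b' p} \<le> 2" .
  qed
  finally have "(\<Sum>b\<in>B. card (?S b)) \<le> 2 * card P" by simp
  then have "(\<Sum>b\<in>B. real (card (?S b))) \<le> real (2 * card P)"
    unfolding of_nat_sum[symmetric] by (rule of_nat_mono)
  then have "(\<Sum>b\<in>B. real (card (?S b))) \<le> (2 * R) * card B" using RP by simp
  then obtain b where b: "b \<in> B" "real (card (?S b)) \<le> 2 * R"
    by (rule exists_le_average[OF finB F(2)])
  have "P \<noteq> {}" using RP Rpos cB by auto
  then obtain p0 where "p0 \<in> P" by blast
  then obtain c c' where c: "c \<in> B" "c' \<in> B" "tri C c c' p0" using on by blast
  have ne: "B - {x} \<noteq> {}" for x using c tri_neq(1)[OF c(3)] by blast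
  show thesis
  proof (rule that[OF F(1) b(1) R0 _ b(2)])
    \<comment> \<open>Deleting a joint with an empty star would increase the density.\<close>
    show "?S b \<noteq> {}"
    proof
      assume "?S b = {}"
      then have "real (card P) \<le> R * card (B - {b})" using max[OF frame_delete[OF F(1), of b] ne] by simp
      then have "R * card B \<le> R * (real (card B) - 1)" using RP unfolding card_del[OF b(1)] by simp
      then show False using Rpos cB by (simp add: algebra_simps)
    qed
  next
    fix p assume "p \<in> ?S b"
    then obtain b' where p: "p \<in> P" "b' \<in> B" "tri C b b' p" by (auto simp: star_def)
    let ?L = "{q\<in>P. tri C b b' q}"
    let ?T = "{q\<in>P. (\<exists>x\<in>B. x \<noteq> b' \<and> tri C b x q) \<and> (\<exists>q'\<in>P. tri C p q q')}"
    \<comment> \<open>The contracted frame has one joint fewer, so at least \<open>R\<close> points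
      are lost; at most \<open>l - 1\<close> of them lie in \<open>?L\<close>, the others in
      \<open>?T\<close>.\<close>
    have "real (card (P - ?L - ?T)) \<le> R * card (B - {b'})"
      by (rule max[OF frame_contract[OF F(1) b(1) p(2,1,3)] ne])
    then have 1: "real (card (P - ?L - ?T)) \<le> R * card B - R" unfolding card_del[OF p(2)] right_diff_distrib by simp
    have "P \<subseteq> (P - ?L - ?T) \<union> ?L \<union> ?T" by blast
    then have "card P \<le> card ((P - ?L - ?T) \<union> ?L \<union> ?T)" using finP by (intro card_mono) auto
    also have "\<dots> \<le> card (P - ?L - ?T) + card ?L + card ?T"
      using card_Un_le[of "P - ?L - ?T" ?L] card_Un_le[of "(P - ?L - ?T) \<union> ?L" ?T] by linarith
    finally have 2: "card P \<le> card (P - ?L - ?T) + card ?L + card ?T" .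
    have 3: "card ?L \<le> l - 1" by (rule card_third_le[OF P])
    have "?T \<subseteq> {q\<in>?S b. star_adj C B b p q}"
    proof
      fix q assume "q \<in> ?T"
      then obtain x q' where q: "q \<in> P" "x \<in> B" "x \<noteq> b'" "tri C b x q" "q' \<in> P" "tri C p q q'" by blast
      obtain d d' where d: "d \<in> B" "d' \<in> B" "tri C d d' q'" using on q(5) by blast
      have nx: "b \<noteq> b'" "b \<noteq> x" using tri_neq(1)[OF p(3)] tri_neq(1)[OF q(4)] by auto
      \<comment> \<open>The third side of the triangle has the joints \<open>b'\<close> and
        \<open>x\<close>; it avoids \<open>b\<close>, so it may serve as the witness for
        \<open>star_adj\<close>.\<close>
      have "{b, x} \<subseteq> {d, d', b, b'}" "{b, b'} \<subseteq> {b, x, d, d'}" "{d, d'} \<subseteq> {b, b', b, x}"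
        using collinear_supports[OF B b(1) q(2) d(1,2) b(1) p(2) q(4) d(3) p(3) tri_rot[OF q(6)]]
          collinear_supports[OF B b(1) p(2) b(1) q(2) d(1,2) p(3) q(4) d(3) q(6)]
          collinear_supports[OF B d(1,2) b(1) p(2) b(1) q(2) d(3) p(3) q(4) tri_rot[OF tri_rot[OF q(6)]]]
        by auto
      then have "b' \<in> {d, d'}" "x \<in> {d, d'}" using nx q(3) by auto
      then have dd: "{d, d'} = {b', x}" using q(3) by auto
      have "q' \<in> cl (C \<union> (B - {b}))"
        by (rule tri_in_cl[OF d(3)]) (use dd d nx in auto)
      then have "star_adj C B b p q" using q(6) unfolding star_adj_def by blast
      then show "q \<in> {q\<in>?S b. star_adj C B b p q}" using q unfolding star_def by blast
    qed
    then have "card ?T \<le> deg_in (star_adj C B b) (?S b) p"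
      unfolding deg_in_def using finP by (intro card_mono) (auto simp: star_def)
    then show "R - real (l - 1) \<le> deg_in (star_adj C B b) (?S b) p"
      using 1 2 3 RP by linarith
  qed
qed

end

section \<open>Contractions along paths in the star of a joint\<close>

context line_bounded
begin

text \<open>One step of a walk starting at \<open>a\<close>: the current vertex \<open>p\<close> is
  already in the closure of \<open>a\<close>, and contracting the third point \<open>z\<close> of
  the line through \<open>p\<close> and \<open>q\<close> brings \<open>q\<close> there too. Since
  the joint \<open>x\<close> of \<open>q\<close> is new, \<open>q\<close> and hence \<open>z\<close>
  lie outside the span of \<open>b\<close> and \<open>U\<close>, which contains all that has been
  used; therefore \<open>A\<close> stays independent.\<close>

lemma star_extend:
  assumes B: "ind C B" "b \<in> B" and U: "U \<subseteq> B - {b}" and Z: "Z \<subseteq> cl (C \<union> (B - {b}))"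
    and sp: "C \<union> Z \<union> A \<subseteq> cl (C \<union> insert b U)" and A: "ind (C \<union> Z) A" "a \<in> A"
    and p: "p \<in> cl (insert a (C \<union> Z))" and q: "tri C b x q" "x \<in> B" "x \<notin> U" "star_adj C B b p q"
  obtains z where "insert z Z \<subseteq> cl (C \<union> (B - {b}))" "ind (C \<union> insert z Z) A"
    "C \<union> insert z Z \<union> A \<subseteq> cl (C \<union> insert b (insert x U))" "q \<in> cl (insert a (C \<union> insert z Z))"
proof -
  obtain z where z: "z \<in> cl (C \<union> (B - {b}))" "tri C p q z" using q(4) by (auto simp: star_adj_def)
  have xb: "x \<noteq> b" using tri_neq(1)[OF q(1)] by simp
  have nq: "q \<notin> cl (C \<union> insert b U)"
  proof
    assume "q \<in> cl (C \<union> insert b U)"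
    from support_subset(2)[OF B(1,2) q(2,1) _ this] U B(2) have "x \<in> insert b U" by auto
    then show False using xb q(3) by simp
  qed
  have p': "p \<in> cl (C \<union> insert b U)"
    by (rule in_cl_trans[OF p]) (use A(2) sp in auto)
  have nz: "z \<notin> cl ((C \<union> Z) \<union> A)"
  proof
    assume "z \<in> cl ((C \<union> Z) \<union> A)"
    then have "z \<in> cl (C \<union> insert b U)" by (rule in_cl_trans) (use sp in auto)
    then have "insert p (insert z C) \<subseteq> cl (C \<union> insert b U)" using p' by (auto intro: in_clI)
    then have "q \<in> cl (C \<union> insert b U)" by (rule in_cl_trans[OF tri_cl(3)[OF z(2)]])
    then show False using nq by blast
  qed
  have ext: "cl (C \<union> insert b U) \<subseteq> cl (C \<union> insert b (insert x U))" by (rule cl_mono) auto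
  have q': "q \<in> cl (C \<union> insert b (insert x U))" by (rule tri_in_cl[OF q(1)]) auto
  have eqC: "C \<union> insert z Z = insert z (C \<union> Z)" by auto
  show thesis
  proof (rule that[of z])
    show "insert z Z \<subseteq> cl (C \<union> (B - {b}))" using z Z by auto
    show "ind (C \<union> insert z Z) A" unfolding eqC by (rule ind_contract[OF A(1) nz])
    have "insert p (insert q C) \<subseteq> cl (C \<union> insert b (insert x U))"
      using p' q' ext by (auto intro: in_clI)
    then have "z \<in> cl (C \<union> insert b (insert x U))" by (rule in_cl_trans[OF tri_cl(1)[OF z(2)]])
    then show "C \<union> insert z Z \<union> A \<subseteq> cl (C \<union> insert b (insert x U))" using sp ext by auto
    have "p \<in> cl (insert a (C \<union> insert z Z))" by (rule cl_monoD[OF p]) auto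
    then have "insert p (insert z C) \<subseteq> cl (insert a (C \<union> insert z Z))" by (auto intro: in_clI)
    then show "q \<in> cl (insert a (C \<union> insert z Z))" by (rule in_cl_trans[OF tri_cl(3)[OF z(2)]])
  qed
qed

text \<open>That \<open>f\<close> is neither a loop nor parallel to \<open>a\<close> is expressed by
  \<open>a'\<close> lying in the closure of \<open>a\<close> and \<open>f\<close>. As a closure
  membership this survives further contraction, and it gives back \<open>f \<notin> cl C\<close>
  once \<open>A\<close> is independent.\<close>

abbreviation linked :: "'a set \<Rightarrow> 'a set \<Rightarrow> 'a set \<Rightarrow> 'a set \<Rightarrow> bool" where
  "linked C F A d \<equiv> \<exists>a\<in>A. \<exists>a'\<in>A. \<exists>f\<in>F. d = {a, a'} \<and> a \<noteq> a'
    \<and> f \<in> cl (insert a (insert a' C)) \<and> a' \<in> cl (insert a (insert f C))"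

text \<open>For each pair the first three links of a path are contracted, which pulls
  \<open>p3\<close> into the closure of \<open>a\<close>. The fourth link is kept: it is the point
  \<open>f\<close> on the line of \<open>a\<close> and \<open>a'\<close>. The set \<open>U\<close>
  of used joints starts with those of \<open>A\<close> and grows by three per pair, so it has at
  most \<open>u\<close> elements whenever a path is requested.\<close>

lemma star_link_pairs:
  fixes C B P b and k u :: nat
  defines "F \<equiv> cl (C \<union> (B - {b}))" and "V \<equiv> star C B P b"
  assumes B: "ind C B" "b \<in> B"
    and e: "\<And>p. p \<in> V \<Longrightarrow> e p \<in> B \<and> tri C b (e p) p"
    and A: "A \<subseteq> V" "card A = k" "finite A" "ind C A"
    and path: "\<And>a a' U. a \<in> A \<Longrightarrow> a' \<in> A \<Longrightarrow> finite U \<Longrightarrow> card U \<le> u \<Longrightarrow>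
      fresh_path (star_adj C B b) V e U a a'"
  shows "finite G \<Longrightarrow> G \<subseteq> {d. d \<subseteq> A \<and> card d = 2} \<Longrightarrow> k + 3 * card G \<le> u + 3 \<Longrightarrow>
    \<exists>Z U. finite U \<and> card U \<le> k + 3 * card G \<and> U \<subseteq> B - {b} \<and> Z \<subseteq> F \<and> C \<union> Z \<union> A \<subseteq> cl (C \<union> insert b U)
      \<and> ind (C \<union> Z) A \<and> (\<forall>d\<in>G. linked (C \<union> Z) F A d)"
proof (induction G rule: finite_induct)
  case empty
  have "C \<union> A \<subseteq> cl (C \<union> insert b (e ` A))"
  proof
    fix x assume "x \<in> C \<union> A"
    then show "x \<in> cl (C \<union> insert b (e ` A))"
    proof
      assume "x \<in> A"
      then have "tri C b (e x) x" using e A by blast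
      then show ?thesis by (rule tri_in_cl) (use \<open>x \<in> A\<close> in auto)
    qed (auto intro: in_clI)
  qed
  moreover have "e ` A \<subseteq> B - {b}" using e A(1) tri_neq(1) by blast
  ultimately show ?case using A card_image_le[OF A(3), of e]
    by (intro exI[of _ "{}"] exI[of _ "e ` A"]) auto
next
  case (insert d G)
  then obtain Z U where U: "finite U" "card U \<le> k + 3 * card G" "U \<subseteq> B - {b}"
    and Z: "Z \<subseteq> cl (C \<union> (B - {b}))" and sp: "C \<union> Z \<union> A \<subseteq> cl (C \<union> insert b U)" and i: "ind (C \<union> Z) A"
    and G: "\<forall>d\<in>G. linked (C \<union> Z) F A d"
    unfolding F_def by auto
  obtain a a' where d: "d = {a, a'}" "a \<noteq> a'" "a \<in> A" "a' \<in> A"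
    using insert.prems by (auto simp: card_2_iff)
  have "card U \<le> u" using U insert.prems insert.hyps by simp
  from path[OF d(3,4) U(1) this] obtain p1 p2 p3 where p: "p1 \<in> V" "p2 \<in> V" "p3 \<in> V"
    and H: "star_adj C B b a p1" "star_adj C B b p1 p2" "star_adj C B b p2 p3" "star_adj C B b p3 a'"
    and new: "e p1 \<notin> U" "e p2 \<notin> insert (e p1) U" "e p3 \<notin> insert (e p2) (insert (e p1) U)" by blast
  have x: "e p1 \<in> B" "e p2 \<in> B" "e p3 \<in> B" and t: "tri C b (e p1) p1" "tri C b (e p2) p2" "tri C b (e p3) p3"
    using e p by auto
  have nb: "e p1 \<noteq> b" "e p2 \<noteq> b" "e p3 \<noteq> b" using t tri_neq(1) by fastforce+
  have a0: "a \<in> cl (insert a (C \<union> Z))" by (intro in_clI) auto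
  obtain z1 where z1: "insert z1 Z \<subseteq> cl (C \<union> (B - {b}))" "ind (C \<union> insert z1 Z) A"
    "C \<union> insert z1 Z \<union> A \<subseteq> cl (C \<union> insert b (insert (e p1) U))" "p1 \<in> cl (insert a (C \<union> insert z1 Z))"
    by (rule star_extend[OF B U(3) Z sp i d(3) a0 t(1) x(1) new(1) H(1)])
  have U1: "insert (e p1) U \<subseteq> B - {b}" using U x nb by auto
  obtain z2 where z2: "insert z2 (insert z1 Z) \<subseteq> cl (C \<union> (B - {b}))" "ind (C \<union> insert z2 (insert z1 Z)) A"
    "C \<union> insert z2 (insert z1 Z) \<union> A \<subseteq> cl (C \<union> insert b (insert (e p2) (insert (e p1) U)))"
    "p2 \<in> cl (insert a (C \<union> insert z2 (insert z1 Z)))"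
    by (rule star_extend[OF B U1 z1(1,3,2) d(3) z1(4) t(2) x(2) new(2) H(2)])
  have U2: "insert (e p2) (insert (e p1) U) \<subseteq> B - {b}" using U1 x nb by auto
  obtain z3 where z3: "insert z3 (insert z2 (insert z1 Z)) \<subseteq> cl (C \<union> (B - {b}))"
    "ind (C \<union> insert z3 (insert z2 (insert z1 Z))) A"
    "C \<union> insert z3 (insert z2 (insert z1 Z)) \<union> A \<subseteq> cl (C \<union> insert b (insert (e p3) (insert (e p2) (insert (e p1) U))))"
    "p3 \<in> cl (insert a (C \<union> insert z3 (insert z2 (insert z1 Z))))"
    by (rule star_extend[OF B U2 z2(1,3,2) d(3) z2(4) t(3) x(3) new(3) H(3)])
  have U3: "insert (e p3) (insert (e p2) (insert (e p1) U)) \<subseteq> B - {b}" using U2 x nb by auto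
  let ?Z = "insert z3 (insert z2 (insert z1 Z))" and ?U = "insert (e p3) (insert (e p2) (insert (e p1) U))"
  obtain f where f: "f \<in> F" "tri C p3 a' f" using H(4) by (auto simp: star_adj_def F_def)
  show ?case
  proof (intro exI conjI ballI)
    show "finite ?U" using U by simp
    have "card ?U \<le> card U + 3" using U by (simp add: card_insert_if)
    then show "card ?U \<le> k + 3 * card (insert d G)" using U insert.hyps by simp
    show "?U \<subseteq> B - {b}" by (rule U3)
    show "?Z \<subseteq> F" unfolding F_def by (rule z3)
    show "C \<union> ?Z \<union> A \<subseteq> cl (C \<union> insert b ?U)" by (rule z3)
    show "ind (C \<union> ?Z) A" by (rule z3)
    fix d' assume "d' \<in> insert d G"
    then show "linked (C \<union> ?Z) F A d'"
    proof
      assume "d' \<in> G"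
      then obtain v v' h where h: "v \<in> A" "v' \<in> A" "h \<in> F" "d' = {v, v'}" "v \<noteq> v'"
        "h \<in> cl (insert v (insert v' (C \<union> Z)))" "v' \<in> cl (insert v (insert h (C \<union> Z)))"
        using bspec[OF G \<open>d' \<in> G\<close>] by (elim bexE conjE)
      have 1: "h \<in> cl (insert v (insert v' (C \<union> ?Z)))" by (rule cl_monoD[OF h(6)]) auto
      have 2: "v' \<in> cl (insert v (insert h (C \<union> ?Z)))" by (rule cl_monoD[OF h(7)]) auto
      show ?thesis
        by (rule bexI[OF bexI[OF bexI[OF _ h(3)] h(2)] h(1)]) (intro conjI h(4,5) 1 2)
    next
      assume "d' = d"
      have "p3 \<in> cl (insert a (insert a' (C \<union> ?Z)))" by (rule cl_monoD[OF z3(4)]) auto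
      then have "insert p3 (insert a' C) \<subseteq> cl (insert a (insert a' (C \<union> ?Z)))" by (auto intro: in_clI)
      then have 1: "f \<in> cl (insert a (insert a' (C \<union> ?Z)))" by (rule in_cl_trans[OF tri_cl(1)[OF f(2)]])
      have "p3 \<in> cl (insert a (insert f (C \<union> ?Z)))" by (rule cl_monoD[OF z3(4)]) auto
      then have "insert p3 (insert f C) \<subseteq> cl (insert a (insert f (C \<union> ?Z)))" by (auto intro: in_clI)
      then have 2: "a' \<in> cl (insert a (insert f (C \<union> ?Z)))" by (rule in_cl_trans[OF tri_cl(3)[OF f(2)]])
      have 3: "d' = {a, a'}" using d(1) \<open>d' = d\<close> by simp
      show ?thesis
        by (rule bexI[OF bexI[OF bexI[OF _ f(1)] d(4)] d(3)]) (intro conjI 3 d(2) 1 2)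
    qed
  qed
qed

text \<open>The points of \<open>A\<close> will be the edges at one vertex of the clique, and the
  links, which avoid \<open>b\<close>, the remaining edges. The flat spanned by \<open>C\<close> and
  the joints other than \<open>b\<close> keeps the two kinds apart.\<close>

lemma star_model:
  fixes R :: real and k N :: nat
  assumes F: "frame C B P" "b \<in> B" and ne: "star C B P b \<noteq> {}" and cV: "card (star C B P b) \<le> 2 * R"
    and deg: "\<And>p. p \<in> star C B P b \<Longrightarrow> R - real (l - 1) \<le> deg_in (star_adj C B b) (star C B P b) p"
    and l2: "2 \<le> l" and R: "20 * real (l - 1) * real N \<le> R" and N: "k + 3 + 3 * (k choose 2) \<le> N"
  obtains C' A H where "card A = k" "ind C' A" "C' \<subseteq> cl H" "\<And>a. a \<in> A \<Longrightarrow> a \<notin> cl H"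
    "\<And>a a'. a \<in> A \<Longrightarrow> a' \<in> A \<Longrightarrow> a \<noteq> a' \<Longrightarrow> \<exists>f\<in>cl H. f \<in> cl (insert a (insert a' C')) \<and> f \<notin> cl C'"
proof -
  let ?V = "star C B P b" and ?H = "C \<union> (B - {b})"
  have B: "ind C B" and P: "simple C P" using F(1) by (auto simp: frame_def)
  have fV: "finite ?V" using simple_finite[OF P] by (auto simp: star_def)
  have "\<forall>p\<in>?V. \<exists>x. x \<in> B \<and> tri C b x p" by (auto simp: star_def)
  then obtain e where e: "\<And>p. p \<in> ?V \<Longrightarrow> e p \<in> B \<and> tri C b (e p) p" by metis
  have fib: "card {q\<in>?V. e q = x} \<le> l - 1" for x
  proof -
    have "{q\<in>?V. e q = x} \<subseteq> {q\<in>P. tri C b x q}" using e by (auto simp: star_def)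
    then have "card {q\<in>?V. e q = x} \<le> card {q\<in>P. tri C b x q}"
      using simple_finite[OF P] by (intro card_mono) auto
    then show ?thesis using card_third_le[OF P, of b x] by linarith
  qed
  obtain A where A: "A \<subseteq> ?V" "card A = k" "inj_on e A"
    and path: "\<And>a a' U. a \<in> A \<Longrightarrow> a' \<in> A \<Longrightarrow> finite U \<Longrightarrow> card U \<le> k + 3 * (k choose 2) \<Longrightarrow>

      fresh_path (star_adj C B b) ?V e U a a'"
    by (rule robust_paths[OF fV ne star_adj_sym fib _ deg cV R, where k = k and u = "k + 3 * (k choose 2)"])
      (use l2 N in auto)
  have fA: "finite A" using A(1) fV finite_subset by blast
  \<comment> \<open>The points of \<open>A\<close> have different joints besides \<open>b\<close>,
    so each new one leaves the span of \<open>b\<close> and the joints of the earlier ones.\<close>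
  have "ind C A'" if "A' \<subseteq> A" for A'
    using finite_subset[OF that fA] that
  proof (induction A' rule: finite_induct)
    case empty
    then show ?case by (simp add: ind_def)
  next
    case (insert a A')
    have "a \<notin> cl (C \<union> A')"
    proof
      assume a: "a \<in> cl (C \<union> A')"
      have "C \<union> A' \<subseteq> cl (C \<union> insert b (e ` A'))"
      proof
        fix x assume "x \<in> C \<union> A'"
        then show "x \<in> cl (C \<union> insert b (e ` A'))"
        proof
          assume x: "x \<in> A'"
          then have "tri C b (e x) x" using e insert.prems A(1) by blast
          then show ?thesis by (rule tri_in_cl) (use x in auto)
        qed (auto intro: in_clI)
      qed
      then have a': "a \<in> cl (C \<union> insert b (e ` A'))" using a by (rule in_cl_trans[rotated])
      have ea: "e a \<in> B" "tri C b (e a) a" using e insert.prems A(1) by auto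
      have "insert b (e ` A') \<subseteq> B" using F(2) e insert.prems A(1) by blast
      from support_subset(2)[OF B F(2) ea this a'] have "e a \<in> insert b (e ` A')" .
      then have "e a \<in> e ` A'" using tri_neq(1)[OF ea(2)] by auto
      then show False using A(3) insert.prems insert.hyps by (auto simp: inj_on_def)
    qed
    then show ?case using insert by (intro ind_insert) auto
  qed
  then have iA: "ind C A" by blast
  let ?G = "{d. d \<subseteq> A \<and> card d = 2}"
  have cG: "card ?G = k choose 2" using n_subsets[OF fA, of 2] A(2) by simp
  have fG: "finite ?G" using fA by auto
  have cG': "k + 3 * card ?G \<le> k + 3 * (k choose 2) + 3" using cG by simp
  have "\<exists>Z U. finite U \<and> card U \<le> k + 3 * card ?G \<and> U \<subseteq> B - {b} \<and> Z \<subseteq> cl ?H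
      \<and> C \<union> Z \<union> A \<subseteq> cl (C \<union> insert b U)
      \<and> ind (C \<union> Z) A \<and> (\<forall>d\<in>?G. linked (C \<union> Z) (cl ?H) A d)"
    by (rule star_link_pairs[OF B F(2) e A(1,2) fA iA path fG subset_refl cG'])
  then obtain Z where Z: "Z \<subseteq> cl ?H" "ind (C \<union> Z) A"
    and G: "\<forall>d\<in>?G. linked (C \<union> Z) (cl ?H) A d"
    by (elim exE conjE)
  show thesis
  proof (rule that[OF A(2) Z(2)])
    show "C \<union> Z \<subseteq> cl ?H" using Z(1) by (auto intro: in_clI)
    show "a \<notin> cl ?H" if "a \<in> A" for a
    proof
      assume "a \<in> cl ?H"
      moreover have "e a \<in> B" "tri C b (e a) a" using e that A(1) by auto
      ultimately have "b \<in> B - {b}" using support_subset(1)[OF B F(2)] by blast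
      then show False by blast
    qed
    fix a a' assume a: "a \<in> A" "a' \<in> A" "a \<noteq> a'"
    then have "{a, a'} \<in> ?G" by auto
    then obtain v v' f where f: "v \<in> A" "v' \<in> A" "f \<in> cl ?H" "{a, a'} = {v, v'}" "v \<noteq> v'"
      "f \<in> cl (insert v (insert v' (C \<union> Z)))" "v' \<in> cl (insert v (insert f (C \<union> Z)))"
      using bspec[OF G \<open>{a, a'} \<in> ?G\<close>] by (elim bexE conjE)
    \<comment> \<open>If \<open>f\<close> were a loop, the closure of \<open>v\<close> and
      \<open>f\<close> would be that of \<open>v\<close>, and \<open>v'\<close> would be parallel to
      \<open>v\<close>.\<close>
    have "f \<notin> cl (C \<union> Z)"
    proof
      assume f0: "f \<in> cl (C \<union> Z)"
      have "insert v (insert f (C \<union> Z)) \<subseteq> cl (insert v (C \<union> Z))"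
        using f0 cl_mono[of "C \<union> Z" "insert v (C \<union> Z)"] by (auto intro: in_clI)
      then have "v' \<in> cl (insert v (C \<union> Z))" by (rule in_cl_trans[OF f(7)])
      moreover have "pw (C \<union> Z) v v'" by (rule ind_pw[OF Z(2) f(1,2,5)])
      ultimately show False by (auto dest: pwD)
    qed
    moreover have "insert v (insert v' (C \<union> Z)) = insert a (insert a' (C \<union> Z))"
      using f(4) by (auto simp: doubleton_eq_iff)
    ultimately show "\<exists>f\<in>cl ?H. f \<in> cl (insert a (insert a' (C \<union> Z))) \<and> f \<notin> cl (C \<union> Z)"
      using f by auto
  qed
qed

end

section \<open>Representing the complete graph\<close>

definition path_edges :: "'v list \<Rightarrow> 'v set set" where
  "path_edges vs = {{vs ! i, vs ! Suc i} | i. Suc i < length vs}"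

lemma path_edges_Cons: "vs \<noteq> [] \<Longrightarrow> path_edges (x # vs) = insert {x, hd vs} (path_edges vs)"
proof -
  assume ne: "vs \<noteq> []"
  show ?thesis
  proof (intro equalityI subsetI)
    fix e assume "e \<in> path_edges (x # vs)"
    then obtain i where i: "e = {(x # vs) ! i, (x # vs) ! Suc i}" "Suc i < length (x # vs)"
      by (auto simp: path_edges_def)
    show "e \<in> insert {x, hd vs} (path_edges vs)"
    proof (cases i)
      case 0
      then show ?thesis using i ne by (simp add: hd_conv_nth)
    next
      case (Suc j)
      then show ?thesis using i by (auto simp: path_edges_def)
    qed
  next
    fix e assume "e \<in> insert {x, hd vs} (path_edges vs)"
    then consider "e = {x, hd vs}" | i where "e = {vs ! i, vs ! Suc i}" "Suc i < length vs"
      by (auto simp: path_edges_def)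
    then show "e \<in> path_edges (x # vs)"
    proof cases
      case 1
      then have "e = {(x # vs) ! 0, (x # vs) ! Suc 0}" "Suc 0 < length (x # vs)" using ne by (auto simp: hd_conv_nth)
      then show ?thesis unfolding path_edges_def by blast
    next
      case (2 i)
      then have "e = {(x # vs) ! Suc i, (x # vs) ! Suc (Suc i)}" "Suc (Suc i) < length (x # vs)" by auto
      then show ?thesis unfolding path_edges_def by blast
    qed
  qed
qed

lemma path_edges_take: "path_edges (take n vs) \<subseteq> path_edges vs"
proof
  fix e assume "e \<in> path_edges (take n vs)"
  then obtain i where i: "e = {take n vs ! i, take n vs ! Suc i}" "Suc i < length (take n vs)"
    unfolding path_edges_def by blast
  then have "e = {vs ! i, vs ! Suc i}" "Suc i < length vs" by auto
  then show "e \<in> path_edges vs" unfolding path_edges_def by blast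
qed

text \<open>Cutting the cycle at its closing edge replaces the index modulo the length by a list of
  path edges, which suits induction on the list.\<close>

lemma cycle_edge_set_iff:
  "cycle_edge_set X \<longleftrightarrow> (\<exists>vs. distinct vs \<and> 3 \<le> length vs \<and> X = insert {last vs, hd vs} (path_edges vs))"
proof -
  have *: "{{vs ! i, vs ! ((i + 1) mod length vs)} | i. i < length vs} = insert {last vs, hd vs} (path_edges vs)"
    if "3 \<le> length vs" for vs :: "'a list"
  proof (intro equalityI subsetI)
    fix e assume "e \<in> {{vs ! i, vs ! ((i + 1) mod length vs)} | i. i < length vs}"
    then obtain i where i: "e = {vs ! i, vs ! ((i + 1) mod length vs)}" "i < length vs" by blast
    show "e \<in> insert {last vs, hd vs} (path_edges vs)"
    proof (cases "Suc i < length vs")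
      case True
      then show ?thesis using i by (auto simp: path_edges_def)
    next
      case False
      then have "Suc i = length vs" using i by simp
      moreover have "vs \<noteq> []" using that by auto
      ultimately have "vs ! i = last vs" "vs ! ((i + 1) mod length vs) = hd vs"
        by (metis last_conv_nth diff_Suc_1, simp add: hd_conv_nth)
      then show ?thesis using i(1) by simp
    qed
  next
    fix e assume "e \<in> insert {last vs, hd vs} (path_edges vs)"
    then consider "e = {last vs, hd vs}" | i where "e = {vs ! i, vs ! Suc i}" "Suc i < length vs"
      by (auto simp: path_edges_def)
    then show "e \<in> {{vs ! i, vs ! ((i + 1) mod length vs)} | i. i < length vs}"
    proof cases
      case 1
      have "vs \<noteq> []" using that by auto
      then have "e = {vs ! (length vs - 1), vs ! ((length vs - 1 + 1) mod length vs)}"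
        using 1 by (simp add: last_conv_nth hd_conv_nth)
      moreover have "length vs - 1 < length vs" using that by simp
      ultimately show ?thesis by blast
    next
      case (2 i)
      then have "e = {vs ! i, vs ! ((i + 1) mod length vs)}" "i < length vs" by auto
      then show ?thesis by blast
    qed
  qed
  show ?thesis unfolding cycle_edge_set_def by (intro ex_cong1 conj_cong refl) (simp only: *)
qed

text \<open>The first vertex of a longest path is a leaf: another edge at it would either extend the
  path or close a cycle with an initial segment.\<close>

lemma exists_leaf:
  assumes fin: "finite X" and X2: "\<And>e. e \<in> X \<Longrightarrow> card e = 2" and ne: "X \<noteq> {}"
    and acyc: "\<not> (\<exists>Y\<subseteq>X. cycle_edge_set Y)"
  obtains v e where "e \<in> X" "v \<in> e" "\<And>e'. e' \<in> X \<Longrightarrow> v \<in> e' \<Longrightarrow> e' = e"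
proof (rule ccontr)
  assume n: "\<not> thesis"
  have two: "\<exists>e'\<in>X. v \<in> e' \<and> e' \<noteq> e" if "e \<in> X" "v \<in> e" for v e
    using n that \<open>\<And>e v. e \<in> X \<Longrightarrow> v \<in> e \<Longrightarrow> (\<And>e'. e' \<in> X \<Longrightarrow> v \<in> e' \<Longrightarrow> e' = e) \<Longrightarrow> thesis\<close> by metis
  have fV: "finite (\<Union>X)" using X2 by (intro finite_Union[OF fin] card_ge_0_finite) simp
  let ?Q = "\<lambda>vs. distinct vs \<and> 2 \<le> length vs \<and> path_edges vs \<subseteq> X"
  have Qset: "set vs \<subseteq> \<Union>X" if "?Q vs" for vs
  proof
    fix x assume "x \<in> set vs"
    then obtain i where i: "i < length vs" "x = vs ! i" by (auto simp: in_set_conv_nth)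
    show "x \<in> \<Union>X"
    proof (cases "Suc i < length vs")
      case True
      then have "{vs ! i, vs ! Suc i} \<in> path_edges vs" unfolding path_edges_def by blast
      then show ?thesis using that i by auto
    next
      case False
      then have "Suc (i - 1) < length vs" "Suc (i - 1) = i" using i that by auto
      then have "{vs ! (i - 1), vs ! i} \<in> path_edges vs" unfolding path_edges_def by fastforce
      then show ?thesis using that i by auto
    qed
  qed
  have bound: "length vs \<le> card (\<Union>X)" if "?Q vs" for vs
  proof -
    have "length vs = card (set vs)" using that by (simp add: distinct_card)
    also have "\<dots> \<le> card (\<Union>X)" by (rule card_mono[OF fV Qset[OF that]])
    finally show ?thesis .
  qed
  obtain e where e: "e \<in> X" using ne by blast
  then obtain a b where ab: "e = {a, b}" "a \<noteq> b" using X2[OF e] unfolding card_2_iff by blast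
  have "path_edges [a, b] = {e}" using ab by (auto simp: path_edges_def)
  then have Q0: "?Q [a, b]" using ab e by auto
  have "\<forall>ws. ?Q ws \<longrightarrow> length ws < Suc (card (\<Union>X))" using bound by (simp add: less_Suc_eq_le)
  from ex_has_greatest_nat[of ?Q, OF Q0 this]
  obtain vs where vs: "?Q vs" and max: "\<And>ws. ?Q ws \<Longrightarrow> length ws \<le> length vs" by blast
  then obtain v w ws where v: "vs = v # w # ws" by (cases vs; cases "tl vs") auto
  have "path_edges vs = insert {v, w} (path_edges (w # ws))" unfolding v by (simp add: path_edges_Cons)
  then have "{v, w} \<in> X" using vs by auto
  then obtain e' where e': "e' \<in> X" "v \<in> e'" "e' \<noteq> {v, w}" using two by blast
  then obtain x where x: "e' = {v, x}" "x \<noteq> v" "x \<noteq> w" using X2[OF e'(1)] by (auto simp: card_2_iff)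
  show False
  proof (cases "x \<in> set vs")
    case False
    have "path_edges (x # vs) = insert {x, v} (path_edges vs)" using v by (simp add: path_edges_Cons)
    then have "?Q (x # vs)" using False vs e' x by (auto simp: insert_commute)
    then show False using max by fastforce
  next
    case True
    then obtain j where j: "j < length vs" "x = vs ! j" by (auto simp: in_set_conv_nth)
    have "j \<noteq> 0" using j x v by (intro notI) auto
    moreover have "j \<noteq> 1" using j x v by (intro notI) auto
    ultimately have j2: "2 \<le> j" by simp
    let ?c = "take (Suc j) vs"
    have len: "length ?c = Suc j" using j by simp
    have "last ?c = x" using j len by (subst last_conv_nth) auto
    moreover have "hd ?c = v" using v by simp
    moreover have "path_edges ?c \<subseteq> X" using path_edges_take[of "Suc j" vs] vs by blast
    ultimately have "insert {last ?c, hd ?c} (path_edges ?c) \<subseteq> X" using e' x by (auto simp: insert_commute)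
    moreover have "cycle_edge_set (insert {last ?c, hd ?c} (path_edges ?c))"
      unfolding cycle_edge_set_iff using vs len j2 by (intro exI[of _ ?c]) (auto simp: distinct_take)
    ultimately show False using acyc by blast
  qed
qed

context rank_function
begin

text \<open>A basis \<open>A\<close> together with points \<open>f\<close> on all its lines that lie in a common flat missing \<open>A\<close> is a copy
  of \<open>M(K\<^sub>k\<^sub>+\<^sub>1)\<close>, the elements of \<open>A\<close> being the edges at the vertex \<open>0\<close>.\<close>

lemma clique_representation:
  assumes A: "card A = k" "ind C A" and H: "C \<subseteq> cl H" "\<And>a. a \<in> A \<Longrightarrow> a \<notin> cl H"
    and f: "\<And>a a'. a \<in> A \<Longrightarrow> a' \<in> A \<Longrightarrow> a \<noteq> a' \<Longrightarrow>
      \<exists>f\<in>cl H. f \<in> cl (insert a (insert a' C)) \<and> f \<notin> cl C"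
  obtains g where "inj_on g (complete_graph_edges (Suc k))"
    "\<And>X. X \<subseteq> complete_graph_edges (Suc k) \<Longrightarrow> ind C (g ` X) \<longleftrightarrow> \<not> (\<exists>Y\<subseteq>X. cycle_edge_set Y)"
    "\<And>e. e \<in> complete_graph_edges (Suc k) \<Longrightarrow> g e \<notin> cl C"
proof -
  let ?K = "complete_graph_edges (Suc k)"
  have fA: "finite A" by (rule ind_finite[OF A(2)])
  obtain h where h: "bij_betw h {1..k} A"
    using ex_bij_betw_nat_finite_1[OF fA] A(1) by blast
  have hA: "h i \<in> A" if "0 < i" "i \<le> k" for i using h that by (auto simp: bij_betw_def)
  have hinj: "h i \<noteq> h j" if "0 < i" "i \<le> k" "0 < j" "j \<le> k" "i \<noteq> j" for i j
    using inj_on_eq_iff[OF bij_betw_imp_inj_on[OF h], of i j] that by simp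
  \<comment> \<open>The choice is indexed by the set \<open>{i, j}\<close>, so that the point does
    not depend on the order of its ends.\<close>
  have "\<exists>F. \<forall>i j. 0 < i \<longrightarrow> i \<le> k \<longrightarrow> 0 < j \<longrightarrow> j \<le> k \<longrightarrow> i \<noteq> j \<longrightarrow>
    F {i, j} \<in> cl H \<and> F {i, j} \<in> cl (insert (h i) (insert (h j) C)) \<and> F {i, j} \<notin> cl C"
  proof -
    have "\<forall>d. \<exists>p. \<forall>i j. d = {i, j} \<longrightarrow> 0 < i \<longrightarrow> i \<le> k \<longrightarrow> 0 < j \<longrightarrow> j \<le> k \<longrightarrow> i \<noteq> j \<longrightarrow>
      p \<in> cl H \<and> p \<in> cl (insert (h i) (insert (h j) C)) \<and> p \<notin> cl C"
    proof
      fix d :: "nat set"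
      show "\<exists>p. \<forall>i j. d = {i, j} \<longrightarrow> 0 < i \<longrightarrow> i \<le> k \<longrightarrow> 0 < j \<longrightarrow> j \<le> k \<longrightarrow> i \<noteq> j \<longrightarrow>
        p \<in> cl H \<and> p \<in> cl (insert (h i) (insert (h j) C)) \<and> p \<notin> cl C"
      proof (cases "\<exists>i j. d = {i, j} \<and> 0 < i \<and> i \<le> k \<and> 0 < j \<and> j \<le> k \<and> i \<noteq> j")
        case True
        then obtain i j where ij: "d = {i, j}" "0 < i" "i \<le> k" "0 < j" "j \<le> k" "i \<noteq> j" by blast
        obtain p where p: "p \<in> cl H" "p \<in> cl (insert (h i) (insert (h j) C))" "p \<notin> cl C"
          using f[OF hA[OF ij(2,3)] hA[OF ij(4,5)] hinj[OF ij(2-6)]] by blast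
        have "insert (h j) (insert (h i) C) = insert (h i) (insert (h j) C)" by (rule insert_commute)
        then show ?thesis using p ij(1) by (intro exI[of _ p]) (auto simp: doubleton_eq_iff)
      qed blast
    qed
    then obtain F where "\<forall>d i j. d = {i, j} \<longrightarrow> 0 < i \<longrightarrow> i \<le> k \<longrightarrow> 0 < j \<longrightarrow> j \<le> k \<longrightarrow> i \<noteq> j \<longrightarrow>
      F d \<in> cl H \<and> F d \<in> cl (insert (h i) (insert (h j) C)) \<and> F d \<notin> cl C" by (auto dest!: choice)
    then show ?thesis by (intro exI[of _ F]) auto
  qed
  then obtain F where F: "\<And>i j. 0 < i \<Longrightarrow> i \<le> k \<Longrightarrow> 0 < j \<Longrightarrow> j \<le> k \<Longrightarrow> i \<noteq> j \<Longrightarrow>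
    F {i, j} \<in> cl H \<and> F {i, j} \<in> cl (insert (h i) (insert (h j) C)) \<and> F {i, j} \<notin> cl C" by blast
  define g where "g = (\<lambda>e. if 0 \<in> e then h (the_elem (e - {0})) else F e)"
  have g0: "g {0, i} = h i" "g {i, 0} = h i" if "0 < i" for i
  proof -
    have "{0, i} - {0} = {i}" "{i, 0} - {0} = {i}" using that by auto
    then show "g {0, i} = h i" "g {i, 0} = h i" by (simp_all add: g_def)
  qed
  have g1: "g {i, j} = F {i, j}" if "0 < i" "0 < j" for i j using that by (simp add: g_def)
  have Fh: "F {i, j} \<notin> cl (insert (h i) C)" if ij: "0 < i" "i \<le> k" "0 < j" "j \<le> k" "i \<noteq> j" for i j
  proof
    assume "F {i, j} \<in> cl (insert (h i) C)"
    then have "h i \<in> cl (insert (F {i, j}) C)" by (rule cl_exchange) (use F[OF ij] in blast)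
    then have "h i \<in> cl H" by (rule in_cl_trans) (use F[OF ij] H(1) in auto)
    then show False using H(2) hA[OF ij(1,2)] by blast
  qed
  have tri0: "h j \<in> cl (insert (F {i, j}) (insert (h i) C))"
    if ij: "0 < i" "i \<le> k" "0 < j" "j \<le> k" "i \<noteq> j" for i j
  proof (rule cl_exchange[OF _ Fh[OF ij]])
    show "F {i, j} \<in> cl (insert (h j) (insert (h i) C))" using F[OF ij] by (simp add: insert_commute)
  qed
  \<comment> \<open>The three points lie in \<open>cl H\<close> and in the span of
    \<open>h u\<close>, \<open>h v\<close>, \<open>h w\<close>, which has rank 3 over
    \<open>C\<close>. If they were independent, adding \<open>h u\<close>, which is outside
    \<open>cl H\<close>, would give rank 4 inside that span.\<close>
  have triF: "F {u, w} \<in> cl (insert (F {u, v}) (insert (F {v, w}) C))"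
    if uvw: "0 < u" "u \<le> k" "0 < v" "v \<le> k" "0 < w" "w \<le> k" "u \<noteq> v" "v \<noteq> w" "u \<noteq> w" for u v w
  proof (rule ccontr)
    let ?Y = "insert (F {u, v}) (insert (F {v, w}) C)"
    assume n: "F {u, w} \<notin> cl ?Y"
    have Fs: "F {u, v} \<in> cl H" "F {v, w} \<in> cl H" "F {u, w} \<in> cl H"
      "F {v, w} \<notin> cl C" "F {u, v} \<in> cl (insert (h u) (insert (h v) C))"
      "F {v, w} \<in> cl (insert (h v) (insert (h w) C))" "F {u, w} \<in> cl (insert (h u) (insert (h w) C))"
      using F uvw by auto
    let ?D = "C \<union> {h u, h v, h w}"
    have "F {u, v} \<notin> cl (insert (F {v, w}) C)"
    proof
      assume a: "F {u, v} \<in> cl (insert (F {v, w}) C)"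
      have "insert (F {v, w}) C \<subseteq> cl (C \<union> {h v, h w})"
        using Fs(6) by (auto intro: in_clI)
      then have "F {u, v} \<in> cl (C \<union> {h v, h w})" by (rule in_cl_trans[OF a])
      moreover have "F {u, v} \<in> cl (C \<union> {h u, h v})" using Fs(5) by simp
      ultimately have "F {u, v} \<in> cl (C \<union> ({h v, h w} \<inter> {h u, h v}))"
        using uvw hA by (intro cl_Int_ind[OF A(2)]) auto
      moreover have "{h v, h w} \<inter> {h u, h v} = {h v}" using hinj uvw by auto
      ultimately have "F {v, u} \<in> cl (insert (h v) C)" by (simp add: insert_commute)
      then show False using Fh[of v u] uvw by simp
    qed
    then have "r ?Y = r C + 2" using Fs(4) by (simp add: r_insert_notin)
    then have "r (insert (F {u, w}) ?Y) = r C + 3" using n by (simp add: r_insert_notin)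
    moreover have "h u \<notin> cl (insert (F {u, w}) ?Y)"
    proof
      assume "h u \<in> cl (insert (F {u, w}) ?Y)"
      then have "h u \<in> cl H" by (rule in_cl_trans) (use Fs H(1) in auto)
      then show False using H(2) hA uvw by blast
    qed
    ultimately have "r (insert (h u) (insert (F {u, w}) ?Y)) = r C + 4" by (simp add: r_insert_notin)
    moreover have "r (insert (h u) (insert (F {u, w}) ?Y)) \<le> r ?D"
    proof (rule r_le_of_subset_cl)
      have "F {u, v} \<in> cl ?D" by (rule cl_monoD[OF Fs(5)]) auto
      moreover have "F {v, w} \<in> cl ?D" by (rule cl_monoD[OF Fs(6)]) auto
      moreover have "F {u, w} \<in> cl ?D" by (rule cl_monoD[OF Fs(7)]) auto
      ultimately show "insert (h u) (insert (F {u, w}) ?Y) \<subseteq> cl ?D" by (auto intro: in_clI)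
    qed
    moreover have "r ?D \<le> r C + card {h u, h v, h w}" by (rule r_union_le_card) simp
    moreover have "card {h u, h v, h w} \<le> 3" by (simp add: card_insert_if)
    ultimately show False by simp
  qed
  have tri_g: "g {u, w} \<in> cl (insert (g {u, v}) (insert (g {v, w}) C))"
    if uvw: "u \<le> k" "v \<le> k" "w \<le> k" "u \<noteq> v" "v \<noteq> w" "u \<noteq> w" for u v w
  proof -
    consider "u = 0" | "v = 0" | "w = 0" | "0 < u" "0 < v" "0 < w" by blast
    then show ?thesis
    proof cases
      case 1
      then have "h w \<in> cl (insert (h v) (insert (F {v, w}) C))"
        using tri0[of v w] uvw by (simp add: insert_commute[of "h v"])
      then show ?thesis using 1 uvw g0(1)[of w] g0(1)[of v] g1[of v w] by simp
    next
      case 2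
      then show ?thesis using F[of u w] uvw g0(2)[of u] g0(1)[of w] g1[of u w] by simp
    next
      case 3
      then have "h u \<in> cl (insert (F {u, v}) (insert (h v) C))"
        using tri0[of v u] uvw by (simp add: insert_commute[of u v])
      then show ?thesis using 3 uvw g0(2)[of u] g0(2)[of v] g1[of u v] by simp
    next
      case 4
      then show ?thesis using triF[of u v w] uvw g1 by simp
    qed
  qed
  \<comment> \<open>Repeated use of the triangle relation: the edge joining the ends of a path is
    spanned by the path, so cycles are dependent.\<close>
  have path: "g {hd vs, last vs} \<in> cl (C \<union> g ` path_edges vs)"
    if "distinct vs" "2 \<le> length vs" "set vs \<subseteq> {..k}" for vs
    using that
  proof (induction vs)
    case (Cons v vs)
    then have vs: "vs \<noteq> []" by auto
    show ?case
    proof (cases "tl vs = []")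
      case True
      then obtain w where "vs = [w]" using vs by (cases vs) auto
      then show ?thesis by (auto simp: path_edges_Cons path_edges_def intro: in_clI)
    next
      case False
      then have len: "2 \<le> length vs" using vs by (cases vs; cases "tl vs") auto
      have ends: "hd vs \<in> set vs" "last vs \<in> set vs" "hd vs \<noteq> last vs"
        using vs False Cons.prems(1) by (cases vs; auto)+
      have IH: "g {hd vs, last vs} \<in> cl (C \<union> g ` path_edges vs)"
        using Cons.prems len by (intro Cons.IH) auto
      have "g {v, last vs} \<in> cl (insert (g {v, hd vs}) (insert (g {hd vs, last vs}) C))"
        using Cons.prems ends by (intro tri_g) auto
      moreover have "insert (g {v, hd vs}) (insert (g {hd vs, last vs}) C) \<subseteq> cl (C \<union> g ` path_edges (v # vs))"
      proof -
        have "g {hd vs, last vs} \<in> cl (C \<union> g ` path_edges (v # vs))"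
          by (rule cl_monoD[OF IH]) (auto simp: path_edges_Cons[OF vs])
        then show ?thesis by (auto simp: path_edges_Cons[OF vs] intro: in_clI)
      qed
      ultimately have "g {v, last vs} \<in> cl (C \<union> g ` path_edges (v # vs))" by (rule in_cl_trans)
      then show ?thesis using vs by simp
    qed
  qed simp
  \<comment> \<open>The closure of \<open>W v\<close> contains the images of the edges avoiding
    \<open>v\<close> and none of those at \<open>v\<close>; it plays the part of the flat of
    \<open>K_k\<close> on the other vertices. For \<open>v = 0\<close> this is the given
    \<open>H\<close>. Both injectivity and the independence of forests follow from it.\<close>
  define W where "W = (\<lambda>v. if v = 0 then H else C \<union> (A - {h v}))"
  have edge: "\<exists>i j. e = {i, j} \<and> i \<noteq> j \<and> i \<le> k \<and> j \<le> k \<and> i \<in> e" if "e \<in> ?K" for e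
  proof -
    have "e \<subseteq> {..<Suc k}" "card e = 2" using that by (auto simp: complete_graph_edges_def)
    moreover from this(2) obtain i j where "e = {i, j}" "i \<noteq> j" unfolding card_2_iff by blast
    ultimately show ?thesis by (intro exI[of _ i] exI[of _ j]) auto
  qed
  have W_out: "g e \<in> cl (W v)" if e: "e \<in> ?K" "v \<notin> e" "v \<le> k" for e v
  proof -
    obtain i j where ij: "e = {i, j}" "i \<noteq> j" "i \<le> k" "j \<le> k" using edge[OF e(1)] by blast
    show ?thesis
    proof (cases "v = 0")
      case True
      then show ?thesis using ij e F[of i j] g1[of i j] by (simp add: W_def)
    next
      case v: False
      have hv: "h x \<in> cl (W v)" if "0 < x" "x \<le> k" "x \<noteq> v" for x
        using that v hA hinj[of x v] e(3) by (intro in_clI) (auto simp: W_def)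
      consider "i = 0" | "j = 0" | "0 < i" "0 < j" by blast
      then show ?thesis
      proof cases
        case 1
        then show ?thesis using hv[of j] g0 ij e by auto
      next
        case 2
        then show ?thesis using hv[of i] g0 ij e by auto
      next
        case 3
        have "F {i, j} \<in> cl (insert (h i) (insert (h j) C))" using F[of i j] 3 ij by simp
        moreover have "C \<subseteq> cl (W v)" using v by (auto simp: W_def intro: in_clI)
        moreover have "h i \<in> cl (W v)" "h j \<in> cl (W v)" using hv[of i] hv[of j] 3 ij e by auto
        ultimately have "F {i, j} \<in> cl (W v)" using in_cl_trans by (metis insert_subset)
        then show ?thesis using g1 3 ij by simp
      qed
    qed
  qed
  have W_in: "g e \<notin> cl (W v)" if e: "e \<in> ?K" "v \<in> e" for e v
  proof -
    obtain i j where ij: "e = {i, j}" "i \<noteq> j" "i \<le> k" "j \<le> k" using edge[OF e(1)] by blast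
    obtain w where w: "e = {v, w}" "w \<noteq> v" "w \<le> k" "v \<le> k" using ij e(2) by auto
    show ?thesis
    proof (cases "v = 0")
      case True
      then show ?thesis using w H(2) hA[of w] g0(1)[of w] by (simp add: W_def)
    next
      case v: False
      have nv: "h v \<notin> cl (W v)"
        using ind_notin_cl[OF A(2), of "A - {h v}" "h v"] hA[of v] v w by (simp add: W_def)
      show ?thesis
      proof (cases "w = 0")
        case True
        then show ?thesis using nv g0(2)[of v] v w by simp
      next
        case w0: False
        have hw: "h w \<in> cl (W v)" using hA[of w] hinj[of w v] w w0 v by (intro in_clI) (auto simp: W_def)
        have "h v \<in> cl (insert (F {w, v}) (insert (h w) C))" using tri0[of w v] w w0 v by simp
        moreover have "C \<subseteq> cl (W v)" using v by (auto simp: W_def intro: in_clI)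
        ultimately have "F {w, v} \<notin> cl (W v)"
          using nv hw in_cl_trans by (metis insert_subset)
        moreover have "e = {w, v}" using w(1) by auto
        ultimately show ?thesis using g1[of w v] w0 v by simp
      qed
    qed
  qed
  have CW: "C \<subseteq> cl (W v)" for v using H(1) by (auto simp: W_def intro: in_clI)
  have inj: "inj_on g ?K"
  proof (rule inj_onI)
    fix e e' assume e: "e \<in> ?K" "e' \<in> ?K" "g e = g e'"
    have fe: "finite e" "finite e'" "card e = card e'"
      using e by (auto simp: complete_graph_edges_def intro: card_ge_0_finite)
    have "e \<subseteq> e'"
    proof
      fix v assume v: "v \<in> e"
      then have "v \<le> k" using e(1) by (auto simp: complete_graph_edges_def)
      then show "v \<in> e'" using W_in[OF e(1) v] W_out[OF e(2)] e(3) by auto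
    qed
    then show "e = e'" using fe by (simp add: card_subset_eq)
  qed
  have dep: "\<not> ind C (g ` X)" if X: "X \<subseteq> ?K" and Y: "Y \<subseteq> X" "cycle_edge_set Y" for X Y
  proof
    assume i: "ind C (g ` X)"
    obtain vs where vs: "distinct vs" "3 \<le> length vs" "Y = insert {last vs, hd vs} (path_edges vs)"
      using Y(2) by (auto simp: cycle_edge_set_iff)
    have set: "set vs \<subseteq> {..k}"
    proof
      fix x assume "x \<in> set vs"
      then obtain i where i: "i < length vs" "x = vs ! i" by (auto simp: in_set_conv_nth)
      have "\<exists>e\<in>Y. x \<in> e"
      proof (cases "Suc i < length vs")
        case True
        then have "{vs ! i, vs ! Suc i} \<in> path_edges vs" unfolding path_edges_def by blast
        then show ?thesis using vs(3) i by auto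
      next
        case False
        then have "i = length vs - 1" "vs \<noteq> []" using i vs(2) by auto
        then have "x = last vs" using i by (simp add: last_conv_nth)
        then show ?thesis using vs(3) by auto
      qed
      then show "x \<in> {..k}" using X Y(1) by (force simp: complete_graph_edges_def less_Suc_eq_le)
    qed
    let ?e = "{hd vs, last vs}"
    have eX: "?e \<in> X" using Y(1) vs(3) by (auto simp: insert_commute)
    \<comment> \<open>This uses length at least 3. With injectivity of \<open>g\<close>, the closing
      edge is an element of the independent set different from those that span it.\<close>
    have "?e \<notin> path_edges vs"
    proof
      assume "?e \<in> path_edges vs"
      then obtain i where i: "?e = {vs ! i, vs ! Suc i}" "Suc i < length vs" by (auto simp: path_edges_def)
      have ne: "vs \<noteq> []" using vs(2) by auto
      have "{vs ! 0, vs ! (length vs - 1)} = {vs ! i, vs ! Suc i}"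
        using i(1) ne by (simp add: hd_conv_nth last_conv_nth)
      then have "vs ! i = vs ! 0 \<and> vs ! Suc i = vs ! (length vs - 1) \<or> vs ! Suc i = vs ! 0"
        by (auto simp: doubleton_eq_iff)
      moreover have "0 < length vs" "length vs - 1 < length vs" "i < length vs" using i vs(2) by auto
      ultimately have "i = 0 \<and> Suc i = length vs - 1 \<or> Suc i = 0"
        using nth_eq_iff_index_eq[OF vs(1)] i(2) by blast
      then show False using vs(2) by auto
    qed
    moreover have "path_edges vs \<subseteq> X" using Y(1) vs(3) by blast
    ultimately have "g d \<in> g ` X - {g ?e}" if "d \<in> path_edges vs" for d
      using that inj_on_eq_iff[OF inj, of d ?e] X eX by auto
    then have "g ` path_edges vs \<subseteq> g ` X - {g ?e}" by (rule image_subsetI)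
    then have sub: "C \<union> g ` path_edges vs \<subseteq> C \<union> (g ` X - {g ?e})" by (rule Un_mono[OF subset_refl])
    have "g ?e \<in> cl (C \<union> g ` path_edges vs)" using path[OF vs(1) _ set] vs(2) by simp
    then have "g ?e \<in> cl (C \<union> (g ` X - {g ?e}))" by (rule cl_monoD[OF _ sub])
    moreover have "g ?e \<notin> cl (C \<union> (g ` X - {g ?e}))"
      by (rule ind_notin_cl[OF i]) (use eX in auto)
    ultimately show False by blast
  qed
  have finK: "finite ?K" by (rule finite_subset[of _ "Pow {..<Suc k}"]) (auto simp: complete_graph_edges_def)
  have indep: "ind C (g ` X)" if "X \<subseteq> ?K" "\<not> (\<exists>Y\<subseteq>X. cycle_edge_set Y)" for X
    using that
  proof (induction "card X" arbitrary: X)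
    case 0
    then have "X = {}" using finite_subset[OF 0(2) finK] by simp
    then show ?case by (simp add: ind_def)
  next
    case (Suc n)
    have fX: "finite X" by (rule finite_subset[OF Suc.prems(1) finK])
    have "X \<noteq> {}" using Suc.hyps(2) by auto
    have c2: "card e = 2" if "e \<in> X" for e using that Suc.prems(1) by (auto simp: complete_graph_edges_def)
    obtain v e where v: "e \<in> X" "v \<in> e" "\<And>e'. e' \<in> X \<Longrightarrow> v \<in> e' \<Longrightarrow> e' = e"
      by (rule exists_leaf[OF fX c2 \<open>X \<noteq> {}\<close> Suc.prems(2)]) (assumption, rule that)
    let ?X = "X - {e}"
    have "n = card ?X" using Suc.hyps(2) v(1) by simp
    then have i: "ind C (g ` ?X)" using Suc.prems by (intro Suc.hyps(1)) blast+
    have "e \<subseteq> {..<Suc k}" using v(1) Suc.prems(1) unfolding complete_graph_edges_def by blast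
    then have vk: "v \<le> k" using v(2) by auto
    \<comment> \<open>Only the leaf edge meets \<open>v\<close>, so the images of all other edges
      are in the closure of \<open>W v\<close> and that of the leaf edge is not.\<close>
    have "g d \<in> cl (W v)" if "d \<in> ?X" for d
      by (rule W_out[OF _ _ vk]) (use that v(3)[of d] Suc.prems(1) in auto)
    then have "g ` ?X \<subseteq> cl (W v)" by (rule image_subsetI)
    then have "C \<union> g ` ?X \<subseteq> cl (W v)" by (rule Un_least[OF CW])
    moreover have "e \<in> ?K" using v(1) Suc.prems(1) by blast
    ultimately have "g e \<notin> cl (C \<union> g ` ?X)" using W_in[OF _ v(2)] in_cl_trans by metis
    then have "ind C (insert (g e) (g ` ?X))" by (rule ind_insert[OF i])
    moreover have "insert (g e) (g ` ?X) = g ` X" using v(1) by blast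
    ultimately show ?case by simp
  qed
  show thesis
  proof (rule that[OF inj])
    show "ind C (g ` X) \<longleftrightarrow> \<not> (\<exists>Y\<subseteq>X. cycle_edge_set Y)" if "X \<subseteq> ?K" for X
    proof
      show "ind C (g ` X) \<Longrightarrow> \<not> (\<exists>Y\<subseteq>X. cycle_edge_set Y)" using dep[OF that] by blast
    qed (rule indep[OF that])
    fix e assume e: "e \<in> ?K"
    obtain v where "v \<in> e" using edge[OF e] by blast
    then have "g e \<notin> cl (W v)" by (rule W_in[OF e])
    then show "g e \<notin> cl C" using cl_subset_clI[OF CW[of v]] by blast
  qed
qed

end

section \<open>Minors of matroids\<close>

context finite_matroid
begin

lemma finite_indeps: "finite (indeps M)"
  by (rule finite_subset[of _ "Pow (ground M)"]) (use indeps_subset finite_ground in auto)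

lemma indep_finite: "I \<in> indeps M \<Longrightarrow> finite I"
  using indeps_subset finite_ground finite_subset by blast

lemma rank_ge: "I \<in> indeps M \<Longrightarrow> I \<subseteq> X \<Longrightarrow> card I \<le> rank_of M X"
  unfolding rank_of_def using finite_indeps by (intro Max_ge) auto

lemma rank_obtain: obtains I where "I \<in> indeps M" "I \<subseteq> X" "card I = rank_of M X"
proof -
  have "rank_of M X \<in> card ` {I \<in> indeps M. I \<subseteq> X}"
    unfolding rank_of_def using finite_indeps empty_indep by (intro Max_in) auto
  then show thesis using that by auto
qed

lemma extend_indep:
  assumes "I \<in> indeps M" "I \<subseteq> X"
  obtains J where "J \<in> indeps M" "I \<subseteq> J" "J \<subseteq> X" "card J = rank_of M X"
proof -
  have "\<exists>J. J \<in> indeps M \<and> I \<subseteq> J \<and> J \<subseteq> X \<and> card J = rank_of M X"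
    using assms
  proof (induction "rank_of M X - card I" arbitrary: I)
    case 0
    then have "card I = rank_of M X" using rank_ge[of I X] by simp
    then show ?case using 0 by blast
  next
    case (Suc n)
    obtain K where K: "K \<in> indeps M" "K \<subseteq> X" "card K = rank_of M X" by (rule rank_obtain)
    have "card I < card K" using Suc.hyps(2) K(3) by simp
    then obtain y where y: "y \<in> K - I" "insert y I \<in> indeps M"
      using augmentation[OF Suc.prems(1) K(1)] by blast
    have "card (insert y I) = Suc (card I)" using y indep_finite[OF Suc.prems(1)] by simp
    then have "n = rank_of M X - card (insert y I)" using Suc.hyps(2) by simp
    then have "\<exists>J. J \<in> indeps M \<and> insert y I \<subseteq> J \<and> J \<subseteq> X \<and> card J = rank_of M X"
      by (rule Suc.hyps(1)) (use y K Suc.prems in auto)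
    then show ?case by blast
  qed
  then show thesis using that by blast
qed

lemma rank_function: "rank_function (ground M) (rank_of M)"
proof
  show "finite (ground M)" by (rule finite_ground)
  obtain I where "I \<in> indeps M" "I \<subseteq> {}" "card I = rank_of M {}" by (rule rank_obtain)
  then show "rank_of M {} = 0" by auto
next
  fix x X
  obtain I where I: "I \<in> indeps M" "I \<subseteq> insert x X" "card I = rank_of M (insert x X)" by (rule rank_obtain)
  have "I - {x} \<in> indeps M" using indep_mono[OF I(1)] by blast
  then have "card (I - {x}) \<le> rank_of M X" by (rule rank_ge) (use I in auto)
  moreover have "card I \<le> Suc (card (I - {x}))" by (simp add: card_Diff_singleton_if) linarith
  ultimately show "rank_of M (insert x X) \<le> Suc (rank_of M X)" using I(3) by simp
next
  fix X Y :: "'a set"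
  assume "X \<subseteq> Y"
  obtain I where I: "I \<in> indeps M" "I \<subseteq> X" "card I = rank_of M X" by (rule rank_obtain)
  then show "rank_of M X \<le> rank_of M Y" using rank_ge[of I Y] \<open>X \<subseteq> Y\<close> by auto
next
  fix X Y :: "'a set"
  obtain I where I: "I \<in> indeps M" "I \<subseteq> X \<inter> Y" "card I = rank_of M (X \<inter> Y)" by (rule rank_obtain)
  obtain J where J: "J \<in> indeps M" "I \<subseteq> J" "J \<subseteq> X \<union> Y" "card J = rank_of M (X \<union> Y)"
    using extend_indep[OF I(1), of "X \<union> Y"] I(2) by blast
  have fJ: "finite J" by (rule indep_finite[OF J(1)])
  have "J \<inter> X \<in> indeps M" "J \<inter> Y \<in> indeps M" using indep_mono[OF J(1)] by auto
  then have "card (J \<inter> X) \<le> rank_of M X" "card (J \<inter> Y) \<le> rank_of M Y" by (auto intro: rank_ge)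
  moreover have "card (J \<inter> X) + card (J \<inter> Y) = card ((J \<inter> X) \<union> (J \<inter> Y)) + card ((J \<inter> X) \<inter> (J \<inter> Y))"
    using fJ by (intro card_Un_Int) auto
  moreover have "(J \<inter> X) \<union> (J \<inter> Y) = J" using J(3) by blast
  moreover have "card I \<le> card ((J \<inter> X) \<inter> (J \<inter> Y))" using fJ I(2) J(2) by (intro card_mono) auto
  ultimately show "rank_of M (X \<union> Y) + rank_of M (X \<inter> Y) \<le> rank_of M X + rank_of M Y"
    using I(3) J(4) by simp
next
  fix X
  have "{I \<in> indeps M. I \<subseteq> X \<inter> ground M} = {I \<in> indeps M. I \<subseteq> X}" using indeps_subset by auto
  then show "rank_of M (X \<inter> ground M) = rank_of M X" by (simp add: rank_of_def)
qed

text \<open>The rank condition frees independence in the contraction from the chosen basis: a basis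
  of \<open>C\<close>, extended within \<open>C \<union> X\<close>, must take up all of
  \<open>X\<close>.\<close>

lemma contraction_indep_iff:
  assumes "C \<subseteq> ground M" "X \<subseteq> ground M - C"
  shows "X \<in> indeps (contraction M C) \<longleftrightarrow> rank_of M (C \<union> X) = rank_of M C + card X"
proof -
  interpret rank_function "ground M" "rank_of M" by (rule rank_function)
  have fX: "finite X" using assms finite_ground finite_subset by blast
  show ?thesis
  proof
    assume "X \<in> indeps (contraction M C)"
    then obtain B where B: "basis_of M C B" "X \<union> B \<in> indeps M" by (auto simp: contraction_def)
    have B': "B \<in> indeps M" "B \<subseteq> C" "\<forall>B'\<in>indeps M. B \<subseteq> B' \<and> B' \<subseteq> C \<longrightarrow> B' = B"
      using B(1) by (auto simp: basis_of_def)
    obtain J where J: "J \<in> indeps M" "B \<subseteq> J" "J \<subseteq> C" "card J = rank_of M C"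
      by (rule extend_indep[OF B'(1,2)])
    then have "card B = rank_of M C" using B'(3) by blast
    moreover have "card (X \<union> B) = card X + card B"
      using fX indep_finite[OF B'(1)] assms(2) B'(2) by (intro card_Un_disjoint) auto
    moreover have "card (X \<union> B) \<le> rank_of M (C \<union> X)" by (rule rank_ge[OF B(2)]) (use B'(2) in auto)
    moreover have "rank_of M (C \<union> X) \<le> rank_of M C + card X" by (rule r_union_le_card[OF fX])
    ultimately show "rank_of M (C \<union> X) = rank_of M C + card X" by simp
  next
    assume r: "rank_of M (C \<union> X) = rank_of M C + card X"
    obtain B where B: "B \<in> indeps M" "B \<subseteq> C" "card B = rank_of M C" by (rule rank_obtain)
    have "basis_of M C B"
      unfolding basis_of_def
    proof (intro conjI ballI impI B(1,2))
      fix B' assume B': "B' \<in> indeps M" "B \<subseteq> B' \<and> B' \<subseteq> C"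
      then have "card B' \<le> card B" using rank_ge[of B' C] B(3) by simp
      then show "B' = B" using B' indep_finite card_seteq[of B' B] by blast
    qed
    obtain J where J: "J \<in> indeps M" "B \<subseteq> J" "J \<subseteq> C \<union> X" "card J = rank_of M (C \<union> X)"
      using extend_indep[OF B(1), of "C \<union> X"] B(2) by blast
    have fJ: "finite J" by (rule indep_finite[OF J(1)])
    have "J \<inter> C \<in> indeps M" using indep_mono[OF J(1)] by blast
    then have "card (J \<inter> C) \<le> card B" using rank_ge[of "J \<inter> C" C] B(3) by simp
    then have JC: "J \<inter> C = B" using card_seteq[of "J \<inter> C" B] J(2) B(2) fJ by blast
    have "card J = card (J \<inter> C) + card (J - C)" by (rule card_Int_Diff[OF fJ])
    then have "card X \<le> card (J - C)" using J(4) r JC B(3) by simp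
    then have "J - C = X" using card_seteq[of X "J - C"] J(3) fX by blast
    then have "X \<union> B = J" using JC by blast
    then show "X \<in> indeps (contraction M C)"
      using \<open>basis_of M C B\<close> J(1) assms(2) by (auto simp: contraction_def)
  qed
qed

text \<open>Elements of \<open>C\<close> outside the ground set do not affect ranks, so
  \<open>C\<close> is cut down to the ground set; everything outside \<open>C\<close> and
  \<open>T\<close> is deleted.\<close>

lemma has_minorI:
  assumes T: "T \<subseteq> ground M" "T \<inter> C = {}" and f: "bij_betw f T (ground N)"
    and X: "\<And>X. X \<subseteq> T \<Longrightarrow> rank_of M (C \<union> X) = rank_of M C + card X \<longleftrightarrow> f ` X \<in> indeps N"
  shows "has_minor M N"
proof -
  interpret rank_function "ground M" "rank_of M" by (rule rank_function)
  let ?C = "C \<inter> ground M"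
  let ?D = "ground M - ?C - T"
  have g: "ground (deletion (contraction M ?C) ?D) = T" using T by (auto simp: deletion_def contraction_def)
  have "X \<in> indeps (deletion (contraction M ?C) ?D) \<longleftrightarrow> f ` X \<in> indeps N" if XT: "X \<subseteq> T" for X
  proof -
    have "X \<in> indeps (deletion (contraction M ?C) ?D) \<longleftrightarrow> X \<in> indeps (contraction M ?C)"
      using XT by (auto simp: deletion_def)
    also have "\<dots> \<longleftrightarrow> rank_of M (?C \<union> X) = rank_of M ?C + card X"
      by (rule contraction_indep_iff) (use XT T in auto)
    also have "rank_of M (?C \<union> X) = rank_of M (C \<union> X)"
    proof -
      have "?C \<union> X = (C \<union> X) \<inter> ground M" using XT T by auto
      then show ?thesis by (simp add: r_restrict)
    qed
    also have "rank_of M ?C = rank_of M C" by (rule r_restrict)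
    also have "rank_of M (C \<union> X) = rank_of M C + card X \<longleftrightarrow> f ` X \<in> indeps N" by (rule X[OF XT])
    finally show ?thesis .
  qed
  then have "matroid_iso (deletion (contraction M ?C) ?D) N"
    unfolding matroid_iso_def g using f by blast
  then show ?thesis unfolding has_minor_def using T by (intro exI[of _ ?C] exI[of _ ?D]) auto
qed

text \<open>In any \<open>l + 2\<close> pairwise nonparallel points of a rank-2 contraction, exactly
  the sets of at most two points are independent.\<close>

lemma line_bounded:
  assumes "\<not> has_minor M (uniform_matroid 2 (l + 2))" "0 < l"
  shows "line_bounded (ground M) (rank_of M) l"
proof -
  interpret rank_function "ground M" "rank_of M" by (rule rank_function)
  show ?thesis
  proof
    fix C S assume S: "simple C S" "rank_of M (C \<union> S) \<le> rank_of M C + 2"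
    show "card S \<le> l + 1"
    proof (rule ccontr)
      assume "\<not> ?thesis"
      then have "l + 2 \<le> card S" by simp
      then obtain T where T: "T \<subseteq> S" "card T = l + 2" by (meson obtain_subset_with_card_n)
      have sT: "simple C T" by (rule simple_subset[OF S(1) T(1)])
      have fT: "finite T" by (rule simple_finite[OF sT])
      obtain f where f: "bij_betw f T {..<l + 2}"
        using ex_bij_betw_finite_nat[OF fT] T(2) by (auto simp: atLeast0LessThan)
      have "has_minor M (uniform_matroid 2 (l + 2))"
      proof (rule has_minorI)
        show "T \<subseteq> ground M" by (rule simple_in_E[OF sT])
        show "T \<inter> C = {}" using sT in_clI by (auto simp: simple_def)
        show "bij_betw f T (ground (uniform_matroid 2 (l + 2)))" using f by (simp add: uniform_matroid_def)
        fix X assume X: "X \<subseteq> T"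
        have fX: "finite X" by (rule finite_subset[OF X fT])
        have "inj_on f X" using f X by (auto simp: bij_betw_def intro: inj_on_subset)
        then have "card (f ` X) = card X" by (rule card_image)
        moreover have "f ` X \<subseteq> {..<l + 2}" using f X by (auto simp: bij_betw_def)
        ultimately have iff: "f ` X \<in> indeps (uniform_matroid 2 (l + 2)) \<longleftrightarrow> card X \<le> 2"
          by (simp add: uniform_matroid_def)
        have "rank_of M (C \<union> X) \<le> rank_of M (C \<union> S)" using X T by (intro r_mono) auto
        then have "card X \<le> 2" if "rank_of M (C \<union> X) = rank_of M C + card X" using that S(2) by simp
        moreover have "rank_of M (C \<union> X) = rank_of M C + card X" if "card X \<le> 2"
        proof -
          consider "card X = 0" | "card X = 1" | "card X = 2" using \<open>card X \<le> 2\<close> by linarith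
          then show ?thesis
          proof cases
            case 1
            then show ?thesis using fX by simp
          next
            case 2
            then obtain x where "X = {x}" by (auto simp: card_1_singleton_iff)
            then show ?thesis using sT X by (simp add: simple_def r_insert_notin)
          next
            case 3
            then obtain x y where xy: "X = {x, y}" "x \<noteq> y" unfolding card_2_iff by blast
            then have "pw C x y" using X by (intro simple_pw[OF sT]) auto
            then show ?thesis using xy 3 by (simp add: pw_def)
          qed
        qed
        ultimately show "rank_of M (C \<union> X) = rank_of M C + card X \<longleftrightarrow> f ` X \<in> indeps (uniform_matroid 2 (l + 2))"
          using iff by blast
      qed
      then show False using assms(1) by blast
    qed
  qed (rule assms(2))
qed

text \<open>A rank-1 flat is the closure of any nonloop in it. The closure has to be cut with the
  ground set, since \<open>cl\<close> contains all elements outside of it.\<close>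

lemma points_transversal:
  obtains S where "rank_function.simple (rank_of M) {} S" "card S = num_points M"
proof -
  interpret rank_function "ground M" "rank_of M" by (rule rank_function)
  let ?F = "{F. flat M F \<and> rank_of M F = 1}"
  have ex: "\<exists>x\<in>F. x \<notin> cl {}" if "F \<in> ?F" for F
  proof (rule ccontr)
    assume "\<not> ?thesis"
    then have "rank_of M F \<le> rank_of M {}" by (intro r_le_of_subset_cl) auto
    then show False using that r_empty by simp
  qed
  then obtain x where x: "\<And>F. F \<in> ?F \<Longrightarrow> x F \<in> F \<and> x F \<notin> cl {}" by metis
  have r1: "rank_of M {x F} = 1" if "F \<in> ?F" for F
    using x[OF that] r_insert_notin[of "x F" "{}"] r_empty by simp
  have flat_eq: "F = cl {x F} \<inter> ground M" if F: "F \<in> ?F" for F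
  proof
    have "insert y {x F} \<subseteq> F" if "y \<in> F" for y using that x[OF F] by auto
    then have "rank_of M (insert y {x F}) \<le> 1" if "y \<in> F" for y
      using that F r_mono[of "insert y {x F}" F] by fastforce
    then have "y \<in> cl {x F}" if "y \<in> F" for y
      using that r1[OF F] r_le_insert[of "{x F}" y] by (fastforce simp: cl_iff)
    then show "F \<subseteq> cl {x F} \<inter> ground M" using F by (auto simp: flat_def)
    show "cl {x F} \<inter> ground M \<subseteq> F"
    proof
      fix y assume y: "y \<in> cl {x F} \<inter> ground M"
      then have "y \<in> cl F" using x[OF F] cl_mono[of "{x F}" F] by auto
      then have "\<not> rank_of M F < rank_of M (insert y F)" by (simp add: cl_iff)
      then show "y \<in> F" using y F by (auto simp: flat_def)
    qed
  qed
  have eq: "F = F'" if F: "F \<in> ?F" "F' \<in> ?F" "x F' \<in> cl {x F}" for F F'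
  proof -
    have "x F \<in> cl (insert (x F') {})"
      by (rule cl_exchange[OF F(3)]) (use x[OF F(2)] in blast)
    then have "cl {x F} = cl {x F'}"
      using F(3) by (intro equalityI cl_subset_clI) simp_all
    then show ?thesis using flat_eq[OF F(1)] flat_eq[OF F(2)] by simp
  qed
  show thesis
  proof (rule that)
    show "simple {} (x ` ?F)"
      unfolding simple_def
    proof (intro conjI ballI impI)
      fix u assume "u \<in> x ` ?F"
      then show "u \<notin> cl {}" using x by blast
    next
      fix u v assume "u \<in> x ` ?F" "v \<in> x ` ?F" and ne: "u \<noteq> v"
      then obtain F F' where F: "F \<in> ?F" "u = x F" "F' \<in> ?F" "v = x F'" by blast
      have "v \<notin> cl {u}" using eq[OF F(1,3)] F ne by auto
      then show "pw {} u v" using x F by (simp add: pw_iff)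
    qed
    have "inj_on x ?F" by (intro inj_onI eq) (auto intro: in_clI)
    then show "card (x ` ?F) = num_points M" by (simp add: card_image num_points_def)
  qed
qed

end

section \<open>Choice of the densest minor, numerical estimates and assembly\<close>

lemma (in line_bounded) densest_pair:
  assumes "simple C0 S0" "S0 \<noteq> {}"
  obtains C S and q :: real where "simple C S" "S \<noteq> {}" "adjsC C S = q * card S"
    "\<And>C' S'. simple C' S' \<Longrightarrow> adjsC C' S' \<le> q * card S'" "real (adjsC C0 S0) / card S0 \<le> q"
proof -
  let ?R = "{(C, S). simple C S \<and> S \<noteq> {}}"
  have cS: "card S \<le> card E" "adjsC C S \<le> card E * card E" if "simple C S" for C S
  proof -
    show c: "card S \<le> card E" using simple_in_E[OF that] finite_E by (rule card_mono[rotated])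
    have "adjsC C S \<le> card S * card S" by (rule card_adj_pairs_le[OF simple_finite[OF that]])
    also have "\<dots> \<le> card E * card E" using c by (intro mult_mono) auto
    finally show "adjsC C S \<le> card E * card E" .
  qed
  have bounds: "adjsC (fst x) (snd x) \<le> card E * card E" "card (snd x) \<le> card E" if "x \<in> ?R" for x
    using cS that by auto
  have "(C0, S0) \<in> ?R" using assms by auto
  then obtain x where x: "x \<in> ?R"
    "\<And>y. y \<in> ?R \<Longrightarrow> real (adjsC (fst y) (snd y)) / card (snd y) \<le> real (adjsC (fst x) (snd x)) / card (snd x)"
    by (rule max_ratio_attained[OF _ bounds]) (assumption | rule that)+
  obtain C S where CS: "x = (C, S)" by (cases x)
  have S: "simple C S" "S \<noteq> {}" using x(1) CS by auto
  have max: "real (adjsC C' S') / card S' \<le> real (adjsC C S) / card S" if "simple C' S'" "S' \<noteq> {}" for C' S'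
    using x(2)[of "(C', S')"] that CS by simp
  show thesis
  proof (rule that[OF S])
    have "0 < card S" using S simple_finite by (simp add: card_gt_0_iff)
    then show "real (adjsC C S) = real (adjsC C S) / card S * card S" by simp
    show "real (adjsC C0 S0) / card S0 \<le> real (adjsC C S) / card S" by (rule max[OF assms])
    fix C' S' assume S': "simple C' S'"
    show "real (adjsC C' S') \<le> real (adjsC C S) / card S * card S'"
    proof (cases "S' = {}")
      case False
      then have "0 < card S'" using S' simple_finite by (simp add: card_gt_0_iff)
      then show ?thesis using max[OF S' False] by (simp add: pos_divide_le_eq)
    qed (simp add: adj_pairs_def)
  qed
qed

lemma half_le_ln: "2 \<le> x \<Longrightarrow> 1 / 2 \<le> ln (x :: real)"
proof -
  assume x: "2 \<le> x"
  have "ln (1 / x) \<le> 1 / x - 1" using x by (intro ln_le_minus_one) simp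
  moreover have "1 / x \<le> 1 / 2" using x by (intro divide_left_mono) auto
  moreover have "ln (1 / x) = - ln x" using x by (simp add: ln_div)
  ultimately show ?thesis by linarith
qed

text \<open>All factors are turned into powers of \<open>l\<close>: \<open>1280000 <= 2^21\<close>,
  and \<open>n <= 2^n\<close>. The subtracted 1 is paid for by one spare factor
  \<open>l >= 2\<close>, hence the exponent \<open>1936 * x ^ 2 - 1\<close>.\<close>

lemma density_bound:
  fixes l t x n :: nat
  assumes l: "2 \<le> l" and t: "2 \<le> t"
  defines "x \<equiv> (l - 1) * t ^ 2" and "n \<equiv> 60 * ((l - 1) * t ^ 2) + 1"
  shows "1280000 * n * real (l ^ (n + (n choose 2))) * real l ^ 6
    \<le> real l powr (8 * 22\<^sup>2 * (real l - 1)\<^sup>2 * real t ^ 4 * ln (real t)) - 1"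
proof -
  have n: "n = 60 * x + 1" by (simp add: n_def x_def)
  have "4 \<le> t ^ 2" using power_mono[OF t, of 2] by simp
  then have x4: "4 \<le> x" unfolding x_def using mult_mono[of 1 "l - 1" 4 "t ^ 2"] l by simp
  have rx: "real x = (real l - 1) * real t ^ 2" using l by (simp add: x_def of_nat_diff)
  let ?L = "real l"
  have L: "1 \<le> ?L" using l by simp
  have ch: "n + (n choose 2) = 1800 * x ^ 2 + 90 * x + 1"
    unfolding choose_two n by (simp add: power2_eq_square algebra_simps)
  have "(1280000 :: real) \<le> 2 ^ 21" by simp
  also have "\<dots> \<le> ?L ^ 21" using l by (intro power_mono) auto
  finally have c: "1280000 \<le> ?L ^ 21" .
  have "n < 2 ^ n" by (rule less_exp)
  then have "real n \<le> 2 ^ n" using of_nat_mono[of n "2 ^ n", where 'a = real] by simp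
  also have "\<dots> \<le> ?L ^ n" using l by (intro power_mono) auto
  finally have nn: "real n \<le> ?L ^ n" .
  have "1280000 * n * real (l ^ (n + (n choose 2))) * ?L ^ 6
    \<le> ?L ^ 21 * ?L ^ n * ?L ^ (n + (n choose 2)) * ?L ^ 6"
    unfolding of_nat_power of_nat_mult of_nat_numeral using L
    by (intro mult_right_mono[OF mult_right_mono[OF mult_mono[OF c nn]]]) auto
  also have "\<dots> = ?L ^ (21 + n + (n + (n choose 2)) + 6)" by (simp only: power_add)
  \<comment> \<open>The exponent equals \<open>1800 * x^2 + 150 * x + 29\<close>, and
    \<open>x >= 4\<close> leaves ample room below \<open>1936 * x^2 - 1\<close>.\<close>
  also have "\<dots> \<le> ?L ^ (1936 * x ^ 2 - 1)"
  proof (rule power_increasing[OF _ L])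
    have "4 * x \<le> x ^ 2" using x4 by (simp add: power2_eq_square)
    then have "150 * x + 30 \<le> 136 * x ^ 2" using x4 by linarith
    then show "21 + n + (n + (n choose 2)) + 6 \<le> 1936 * x ^ 2 - 1" using ch n by linarith
  qed
  finally have A: "1280000 * n * real (l ^ (n + (n choose 2))) * ?L ^ 6 \<le> ?L ^ (1936 * x ^ 2 - 1)" .
  have "0 < 1936 * x ^ 2" using x4 by simp
  then have S: "?L ^ (1936 * x ^ 2) = ?L * ?L ^ (1936 * x ^ 2 - 1)" by (subst power_Suc[symmetric]) simp
  have "1 \<le> ?L ^ (1936 * x ^ 2 - 1)" using L by (rule one_le_power)
  moreover have "2 * ?L ^ (1936 * x ^ 2 - 1) \<le> ?L * ?L ^ (1936 * x ^ 2 - 1)"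
    using l by (intro mult_right_mono) auto
  ultimately have B: "?L ^ (1936 * x ^ 2 - 1) \<le> ?L ^ (1936 * x ^ 2) - 1" using S by linarith
  have "?L ^ (1936 * x ^ 2) = ?L powr real (1936 * x ^ 2)" 
    by (rule powr_realpow[symmetric]) (use l in simp)
  also have "\<dots> \<le> ?L powr (8 * 22\<^sup>2 * (?L - 1)\<^sup>2 * real t ^ 4 * ln (real t))"
  proof (rule powr_mono[OF _ L])
    have "real (1936 * x ^ 2) = 3872 * real x ^ 2 * (1 / 2)" by simp
    also have "\<dots> \<le> 3872 * real x ^ 2 * ln (real t)"
      using half_le_ln[of "real t"] t by (intro mult_left_mono) auto
    also have "\<dots> = 8 * 22\<^sup>2 * (?L - 1)\<^sup>2 * real t ^ 4 * ln (real t)"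
      unfolding rx by (simp add: power_mult_distrib flip: power_mult)
    finally show "real (1936 * x ^ 2) \<le> 8 * 22\<^sup>2 * (?L - 1)\<^sup>2 * real t ^ 4 * ln (real t)" .
  qed
  finally show ?thesis using A B by linarith
qed

lemma (in line_bounded) dense_clique_model:
  fixes d :: real and t :: nat
  assumes t: "2 \<le> t" and S0: "simple {} S0" "card S0 > d * r E"
    and d: "d = real l powr (8 * 22\<^sup>2 * (real l - 1)\<^sup>2 * real t ^ 4 * ln (real t))"
  obtains C g where "inj_on g (complete_graph_edges t)"
    "\<And>X. X \<subseteq> complete_graph_edges t \<Longrightarrow> ind C (g ` X) \<longleftrightarrow> \<not> (\<exists>Y\<subseteq>X. cycle_edge_set Y)"
    "\<And>e. e \<in> complete_graph_edges t \<Longrightarrow> g e \<notin> cl C"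
proof -
  have d1: "1 \<le> d" unfolding d using l_pos t by (intro ge_one_powr_ge_zero) auto
  obtain C S where S: "simple C S" "S \<noteq> {}" "\<And>e. e \<in> S \<Longrightarrow> deg_in (adj C) S e > d - 1"
    by (rule dense_min_degree[OF S0]) (use d1 in auto)
  have fS: "finite S" by (rule simple_finite[OF S(1)])
  \<comment> \<open>Positive degree gives a line with three points, more than the two allowed for
    \<open>l = 1\<close>.\<close>
  have l2: "2 \<le> l"
  proof (rule ccontr)
    assume "\<not> ?thesis"
    then have l: "l = 1" using l_pos by simp
    obtain e where e: "e \<in> S" using S(2) by blast
    then have "0 < deg_in (adj C) S e" using S(3)[OF e] d1 by linarith
    then obtain y where "adj C e y" unfolding deg_in_def by (auto simp: card_gt_0_iff)
    then obtain z where z: "tri C e y z" by (auto simp: adj_def)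
    have n: "e \<noteq> y" "e \<noteq> z" "y \<noteq> z" using tri_neq[OF z] by auto
    have "simple C {e, y, z}"
      using z by (auto simp: simple_def tri_iff pw_commute dest: pwD)
    moreover have "r (C \<union> {e, y, z}) \<le> r C + 2" using z by (simp add: tri_def)
    ultimately have "card {e, y, z} \<le> l + 1" by (rule line_bound)
    then show False using n l by simp
  qed
  let ?x = "(l - 1) * t ^ 2"
  define n where "n = 60 * ?x + 1"
  have big: "1280000 * n * real (l ^ (n + (n choose 2))) * real l ^ 6 \<le> d - 1"
    unfolding d n_def by (rule density_bound[OF l2 t])
  obtain C1 S1 and q :: real where S1: "simple C1 S1" "S1 \<noteq> {}" "adjsC C1 S1 = q * card S1"
    "\<And>C' S'. simple C' S' \<Longrightarrow> adjsC C' S' \<le> q * card S'" "real (adjsC C S) / card S \<le> q"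
    by (rule densest_pair[OF S(1,2)]) (rule that)
  have "(\<Sum>e\<in>S. d - 1) \<le> (\<Sum>e\<in>S. real (deg_in (adj C) S e))"
    using S(3) by (intro sum_mono less_imp_le) auto
  then have "card S * (d - 1) \<le> adjsC C S" by (simp add: card_adj_pairs[OF fS])
  moreover have "0 < card S" using fS S(2) by (simp add: card_gt_0_iff)
  ultimately have "d - 1 \<le> real (adjsC C S) / card S" by (simp add: pos_le_divide_eq mult.commute)
  then have q: "1280000 * n * real (l ^ (n + (n choose 2))) * real l ^ 6 \<le> q" using S1(5) big by linarith
  have n1: "1 \<le> n" by (simp add: n_def)
  have "64 * real l ^ 2 \<le> 1280000 * 1 * 1 * real l ^ 6"
  proof -
    have "real l ^ 2 \<le> real l ^ 6" using l2 by (intro power_increasing) auto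
    moreover have "0 \<le> real l ^ 6" by simp
    ultimately show ?thesis by linarith
  qed
  also have "\<dots> \<le> 1280000 * n * real (l ^ (n + (n choose 2))) * real l ^ 6"
    using n1 l2 by (intro mult_mono) auto
  finally have q64: "64 * real l ^ 2 \<le> q" using q by linarith
  obtain V where V: "simple C1 V" "card V \<le> 2 * q" "q ^ 2 / (100 * real l ^ 3) \<le> adjsC C1 V"
    by (rule locally_dense[OF S1(1-4) q64])
  obtain C2 X where X: "ind C2 X" "card X = n" "\<And>x y. x \<in> X \<Longrightarrow> y \<in> X \<Longrightarrow> x \<noteq> y \<Longrightarrow> adj C2 x y"
    by (rule clique_of_locally_dense[OF V l2 n1 q]) (rule that)
  obtain P where P: "frame C2 X P" "card P = card X choose 2" by (rule clique_frame[OF X(1,3)])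
  have x1: "1 \<le> ?x" using l2 t by simp
  \<comment> \<open>The density \<open>(n choose 2) / n\<close> is
    \<open>(n - 1) / 2 = 30 * ?x\<close>.\<close>
  have "n choose 2 = (60 * ?x + 1) * (30 * ?x)" unfolding choose_two n_def by simp
  then have cP: "card P = n * (30 * ?x)" using P(2) X(2) by (simp add: n_def)
  have Xne: "X \<noteq> {}" using X(2) n1 by auto
  have Pne: "P \<noteq> {}" using cP n1 x1 by auto
  obtain C3 B Q b and R :: real where F: "frame C3 B Q" "b \<in> B" "real (card P) / card X \<le> R"
    "star C3 B Q b \<noteq> {}" "card (star C3 B Q b) \<le> 2 * R"
    "\<And>p. p \<in> star C3 B Q b \<Longrightarrow> R - real (l - 1) \<le> deg_in (star_adj C3 B b) (star C3 B Q b) p"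
    by (rule extremal_frame[OF P(1) Xne Pne]) (rule that)
  have R: "real (30 * ?x) \<le> R" using F(3) cP X(2) n1 by simp
  define k where "k = t - 1"
  define N where "N = k + 3 + 3 * (k choose 2)"
  \<comment> \<open>With \<open>k = t - 1\<close> the left side is
    \<open>3 * t^2 - 7 * t + 10\<close>, so \<open>t >= 2\<close> suffices; this makes
    \<open>30 * ?x\<close> at least \<open>20 * (l - 1) * N\<close>.\<close>
  have "2 * N \<le> 3 * t ^ 2"
  proof -
    obtain j where j: "t = j + 2" using t le_Suc_ex by (metis add.commute)
    have k: "k = Suc j" by (simp add: k_def j)
    have "even (Suc j * j)" by simp
    then have "2 * (k choose 2) = Suc j * j" unfolding choose_two k by simp
    then have "2 * N = 2 * Suc j + 6 + 3 * (Suc j * j)" unfolding N_def using k by simp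
    then show ?thesis unfolding j by (simp add: power2_eq_square algebra_simps)
  qed
  then have "(l - 1) * (10 * (2 * N)) \<le> (l - 1) * (10 * (3 * t ^ 2))" by (intro mult_left_mono) auto
  then have "real ((l - 1) * (10 * (2 * N))) \<le> real ((l - 1) * (10 * (3 * t ^ 2)))" by (rule of_nat_mono)
  moreover have "real ((l - 1) * (10 * (2 * N))) = 20 * real (l - 1) * real N"
    "real ((l - 1) * (10 * (3 * t ^ 2))) = real (30 * ?x)" by simp_all
  ultimately have R': "20 * real (l - 1) * real N \<le> R" using R by linarith
  obtain C4 A H where A: "card A = k" "ind C4 A" "C4 \<subseteq> cl H" "\<And>a. a \<in> A \<Longrightarrow> a \<notin> cl H"
    "\<And>a a'. a \<in> A \<Longrightarrow> a' \<in> A \<Longrightarrow> a \<noteq> a' \<Longrightarrow> \<exists>f\<in>cl H. f \<in> cl (insert a (insert a' C4)) \<and> f \<notin> cl C4"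
    by (rule star_model[OF F(1,2,4,5,6) l2 R', where k = k]) (assumption, simp add: N_def, rule that)
  have "t = Suc k" using t by (simp add: k_def)
  moreover obtain g where "inj_on g (complete_graph_edges (Suc k))"
    "\<And>X. X \<subseteq> complete_graph_edges (Suc k) \<Longrightarrow> ind C4 (g ` X) \<longleftrightarrow> \<not> (\<exists>Y\<subseteq>X. cycle_edge_set Y)"
    "\<And>e. e \<in> complete_graph_edges (Suc k) \<Longrightarrow> g e \<notin> cl C4"
    by (rule clique_representation[OF A]) (assumption | rule that)+
  ultimately show thesis using that[of g C4] by simp
qed

theorem theorem7p8:
  fixes l t :: nat and C :: real and M :: "'a matroid"
  assumes "l > 0"
    and "t > 0"
    and "C = 8 * 22\<^sup>2"
    and "finite_matroid M"
    and "\<not> has_minor M (uniform_matroid 2 (l + 2))"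
    and "real (num_points M) >
      real l powr (C * (real l - 1)\<^sup>2 * real t ^ 4 * ln (real t)) * real (matroid_rank M)"
  shows "has_minor M (cycle_matroid (complete_graph_edges t))"
proof -
  interpret finite_matroid M by fact
  interpret line_bounded "ground M" "rank_of M" l by (rule line_bounded[OF assms(5,1)])
  let ?K = "complete_graph_edges t"
  show ?thesis
  proof (cases "t = 1")
    \<comment> \<open>\<open>K_1\<close> has no edges, so its cycle matroid is empty and arises by
      deleting everything.\<close>
    case True
    have "e \<notin> ?K" for e
    proof
      assume "e \<in> ?K"
      then have "e \<subseteq> {0}" "card e = 2" using True by (auto simp: complete_graph_edges_def)
      then show False using card_mono[of "{0}" e] by auto
    qed
    then have K: "?K = {}" by blast
    have "\<not> cycle_edge_set ({} :: nat set set)" by (auto simp: cycle_edge_set_iff)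
    then show ?thesis
      by (intro has_minorI[of "{}" "{}" "\<lambda>_. undefined"]) (auto simp: K cycle_matroid_def bij_betw_def)
  next
    case False
    then have t: "2 \<le> t" using assms(2) by simp
    obtain S where S: "simple {} S" "card S = num_points M" by (rule points_transversal)
    have "real l powr (8 * 22\<^sup>2 * (real l - 1)\<^sup>2 * real t ^ 4 * ln (real t)) * rank_of M (ground M) < card S"
      using assms(3,6) S(2) by (simp add: matroid_rank_def)
    then obtain C g where g: "inj_on g ?K"
      "\<And>X. X \<subseteq> ?K \<Longrightarrow> ind C (g ` X) \<longleftrightarrow> \<not> (\<exists>Y\<subseteq>X. cycle_edge_set Y)"
      "\<And>e. e \<in> ?K \<Longrightarrow> g e \<notin> cl C"
      by (rule dense_clique_model[OF t S(1) _ refl]) (rule that)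
    have bij: "bij_betw (the_inv_into ?K g) (g ` ?K) ?K"
      by (rule bij_betw_the_inv_into[OF inj_on_imp_bij_betw[OF g(1)]])
    show ?thesis
    proof (rule has_minorI[of "g ` ?K" C "the_inv_into ?K g"])
      show "g ` ?K \<subseteq> ground M" using g(3) notin_E_in_cl by blast
      show "g ` ?K \<inter> C = {}" using g(3) in_clI by blast
      show "bij_betw (the_inv_into ?K g) (g ` ?K) (ground (cycle_matroid ?K))"
        using bij by (simp add: cycle_matroid_def)
      fix X assume "X \<subseteq> g ` ?K"
      then obtain Y where Y: "Y \<subseteq> ?K" "X = g ` Y" by (auto simp: subset_image_iff)
      have "finite ?K" by (rule finite_subset[of _ "Pow {..<t}"]) (auto simp: complete_graph_edges_def)
      then have "finite X" using Y finite_subset by blast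
      moreover have "the_inv_into ?K g ` X = Y"
        unfolding Y(2) image_image using Y(1) the_inv_into_f_f[OF g(1)] by (simp add: subset_iff)
      moreover have "Y \<in> indeps (cycle_matroid ?K) \<longleftrightarrow> ind C X"
        using g(2)[OF Y(1)] Y by (simp add: cycle_matroid_def)
      ultimately show "rank_of M (C \<union> X) = rank_of M C + card X
          \<longleftrightarrow> the_inv_into ?K g ` X \<in> indeps (cycle_matroid ?K)"
        by (simp add: ind_def)
    qed
  qed
qed

end
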